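(* Choose $n$ points independently and uniformly from the unit sphere $\mathbb{S}^{d-1}$ and denote their convex hull by $P_{n,d}$. Let $B^d$ be the unit ball of $\mathbb{R}^d$, $d_H$ the Hausdorff distance, and $H_{\min}$ the smallest height of the facets of $P_{n,d}$. (i) Suppose $\ln n\gg d$. This condition allows for fixed $d$ or $d\to\infty$. Then $$ d_H(P_{n,d},B^d)=1-H_{\min}\xrightarrow{P}0, $$ and if additionally $\ln\ln n\ll d$, then $$ 2\,n^{\frac{2}{d-1}}\,d_H(P_{n,d},B^d)\xrightarrow{P}1. $$ (ii) Suppose $(\ln n)/d\to\rho$ for $\rho\in(0,\infty)$. Then $$ d_H(P_{n,d},B^d)=1-H_{\min}\xrightarrow{P}1-\sqrt{1-e^{-2\rho}}. $$ (iii) Suppose $\ln n\ll d$. Then $$ d_H(P_{n,d},B^d)=1-H_{\min}\xrightarrow{P}1. $$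
   Context: Asymptotic setting: $\mathbb{N}\ni n\to\infty$ and $d=d(n)\in\{2,\ldots,n-1\}$ is a function of $n$ which is either constant or tends to infinity. All limits are as $n\to\infty$, and $\xrightarrow{P}$ denotes convergence in probability. The notation $f\ll g$ (equivalently $g\gg f$) means $f(n)/g(n)\to0$. A facet ($(d-1)$-dimensional face) of $P_{n,d}$ has height $h\in[-1,1]$ if its supporting hyperplane is $\{x\in\mathbb{R}^d:\langle x,u\rangle=h\}$ for some $u\in\mathbb{S}^{d-1}$ and $P_{n,d}\subset\{x:\langle x,u\rangle\le h\}$ (heights can be negative).
   Formalization: The identity d_H = 1 − H_min can fail when the origin lies outside P_{n,d}; it is proved almost surely when 0 ∈ P_{n,d}, and with probability tending to 1 in (i) and (ii). In (i)–(iii) both d_H and 1 − H_min are shown to converge in probability to the stated limit. *)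

theory Defs
  imports "HOL-Probability.Probability"
begin

text \<open>
  The dimension varies along the sequence of polytopes, so it cannot be a type. All spaces
  \<open>\<real>\<^sup>d\<close> are therefore placed inside one inner product space, the finitely supported real
  sequences with the Euclidean inner product; \<open>\<real>\<^sup>d\<close> is the subspace \<open>euc d\<close> of the
  sequences that vanish from index \<open>d\<close> on.
\<close>

typedef fseq = "{f :: nat \<Rightarrow> real. finite {i. f i \<noteq> 0}}"
  morphisms coord Abs_fseq
  by (rule exI[of _ "\<lambda>_. 0"]) simp

setup_lifting type_definition_fseq

lemma finite_coord [simp]: "finite {i. coord x i \<noteq> 0}"
  using coord[of x] by simp

lemma fseq_eqI: "(\<And>i. coord x i = coord y i) \<Longrightarrow> x = y"
  by (simp add: coord_inject[symmetric] ext)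

instantiation fseq :: real_vector
begin

lift_definition zero_fseq :: fseq is "\<lambda>_. 0" by simp

lift_definition plus_fseq :: "fseq \<Rightarrow> fseq \<Rightarrow> fseq" is "\<lambda>f g i. f i + g i"
  by (erule (1) finite_subset[OF _ finite_UnI, rotated]) auto

lift_definition minus_fseq :: "fseq \<Rightarrow> fseq \<Rightarrow> fseq" is "\<lambda>f g i. f i - g i"
  by (erule (1) finite_subset[OF _ finite_UnI, rotated]) auto

lift_definition uminus_fseq :: "fseq \<Rightarrow> fseq" is "\<lambda>f i. - f i" by simp

lift_definition scaleR_fseq :: "real \<Rightarrow> fseq \<Rightarrow> fseq" is "\<lambda>c f i. c * f i"
  by (rule finite_subset) auto

instance
  by standard (transfer; simp add: fun_eq_iff algebra_simps)+

end

lemma coord_simps [simp]: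
  "coord 0 i = 0"
  "coord (x + y) i = coord x i + coord y i"
  "coord (x - y) i = coord x i - coord y i"
  "coord (- x) i = - coord x i"
  "coord (c *\<^sub>R x) i = c * coord x i"
  by (transfer; simp)+

instantiation fseq :: real_inner
begin

definition inner_fseq :: "fseq \<Rightarrow> fseq \<Rightarrow> real"
  where "inner_fseq x y = (\<Sum>i | coord x i \<noteq> 0. coord x i * coord y i)"

definition norm_fseq :: "fseq \<Rightarrow> real"
  where "norm_fseq x = sqrt (inner x x)"

definition dist_fseq :: "fseq \<Rightarrow> fseq \<Rightarrow> real"
  where "dist_fseq x y = norm (x - y)"

definition sgn_fseq :: "fseq \<Rightarrow> fseq"
  where "sgn_fseq x = inverse (norm x) *\<^sub>R x"

definition uniformity_fseq :: "(fseq \<times> fseq) filter"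
  where "uniformity_fseq = (INF e\<in>{0<..}. principal {(x, y). dist x y < e})"

definition open_fseq :: "fseq set \<Rightarrow> bool"
  where "open_fseq U \<longleftrightarrow> (\<forall>x\<in>U. \<forall>\<^sub>F (x', y) in uniformity. x' = x \<longrightarrow> y \<in> U)"

lemma inner_fseq_superset:
  assumes "finite A" "\<And>i. i \<notin> A \<Longrightarrow> coord x i = 0 \<or> coord y i = 0"
  shows "inner x y = (\<Sum>i\<in>A. coord x i * coord y i)"
proof -
  have "inner x y = (\<Sum>i\<in>A \<union> {i. coord x i \<noteq> 0}. coord x i * coord y i)"
    unfolding inner_fseq_def by (rule sum.mono_neutral_left) (use assms in auto)
  also have "\<dots> = (\<Sum>i\<in>A. coord x i * coord y i)"
    by (rule sum.mono_neutral_right) (use assms in auto)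
  finally show ?thesis .
qed

instance
proof
  fix x y z :: fseq and r :: real
  show "dist x y = norm (x - y)" "sgn x = inverse (norm x) *\<^sub>R x" "norm x = sqrt (inner x x)"
    by (rule dist_fseq_def sgn_fseq_def norm_fseq_def)+
  show "(uniformity :: (fseq \<times> fseq) filter) = (INF e\<in>{0<..}. principal {(x, y). dist x y < e})"
    by (rule uniformity_fseq_def)
  show "open U = (\<forall>x\<in>U. \<forall>\<^sub>F (x', y) in uniformity. x' = x \<longrightarrow> y \<in> U)" for U :: "fseq set"
    by (rule open_fseq_def)
  let ?A = "{i. coord x i \<noteq> 0} \<union> {i. coord y i \<noteq> 0} \<union> {i. coord z i \<noteq> 0}"
  have sup: "inner a b = (\<Sum>i\<in>?A. coord a i * coord b i)"
    if "\<And>i. i \<notin> ?A \<Longrightarrow> coord a i = 0 \<or> coord b i = 0" for a b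
    by (rule inner_fseq_superset) (use that in auto)
  show "inner x y = inner y x"
    by (subst (1 2) sup) (auto simp: mult.commute)
  show "inner (x + y) z = inner x z + inner y z"
    by (subst (1 2 3) sup) (auto simp: sum.distrib algebra_simps)
  show "inner (r *\<^sub>R x) y = r * inner x y"
    by (subst (1 2) sup) (auto simp: sum_distrib_left algebra_simps)
  show "0 \<le> inner x x"
    unfolding inner_fseq_def by (rule sum_nonneg) simp
  show "inner x x = 0 \<longleftrightarrow> x = 0"
  proof
    assume "inner x x = 0"
    then have "\<forall>i\<in>{i. coord x i \<noteq> 0}. coord x i * coord x i = 0"
      unfolding inner_fseq_def by (subst (asm) sum_nonneg_eq_0_iff) auto
    then show "x = 0" by (intro fseq_eqI) auto
  qed (simp add: inner_fseq_def)
qed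

end

definition euc :: "nat \<Rightarrow> fseq set"
  where "euc d = {x. \<forall>i\<ge>d. coord x i = 0}"

definition embed :: "nat \<Rightarrow> (nat \<Rightarrow> real) \<Rightarrow> fseq"
  where "embed d f = Abs_fseq (\<lambda>i. if i < d then f i else 0)"

definition unit_ball :: "nat \<Rightarrow> fseq set"
  where "unit_ball d = cball 0 1 \<inter> euc d"

definition unit_sphere :: "nat \<Rightarrow> fseq set"
  where "unit_sphere d = sphere 0 1 \<inter> euc d"

definition lebesgue_euc :: "nat \<Rightarrow> fseq measure"
  where "lebesgue_euc d = distr (Pi\<^sub>M {..<d} (\<lambda>_. lborel)) borel (embed d)"

text \<open>
  Normalised surface measure on the unit sphere of \<open>\<real>\<^sup>d\<close>: the radial projection \<open>x \<mapsto> x / \<parallel>x\<parallel>\<close>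
  of the uniform distribution on the unit ball. The measure of a Borel set \<open>A\<close> of the sphere is
  \<open>vol {r a | 0 < r \<le> 1, a \<in> A} / vol B\<^sup>d\<close>.
\<close>

definition uniform_sphere :: "nat \<Rightarrow> fseq measure"
  where "uniform_sphere d = distr (uniform_measure (lebesgue_euc d) (unit_ball d)) borel sgn"

lemma coord_embed [simp]: "coord (embed d f) i = (if i < d then f i else 0)"
proof -
  have "finite {i. (if i < d then f i else 0) \<noteq> 0}"
    by (rule finite_subset[of _ "{..<d}"]) auto
  then show ?thesis by (simp add: embed_def Abs_fseq_inverse)
qed

lemma measurable_embed [measurable]:
  "embed d \<in> borel_measurable (Pi\<^sub>M {..<d} (\<lambda>_. lborel))"
proof -
  define e :: "nat \<Rightarrow> fseq" where "e i = embed d (\<lambda>j. if j = i then 1 else 0)" for i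
  have eq: "embed d f = (\<Sum>i<d. f i *\<^sub>R e i)" for f
  proof (rule fseq_eqI)
    fix j
    have lin: "coord (\<Sum>i\<in>A. x i) j = (\<Sum>i\<in>A. coord (x i) j)" if "finite A" for A and x :: "nat \<Rightarrow> fseq"
      using that by induction auto
    show "coord (embed d f) j = coord (\<Sum>i<d. f i *\<^sub>R e i) j"
      by (simp add: lin e_def if_distrib[of "(*) _"] sum.delta cong: if_cong)
  qed
  have cont: "continuous_on UNIV (embed d)"
    unfolding eq by (intro continuous_intros) (auto intro: continuous_on_product_coordinates)
  have m1: "embed d \<in> borel_measurable (borel :: (nat \<Rightarrow> real) measure)"
    by (rule borel_measurable_continuous_onI[OF cont])
  have m2: "(\<lambda>f i. if i < d then f i else 0) \<in> measurable (Pi\<^sub>M {..<d} (\<lambda>_. lborel)) (borel :: (nat \<Rightarrow> real) measure)"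
    unfolding measurable_cong_sets[OF refl sets_PiM_equal_borel[symmetric]]
  proof (rule measurable_PiM_single')
    fix i :: nat
    show "(\<lambda>f. if i < d then f i else 0) \<in> measurable (Pi\<^sub>M {..<d} (\<lambda>_. lborel)) (borel :: real measure)"
      by (cases "i < d") auto
  qed auto
  have "embed d = embed d \<circ> (\<lambda>f i. if i < d then f i else 0)"
    by (auto intro!: fseq_eqI)
  then show ?thesis
    using measurable_comp[OF m2 m1] by (simp only:)
qed

lemma norm_embed: "norm (embed d f) = L2_set f {..<d}"
proof -
  have "inner (embed d f) (embed d f) = (\<Sum>i<d. f i * f i)"
    by (subst inner_fseq_superset[of "{..<d}"]) auto
  then show ?thesis by (simp add: norm_fseq_def L2_set_def power2_eq_square)
qed

lemma closed_euc: "closed (euc d)"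
proof -
  have c: "continuous_on UNIV (\<lambda>x. coord x i)" for i
  proof -
    have "coord x i = inner (embed (Suc i) (\<lambda>j. if j = i then 1 else 0)) x" for x
      by (subst inner_fseq_superset[of "{i}"]) (auto simp: less_Suc_eq)
    then show ?thesis by (simp add: continuous_intros)
  qed
  have "euc d = (\<Inter>i\<in>{d..}. {x. coord x i = 0})"
    by (auto simp: euc_def)
  then show ?thesis
    by (auto intro!: closed_INT closed_Collect_eq c continuous_on_const)
qed

lemma prob_space_uniform_sphere: "prob_space (uniform_sphere d)"
proof -
  interpret P: product_sigma_finite "\<lambda>_::nat. lborel :: real measure"
    by standard
  have B [measurable]: "unit_ball d \<in> sets borel"
    by (simp add: unit_ball_def borel_closed closed_Int closed_euc)
  let ?L = "Pi\<^sub>M {..<d} (\<lambda>_. lborel :: real measure)"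
  let ?c = "1 / sqrt (real d + 1)"
  let ?S = "embed d -` unit_ball d \<inter> space ?L"
  have em: "emeasure (lebesgue_euc d) (unit_ball d) = emeasure ?L ?S"
    unfolding lebesgue_euc_def by (rule emeasure_distr) simp_all
  have cp: "0 < ?c" by simp
  have low: "(\<Pi>\<^sub>E i\<in>{..<d}. {-?c..?c}) \<subseteq> ?S"
  proof
    fix f assume f: "f \<in> (\<Pi>\<^sub>E i\<in>{..<d}. {-?c..?c})"
    have "(\<Sum>i<d. (f i)\<^sup>2) \<le> (\<Sum>i<d. ?c\<^sup>2)"
    proof (rule sum_mono)
      fix i assume "i \<in> {..<d}"
      then have "\<bar>f i\<bar> \<le> \<bar>?c\<bar>" using f by (auto simp: PiE_iff abs_le_iff minus_le_iff)
      then show "(f i)\<^sup>2 \<le> ?c\<^sup>2" by (simp only: abs_le_square_iff)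
    qed
    also have "\<dots> \<le> 1" by (simp add: power_divide field_simps)
    finally have "norm (embed d f) \<le> 1" by (simp add: norm_embed L2_set_def)
    then show "f \<in> ?S" using f by (auto simp: unit_ball_def euc_def space_PiM PiE_iff)
  qed
  have up: "?S \<subseteq> (\<Pi>\<^sub>E i\<in>{..<d}. {-1..1})"
  proof
    fix f assume f: "f \<in> ?S"
    then have n: "L2_set f {..<d} \<le> 1" by (simp add: unit_ball_def norm_embed)
    have "\<bar>f i\<bar> \<le> 1" if "i < d" for i
    proof -
      have "(f i)\<^sup>2 \<le> (\<Sum>i<d. (f i)\<^sup>2)" by (rule member_le_sum) (use that in auto)
      also have "\<dots> \<le> 1" using n by (simp add: L2_set_def)
      finally show ?thesis by (simp add: abs_square_le_1)
    qed
    then show "f \<in> (\<Pi>\<^sub>E i\<in>{..<d}. {-1..1})"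
      using f by (auto simp: space_PiM PiE_iff abs_le_iff minus_le_iff)
  qed
  have "emeasure ?L (\<Pi>\<^sub>E i\<in>{..<d}. {-?c..?c}) \<le> emeasure ?L ?S"
    by (rule emeasure_mono[OF low]) (rule measurable_sets[OF measurable_embed B])
  moreover have "emeasure ?L (\<Pi>\<^sub>E i\<in>{..<d}. {-?c..?c}) = (\<Prod>i<d. ennreal (2 * ?c))"
    by (subst P.emeasure_PiM) auto
  moreover have "(\<Prod>i<d. ennreal (2 * ?c)) \<noteq> 0"
    using cp by simp
  ultimately have n0: "emeasure ?L ?S \<noteq> 0" by (metis le_zero_eq)
  have "emeasure ?L ?S \<le> emeasure ?L (\<Pi>\<^sub>E i\<in>{..<d}. {-1..1})"
    by (rule emeasure_mono[OF up]) auto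
  also have "\<dots> = (\<Prod>i<d. emeasure lborel {-1..1::real})"
    by (rule P.emeasure_PiM) auto
  also have "\<dots> < \<infinity>"
    by (simp add: ennreal_power[symmetric] power_less_top_ennreal)
  finally have fin: "emeasure ?L ?S \<noteq> \<infinity>" by simp
  have U: "prob_space (uniform_measure (lebesgue_euc d) (unit_ball d))"
    by (rule prob_space_uniform_measure) (use n0 fin em in auto)
  have s: "(sgn :: fseq \<Rightarrow> fseq) \<in> borel_measurable borel"
  proof -
    have "continuous_on (- {0}) (sgn :: fseq \<Rightarrow> fseq)"
      by (rule continuous_on_sgn) (auto intro: continuous_on_id)
    then have "(\<lambda>x::fseq. if x \<in> - {0} then sgn x else 0) \<in> borel_measurable borel"
      by (intro borel_measurable_continuous_on_if) auto
    moreover have "(\<lambda>x::fseq. if x \<in> - {0} then sgn x else 0) = sgn" by auto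
    ultimately show ?thesis by simp
  qed
  have "sets (uniform_measure (lebesgue_euc d) (unit_ball d)) = sets borel"
    by (simp add: lebesgue_euc_def)
  then have "(sgn :: fseq \<Rightarrow> fseq) \<in> measurable (uniform_measure (lebesgue_euc d) (unit_ball d)) borel"
    using s measurable_cong_sets by blast
  then show ?thesis
    unfolding uniform_sphere_def by (rule prob_space.prob_space_distr[OF U])
qed

definition hausdorff_dist :: "'a::metric_space set \<Rightarrow> 'a set \<Rightarrow> real"
  where "hausdorff_dist A B = max (SUP a\<in>A. infdist a B) (SUP b\<in>B. infdist b A)"

text \<open>As the library's \<open>aff_dim\<close>, which is restricted to Euclidean space types.\<close>

definition has_aff_dim :: "'a::real_vector set \<Rightarrow> int \<Rightarrow> bool"
  where "has_aff_dim F k \<longleftrightarrow>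
    (\<exists>S. finite S \<and> affine hull S = affine hull F \<and> \<not> affine_dependent S \<and> int (card S) = k + 1)"

definition facet_in :: "nat \<Rightarrow> fseq set \<Rightarrow> fseq set \<Rightarrow> bool"
  where "facet_in d F P \<longleftrightarrow> F face_of P \<and> has_aff_dim F (int d - 1)"

definition has_height :: "nat \<Rightarrow> fseq set \<Rightarrow> fseq set \<Rightarrow> real \<Rightarrow> bool"
  where "has_height d P F h \<longleftrightarrow>
    (\<exists>u\<in>unit_sphere d. affine hull F = {x \<in> euc d. inner x u = h} \<and> P \<subseteq> {x. inner x u \<le> h})"

text \<open>A polytope has finitely many facets, so the infimum is a minimum whenever there is a facet.\<close>

definition min_facet_height :: "nat \<Rightarrow> fseq set \<Rightarrow> real"
  where "min_facet_height d P = Inf {h. \<exists>F. facet_in d F P \<and> has_height d P F h}"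

definition uniform_sphere_sample ::
    "'w measure \<Rightarrow> nat \<Rightarrow> nat \<Rightarrow> (nat \<Rightarrow> 'w \<Rightarrow> fseq) \<Rightarrow> bool"
  where "uniform_sphere_sample M n d X \<longleftrightarrow> prob_space M \<and>
    prob_space.indep_vars M (\<lambda>_. borel) X {..<n} \<and>
    (\<forall>i<n. distr M borel (X i) = uniform_sphere d)"

definition rand_polytope :: "nat \<Rightarrow> (nat \<Rightarrow> 'w \<Rightarrow> fseq) \<Rightarrow> 'w \<Rightarrow> fseq set"
  where "rand_polytope n X \<omega> = convex hull ((\<lambda>i. X i \<omega>) ` {..<n})"

text \<open>
  Each \<open>Y n\<close> lives on its own probability space. Measurability is demanded explicitly because
  \<open>measure\<close> is \<open>0\<close> on non-measurable sets.
\<close>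

definition tendsto_in_prob ::
    "(nat \<Rightarrow> 'w measure) \<Rightarrow> (nat \<Rightarrow> 'w \<Rightarrow> real) \<Rightarrow> real \<Rightarrow> bool"
  where "tendsto_in_prob M Y c \<longleftrightarrow>
    (\<forall>\<^sub>F n in sequentially. Y n \<in> borel_measurable (M n)) \<and>
    (\<forall>\<epsilon>>0. (\<lambda>n. measure (M n) {\<omega> \<in> space (M n). \<bar>Y n \<omega> - c\<bar> > \<epsilon>}) \<longlonglongrightarrow> 0)"

end

theory Submission
  imports Defs "HOL-Real_Asymp.Real_Asymp"
begin

text \<open>
  Everything is governed by \<open>r = min\<^sub>u max\<^sub>i X\<^sub>i \<bullet> u\<close>, the minimum over unit vectors \<open>u\<close> of the support
  function of the polytope: the Hausdorff distance to the unit ball is always \<open>1 - r\<close>, and in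
  general position the smallest facet height lies between \<open>r\<close> and \<open>max 0 r\<close>, because a point on
  or outside the boundary of a full-dimensional polytope lies on or beyond some facet hyperplane.

  An upper bound for \<open>r\<close> comes from one fixed direction \<open>u\<close>: if \<open>n\<close> times the measure of the cap
  of height \<open>h\<close> around \<open>u\<close> tends to \<open>0\<close>, then with high probability all points lie below \<open>h\<close>. A lower
  bound comes from a union bound over a net of directions, where a cap of measure \<open>p\<close> is missed
  with probability at most \<open>exp (- n p)\<close>. The measure of a cap is compared with volumes of balls: the
  cone over the cap, cut off at suitable radii, is contained in a ball or contains (most of) a ball.
  So only translations and dilations of Lebesgue measure are used, and no rotations.
\<close>

subsection \<open>Linear algebra and topology of finitely supported sequences\<close>

text \<open>The union bound must beat the size of the net. A net of mesh \<open>\<delta>\<close> has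
  at most \<open>(5 * d / \<delta>) ^ d\<close> points, so a lower bound for \<open>r\<close> needs
  \<open>n * p - d * ln (5 * d / \<delta>)\<close> to tend to infinity, where \<open>p\<close>
  bounds the measure of a cap from below. In the sharp statement \<open>\<delta>\<close> is of order
  \<open>1 / s\<close> with \<open>s = n powr (2 / (d - 1))\<close>, so besides a term in
  \<open>d\<close> alone the net costs up to \<open>4 * ln n\<close>, whereas \<open>n * p\<close>
  is only shown to grow exponentially in \<open>d\<close>. This is where \<open>ln (ln n)\<close>
  being small against \<open>d\<close> enters: the exponential in \<open>d\<close> then dominates
  \<open>ln n\<close>. In (iii) the relevant caps have negative height and measure close to
  \<open>1\<close>, so \<open>exp (- n * p)\<close> is too weak against the net when
  \<open>d\<close> is close to \<open>n\<close>. Instead, the probability of missing such a cap is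
  itself exponentially small in \<open>d\<close>, and its \<open>n\<close>-th power beats the net
  because \<open>n > d\<close>. As \<open>r\<close> may be negative there, \<open>1 - Hmin\<close>
  and the Hausdorff distance need not agree, and each is squeezed separately.\<close>

lemma continuous_on_coord [continuous_intros]:
  assumes "continuous_on A f"
  shows "continuous_on A (\<lambda>x. coord (f x) i)"
proof -
  have "coord x i = inner (embed (Suc i) (\<lambda>j. if j = i then 1 else 0)) x" for x
    by (subst inner_fseq_superset[of "{i}"]) (auto simp: less_Suc_eq)
  then show ?thesis using assms by (simp add: continuous_intros)
qed

section \<open>The standard basis and the dimension of \<open>euc d\<close>\<close>

definition unit_vec :: "nat \<Rightarrow> fseq"
  where "unit_vec i = embed (Suc i) (\<lambda>j. if j = i then 1 else 0)"

lemma coord_unit_vec [simp]: "coord (unit_vec i) j = (if j = i then 1 else 0)"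
  by (auto simp: unit_vec_def)

lemma inner_unit_vec: "unit_vec i \<bullet> x = coord x i"
  by (subst inner_fseq_superset[of "{i}"]) auto

lemma norm_unit_vec [simp]: "norm (unit_vec i) = 1"
  by (simp add: norm_eq_1 inner_unit_vec)

lemma abs_coord_le_norm: "\<bar>coord x i\<bar> \<le> norm x"
  using Cauchy_Schwarz_ineq2[of "unit_vec i" x] by (simp add: inner_unit_vec)

lemma coord_sum: "coord (\<Sum>i\<in>A. x i) j = (\<Sum>i\<in>A. coord (x i) j)"
  by (induction A rule: infinite_finite_induct) auto

lemma subspace_euc [simp]: "subspace (euc d)"
  by (auto simp: subspace_def euc_def)

lemma euc_intros [intro, simp]:
  "0 \<in> euc d"
  "x \<in> euc d \<Longrightarrow> y \<in> euc d \<Longrightarrow> x + y \<in> euc d"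
  "x \<in> euc d \<Longrightarrow> y \<in> euc d \<Longrightarrow> x - y \<in> euc d"
  "x \<in> euc d \<Longrightarrow> - x \<in> euc d"
  "x \<in> euc d \<Longrightarrow> c *\<^sub>R x \<in> euc d"
  by (auto simp: euc_def)

lemma sum_in_euc: "(\<And>i. i \<in> A \<Longrightarrow> x i \<in> euc d) \<Longrightarrow> (\<Sum>i\<in>A. x i) \<in> euc d"
  by (auto simp: euc_def coord_sum)

lemma euc_expansion:
  assumes "x \<in> euc d"
  shows "x = (\<Sum>i<d. coord x i *\<^sub>R unit_vec i)"
  using assms
  by (intro fseq_eqI) (auto simp: coord_sum euc_def if_distrib[of "(*) _"] sum.delta not_less cong: if_cong)

lemma unit_vec_in_euc: "i < d \<Longrightarrow> unit_vec i \<in> euc d"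
  by (auto simp: euc_def)

lemma span_unit_vecs: "span (unit_vec ` {..<d}) = euc d"
proof
  show "span (unit_vec ` {..<d}) \<subseteq> euc d"
    by (rule span_minimal) (auto simp: unit_vec_in_euc)
  show "euc d \<subseteq> span (unit_vec ` {..<d})"
  proof
    fix x assume "x \<in> euc d"
    then have "x = (\<Sum>i<d. coord x i *\<^sub>R unit_vec i)" by (rule euc_expansion)
    also have "\<dots> \<in> span (unit_vec ` {..<d})"
      by (intro span_sum span_scale span_base) auto
    finally show "x \<in> span (unit_vec ` {..<d})" .
  qed
qed

lemma inj_unit_vec: "inj unit_vec"
proof (rule injI)
  fix i j assume "unit_vec i = unit_vec j"
  then have "coord (unit_vec i) i = coord (unit_vec j) i" by simp
  then show "i = j" by (simp split: if_splits)
qed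

lemma independent_in_euc:
  assumes "independent S" "S \<subseteq> euc d"
  shows "finite S \<and> card S \<le> d"
proof -
  have "finite S \<and> card S \<le> card (unit_vec ` {..<d})"
    by (rule independent_span_bound) (use assms in \<open>auto simp: span_unit_vecs\<close>)
  then show ?thesis using card_image_le[of "{..<d}" unit_vec] by auto
qed

text \<open>Together with \<open>independent_in_euc\<close> this plays the role of the dimension of
  \<open>euc d\<close>: fewer than \<open>d\<close> vectors always leave a direction free.\<close>

lemma euc_subset_span_card:
  assumes "finite B" "euc d \<subseteq> span B"
  shows "d \<le> card B"
proof -
  have ind: "independent (unit_vec ` {..<d})"
  proof (rule independent_if_scalars_zero)
    fix f x assume s: "(\<Sum>x\<in>unit_vec ` {..<d}. f x *\<^sub>R x) = 0" and x: "x \<in> unit_vec ` {..<d}"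
    obtain i where i: "i < d" "x = unit_vec i" using x by auto
    have "0 = coord (\<Sum>x\<in>unit_vec ` {..<d}. f x *\<^sub>R x) i" by (simp add: s)
    also have "\<dots> = (\<Sum>j<d. f (unit_vec j) * coord (unit_vec j) i)"
      by (subst sum.reindex) (auto simp: coord_sum inj_on_subset[OF inj_unit_vec])
    also have "\<dots> = f x" using i by (simp add: if_distrib[of "(*) _"] sum.delta' cong: if_cong)
    finally show "f x = 0" by simp
  qed auto
  have "unit_vec ` {..<d} \<subseteq> euc d" by (auto simp: unit_vec_in_euc)
  then have "card (unit_vec ` {..<d}) \<le> card B"
    using independent_span_bound[OF assms(1) ind] assms(2) by blast
  then show ?thesis by (simp add: card_image inj_on_subset[OF inj_unit_vec])
qed

section \<open>Compactness in \<open>euc d\<close> and second countability\<close>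

lemma euc_mono: "d \<le> e \<Longrightarrow> euc d \<subseteq> euc e"
  by (auto simp: euc_def)

lemma euc_exhaust: "\<exists>d. x \<in> euc d"
proof -
  obtain m where "\<forall>i\<in>{i. coord x i \<noteq> 0}. i < m"
    using finite_coord[of x] by (meson finite_nat_set_iff_bounded)
  then have "x \<in> euc m" by (auto simp: euc_def not_less[symmetric])
  then show ?thesis ..
qed

text \<open>The ambient space is not locally compact, so Heine-Borel is built up one coordinate at a
  time: the next ball is a closed part of the continuous image of a compact product with an
  interval.\<close>

lemma compact_cball_euc: "compact (cball 0 r \<inter> euc d)"
proof (induction d)
  case 0
  have "euc 0 = {0}" by (auto simp: euc_def intro: fseq_eqI)
  then have "cball 0 r \<inter> euc 0 = {} \<or> cball 0 r \<inter> euc 0 = {0}" by auto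
  then show ?case by (elim disjE; simp only: compact_empty compact_sing)
next
  case (Suc d)
  let ?g = "\<lambda>(x, t). x + t *\<^sub>R unit_vec d"
  have "compact (?g ` ((cball 0 r \<inter> euc d) \<times> {-r..r}))"
    by (intro compact_continuous_image compact_Times Suc.IH compact_Icc)
       (auto intro!: continuous_intros simp: split_beta)
  moreover have "cball 0 r \<inter> euc (Suc d) \<subseteq> ?g ` ((cball 0 r \<inter> euc d) \<times> {-r..r})"
  proof
    fix x assume x: "x \<in> cball 0 r \<inter> euc (Suc d)"
    define y where "y = x - coord x d *\<^sub>R unit_vec d"
    have "inner y (coord x d *\<^sub>R unit_vec d) = 0"
      by (simp add: y_def inner_commute[of _ "unit_vec _"] inner_unit_vec)
    then have "(norm x)\<^sup>2 = (norm y)\<^sup>2 + (norm (coord x d *\<^sub>R unit_vec d))\<^sup>2"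
      using norm_add_Pythagorean[of y "coord x d *\<^sub>R unit_vec d"]
      by (simp add: orthogonal_def y_def)
    then have "(norm y)\<^sup>2 \<le> (norm x)\<^sup>2" by simp
    then have "norm y \<le> norm x" by (simp add: power2_le_iff_abs_le)
    moreover have "y \<in> euc d" using x by (auto simp: euc_def y_def)
    moreover have "\<bar>coord x d\<bar> \<le> r" using abs_coord_le_norm[of x d] x by auto
    ultimately have "(y, coord x d) \<in> (cball 0 r \<inter> euc d) \<times> {-r..r}" using x by auto
    moreover have "x = ?g (y, coord x d)" by (simp add: y_def)
    ultimately show "x \<in> ?g ` ((cball 0 r \<inter> euc d) \<times> {-r..r})" by blast
  qed
  moreover have "closed (cball 0 r \<inter> euc (Suc d))" by (intro closed_Int closed_cball closed_euc)
  ultimately show ?case by (metis compact_Int_closed inf.absorb_iff2)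
qed

lemma compact_in_euc:
  assumes "closed S" "bounded S" "S \<subseteq> euc d"
  shows "compact S"
proof -
  obtain r where "S \<subseteq> cball 0 r" using assms(2) bounded_iff[of S] by (auto simp: subset_iff)
  then have "S = (cball 0 r \<inter> euc d) \<inter> S" using assms by auto
  then show ?thesis using compact_Int_closed[OF compact_cball_euc assms(1)] by metis
qed

lemma unit_sphereD: "u \<in> unit_sphere d \<Longrightarrow> norm u = 1" "u \<in> unit_sphere d \<Longrightarrow> u \<in> euc d"
  by (auto simp: unit_sphere_def)

lemma unit_sphereI: "norm u = 1 \<Longrightarrow> u \<in> euc d \<Longrightarrow> u \<in> unit_sphere d"
  by (auto simp: unit_sphere_def)

lemma compact_unit_sphere: "compact (unit_sphere d)"
proof (rule compact_in_euc[of _ d])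
  show "closed (unit_sphere d)" unfolding unit_sphere_def by (intro closed_Int closed_euc) (simp add: sphere_def closed_Collect_eq continuous_intros)
  show "bounded (unit_sphere d)" by (auto simp: unit_sphere_def bounded_iff)
qed (auto simp: unit_sphere_def)

lemma unit_vec_in_unit_sphere: "i < d \<Longrightarrow> unit_vec i \<in> unit_sphere d"
  by (simp add: unit_sphere_def unit_vec_in_euc)

lemma normalize_in_unit_sphere:
  assumes "w \<in> euc d" "w \<noteq> 0"
  shows "w /\<^sub>R norm w \<in> unit_sphere d"
proof (rule unit_sphereI)
  show "norm (w /\<^sub>R norm w) = 1" using norm_sgn[of w] assms(2) by (simp add: sgn_div_norm)
  show "w /\<^sub>R norm w \<in> euc d" by (rule euc_intros(5)[OF assms(1)])
qed

text \<open>Second countability identifies the Borel sets of the function space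
  \<open>nat \<Rightarrow> fseq\<close> with the product \<sigma>-algebra. Finite rational
  combinations of the unit vectors are dense because every vector has finite support.\<close>

instance fseq :: second_countable_topology
proof
  define g :: "rat list \<Rightarrow> fseq" where "g l = (\<Sum>i<length l. real_of_rat (l ! i) *\<^sub>R unit_vec i)" for l
  have dense: "\<exists>l. dist x (g l) < e" if "e > 0" for x e
  proof -
    obtain m where m: "x \<in> euc m" using euc_exhaust by blast
    \<comment> \<open>The denominator \<open>m + 1\<close> covers \<open>m = 0\<close> and keeps the
      sum of \<open>m\<close> errors strictly below \<open>e\<close>.\<close>
    have "\<exists>q. \<bar>coord x i - real_of_rat q\<bar> < e / (m + 1)" for i
      using of_rat_dense[of "coord x i - e / (m + 1)" "coord x i + e / (m + 1)"] that
      by (auto simp: abs_less_iff algebra_simps) 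
    then obtain q where q: "\<And>i. \<bar>coord x i - real_of_rat (q i)\<bar> < e / (m + 1)" by metis
    define l where "l = map q [0..<m]"
    have "x - g l = (\<Sum>i<m. (coord x i - real_of_rat (q i)) *\<^sub>R unit_vec i)"
      by (subst euc_expansion[OF m]) (simp add: g_def l_def scaleR_diff_left sum_subtractf)
    also have "norm \<dots> \<le> (\<Sum>i<m. \<bar>coord x i - real_of_rat (q i)\<bar>)"
      by (rule order_trans[OF norm_sum]) simp
    also have "\<dots> \<le> (\<Sum>i<m. e / (m + 1))" by (intro sum_mono less_imp_le q)
    also have "\<dots> < e" using that by (simp add: field_simps)
    finally show ?thesis by (auto simp: dist_norm)
  qed
  define B where "B = (\<lambda>(l, n). ball (g l) (1 / real (Suc n))) ` UNIV"
  have "topological_basis B"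
  proof (rule topological_basisI)
    fix O' :: "fseq set" and x assume O: "open O'" "x \<in> O'"
    then obtain e where e: "e > 0" "ball x e \<subseteq> O'" by (meson open_contains_ball)
    obtain n where n: "1 / real (Suc n) < e / 2" using e(1) by (metis half_gt_zero nat_approx_posE)
    obtain l where l: "dist x (g l) < 1 / real (Suc n)" using dense[of "1 / real (Suc n)" x] by auto
    have "ball (g l) (1 / real (Suc n)) \<subseteq> ball x e"
    proof
      fix y assume "y \<in> ball (g l) (1 / real (Suc n))"
      then show "y \<in> ball x e" using l n dist_triangle[of x y "g l"] by (simp add: dist_commute)
    qed
    then show "\<exists>B'\<in>B. x \<in> B' \<and> B' \<subseteq> O'"
      using e(2) l by (intro bexI[of _ "ball (g l) (1 / real (Suc n))"]) (auto simp: B_def dist_commute)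
  qed (auto simp: B_def)
  moreover have "countable B" unfolding B_def by auto
  ultimately show "\<exists>B::fseq set set. countable B \<and> open = generate_topology B"
    using topological_basis_imp_subbasis by blast
qed

section \<open>Orthogonal complements and hyperplanes\<close>

text \<open>A Gram-Schmidt step: \<open>c\<close> is the part of the new vector \<open>a\<close>
  orthogonal to the span of \<open>B\<close>, and the projection \<open>v\<close> of
  \<open>y\<close> is corrected along \<open>c\<close>. If \<open>c = 0\<close> the correction
  vanishes.\<close>

lemma orthogonal_decomposition_finite:
  fixes B :: "'a::real_inner set"
  assumes "finite B"
  shows "\<exists>v\<in>span B. \<forall>b\<in>span B. (y - v) \<bullet> b = 0"
proof -
  have "\<exists>v\<in>span B. \<forall>b\<in>B. (y - v) \<bullet> b = 0" for y
    using assms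
  proof (induction B arbitrary: y)
    case (insert a B)
    obtain v where v: "v \<in> span B" "\<And>b. b \<in> B \<Longrightarrow> (y - v) \<bullet> b = 0" using insert.IH by blast
    obtain p where p: "p \<in> span B" "\<And>b. b \<in> B \<Longrightarrow> (a - p) \<bullet> b = 0" using insert.IH[of a] by blast
    define c where "c = a - p"
    have cB: "c \<bullet> b = 0" if "b \<in> span B" for b
      using that p(2) orthogonal_to_span[of b B c] by (auto simp: orthogonal_def c_def)
    have cc: "c \<bullet> a = c \<bullet> c" using cB[OF p(1)] by (simp add: c_def inner_diff_right)
    define z where "z = v + ((y \<bullet> c - v \<bullet> c) / (c \<bullet> c)) *\<^sub>R c"
    have c_in: "c \<in> span (insert a B)"
      unfolding c_def by (intro span_diff) (use p(1) span_mono[of B "insert a B"] span_base[of a "insert a B"] in auto)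
    have z_in: "z \<in> span (insert a B)"
      unfolding z_def by (intro span_add span_scale c_in) (use v(1) span_mono[of B "insert a B"] in auto)
    have zB: "(y - z) \<bullet> b = 0" if "b \<in> B" for b
      using v(2)[OF that] cB[of b] that span_base[of b B]
      by (simp add: z_def inner_diff_left inner_add_left)
    have yzc: "(y - z) \<bullet> c = 0"
      by (cases "c = 0") (simp_all add: z_def inner_diff_left inner_add_left)
    have "(y - z) \<bullet> p = 0"
      using orthogonal_to_span[of p B "y - z"] p(1) zB by (auto simp: orthogonal_def)
    then have "(y - z) \<bullet> a = 0" using yzc by (simp add: c_def inner_diff_right)
    then show ?case using z_in zB by blast
  qed (auto intro: bexI[of _ 0])
  then obtain v where v: "v \<in> span B" "\<And>b. b \<in> B \<Longrightarrow> (y - v) \<bullet> b = 0" by blast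
  then show ?thesis using orthogonal_to_span[of _ B "y - v"] by (intro bexI[of _ v]) (auto simp: orthogonal_def)
qed

text \<open>The normalised residue of \<open>y\<close> after projection is a combination of
  \<open>y\<close> and of elements of \<open>span B\<close>, so it inherits every orthogonality that
  \<open>y\<close> and \<open>B\<close> share. This allows \<open>w\<close> to be found inside a
  given hyperplane.\<close>

lemma unit_orthogonal_to_span:
  assumes B: "finite B" "B \<subseteq> euc d" and y: "y \<in> euc d" "y \<notin> span B"
  shows "\<exists>w\<in>unit_sphere d. (\<forall>b\<in>span B. w \<bullet> b = 0) \<and> (\<forall>u. u \<bullet> y = 0 \<longrightarrow> (\<forall>b\<in>B. u \<bullet> b = 0) \<longrightarrow> w \<bullet> u = 0)"
proof -
  obtain v where v: "v \<in> span B" "\<And>b. b \<in> span B \<Longrightarrow> (y - v) \<bullet> b = 0"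
    using orthogonal_decomposition_finite[OF B(1)] by blast
  have "v \<in> euc d" using v(1) span_minimal[OF B(2) subspace_euc] by blast
  then have "y - v \<in> euc d" using y by simp
  moreover have ne: "y - v \<noteq> 0" using y v by auto
  ultimately have "(y - v) /\<^sub>R norm (y - v) \<in> unit_sphere d" by (rule normalize_in_unit_sphere)
  moreover have "(y - v) \<bullet> u = 0" if "u \<bullet> y = 0" "\<forall>b\<in>B. u \<bullet> b = 0" for u
  proof -
    have "u \<bullet> v = 0" using orthogonal_to_span[of v B u] v(1) that(2) by (auto simp: orthogonal_def)
    then show ?thesis using that(1) by (simp add: inner_diff_right inner_commute[of _ u])
  qed
  ultimately show ?thesis
    using v(2) by (intro bexI[of _ "(y - v) /\<^sub>R norm (y - v)"]) auto
qed

lemma unit_orthogonal_to_few: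
  assumes "finite B" "B \<subseteq> euc d" "card B < d"
  shows "\<exists>w\<in>unit_sphere d. \<forall>b\<in>B. w \<bullet> b = 0"
proof -
  obtain y where "y \<in> euc d" "y \<notin> span B" using euc_subset_span_card[of B d] assms by auto
  then show ?thesis using unit_orthogonal_to_span[OF assms(1,2)] span_base by metis
qed

definition hyperplane_euc :: "nat \<Rightarrow> fseq \<Rightarrow> real \<Rightarrow> fseq set"
  where "hyperplane_euc d u h = {x \<in> euc d. inner x u = h}"

lemma affine_hyperplane_euc: "affine (hyperplane_euc d u h)"
  by (auto simp: affine_def hyperplane_euc_def inner_add_left distrib_right[symmetric])

text \<open>Replaces a statement about dimension by one about directions in a compact sphere, the
  form that both the extreme point argument and the measurability proof can check. If the hull is
  too small, a point of the hyperplane outside it yields a direction \<open>w\<close> orthogonal to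
  \<open>u\<close> on which \<open>A\<close> is constant.\<close>

lemma affine_hull_eq_hyperplane_iff:
  assumes u: "u \<in> unit_sphere d" and A: "finite A" "A \<noteq> {}" "A \<subseteq> hyperplane_euc d u h"
  shows "affine hull A = hyperplane_euc d u h \<longleftrightarrow>
    (\<forall>w\<in>unit_sphere d. w \<bullet> u = 0 \<longrightarrow> (\<exists>x\<in>A. \<exists>y\<in>A. x \<bullet> w \<noteq> y \<bullet> w))"
proof -
  obtain a where a: "a \<in> A" using A by auto
  {
    assume eq: "affine hull A = hyperplane_euc d u h"
    have "\<forall>w\<in>unit_sphere d. w \<bullet> u = 0 \<longrightarrow> (\<exists>x\<in>A. \<exists>y\<in>A. x \<bullet> w \<noteq> y \<bullet> w)"
    proof (intro ballI impI, rule ccontr)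
      fix w assume w: "w \<in> unit_sphere d" "w \<bullet> u = 0" and "\<not> (\<exists>x\<in>A. \<exists>y\<in>A. x \<bullet> w \<noteq> y \<bullet> w)"
      then have "A \<subseteq> {x. x \<bullet> w = a \<bullet> w}" using a by blast
      moreover have "affine {x. x \<bullet> w = a \<bullet> w}"
        by (auto simp: affine_def inner_add_left distrib_right[symmetric])
      ultimately have "affine hull A \<subseteq> {x. x \<bullet> w = a \<bullet> w}" by (rule hull_minimal)
      moreover have "a + w \<in> hyperplane_euc d u h"
        using a A w by (auto simp: hyperplane_euc_def inner_add_left unit_sphere_def)
      ultimately have "w \<bullet> w = 0" using eq by (auto simp: inner_add_left)
      then show False using w by (auto simp: unit_sphere_def)
    qed
  }
  moreover {
    assume nd: "\<forall>w\<in>unit_sphere d. w \<bullet> u = 0 \<longrightarrow> (\<exists>x\<in>A. \<exists>y\<in>A. x \<bullet> w \<noteq> y \<bullet> w)"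
    have "affine hull A = hyperplane_euc d u h"
    proof
      show "affine hull A \<subseteq> hyperplane_euc d u h"
        by (intro hull_minimal A(3) affine_hyperplane_euc)
      show "hyperplane_euc d u h \<subseteq> affine hull A"
      proof
        fix y assume y: "y \<in> hyperplane_euc d u h"
        define B where "B = {x - a |x. x \<in> A - {a}}"
        have B: "finite B" "B \<subseteq> euc d"
          using A a by (auto simp: B_def hyperplane_euc_def intro!: euc_intros)
        have uB: "\<forall>b\<in>B. u \<bullet> b = 0"
        proof
          fix b assume "b \<in> B"
          then obtain x where x: "b = x - a" "x \<in> A" by (auto simp: B_def)
          show "u \<bullet> b = 0"
            using subsetD[OF A(3) a] subsetD[OF A(3) x(2)]
            by (simp add: x hyperplane_euc_def inner_diff_right inner_commute[of u])
        qed
        have "y - a \<in> span B"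
        proof (rule ccontr)
          assume "y - a \<notin> span B"
          moreover have "y - a \<in> euc d" using y a A by (auto simp: hyperplane_euc_def)
          moreover have "u \<bullet> (y - a) = 0"
            using y subsetD[OF A(3) a] by (simp add: hyperplane_euc_def inner_diff_right inner_commute[of u])
          ultimately obtain w where w: "w \<in> unit_sphere d" "\<forall>b\<in>span B. w \<bullet> b = 0" "w \<bullet> u = 0"
            using unit_orthogonal_to_span[OF B] uB by blast
          have "x \<bullet> w = a \<bullet> w" if "x \<in> A" for x
          proof (cases "x = a")
            case False
            then have "x - a \<in> B" using that by (auto simp: B_def)
            then have "w \<bullet> (x - a) = 0" using w(2) span_base by blast
            then show ?thesis by (simp add: inner_diff_right inner_commute)
          qed simp
          then show False using nd w by fastforce
        qed
        then show "y \<in> affine hull A"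
          unfolding affine_hull_span[OF a] B_def[symmetric] by (auto intro!: exI[of _ "y - a"])
      qed
    qed
  }
  ultimately show ?thesis by blast
qed

text \<open>An affine basis of \<open>F\<close>, translated to the origin and enlarged by the normal
  \<open>u\<close>, is a linear basis of \<open>euc d\<close>; counting its elements gives the
  dimension.\<close>

lemma has_aff_dim_hyperplane:
  assumes u: "u \<in> unit_sphere d" and F: "affine hull F = hyperplane_euc d u h"
  shows "has_aff_dim F (int d - 1)"
proof -
  obtain B where B: "B \<subseteq> F" "\<not> affine_dependent B" "affine hull F = affine hull B"
    using affine_basis_exists by blast
  have "h *\<^sub>R u \<in> hyperplane_euc d u h"
    using u by (auto simp: hyperplane_euc_def unit_sphere_def norm_eq_1)
  then have "B \<noteq> {}" using F B by auto
  then obtain b where b: "b \<in> B" by auto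
  have BH: "B \<subseteq> hyperplane_euc d u h" using B F hull_subset[of B] by metis
  define C where "C = (\<lambda>x. - b + x) ` (B - {b})"
  have C': "C = {x - b |x. x \<in> B - {b}}" by (auto simp: C_def)
  have Cind: "independent C"
    using affine_dependent_iff_dependent2[OF b] B(2) by (simp add: C_def)
  have Ceuc: "C \<subseteq> euc d" using BH b by (auto simp: C' hyperplane_euc_def)
  have "finite C" using independent_in_euc[OF Cind Ceuc] by simp
  have Cu: "u \<bullet> c = 0" if "c \<in> span C" for c
  proof -
    have "c \<bullet> u = 0" if cC: "c \<in> C" for c
    proof -
      obtain x where x: "c = x - b" "x \<in> B" using cC by (auto simp: C')
      then show ?thesis using subsetD[OF BH b] subsetD[OF BH x(2)] by (simp add: hyperplane_euc_def inner_diff_left)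
    qed
    then have "u \<bullet> c = 0" if "c \<in> C" for c
      using that by (simp add: inner_commute[of u])
    then show ?thesis using orthogonal_to_span[of c C u] that by (auto simp: orthogonal_def)
  qed
  have unot: "u \<notin> span C" using Cu[of u] u by (auto simp: unit_sphere_def)
  have ind: "independent (insert u C)"
    using unot Cind by (simp add: independent_insert)
  have "euc d \<subseteq> span (insert u C)"
  proof
    fix y assume y: "y \<in> euc d"
    define z where "z = y - (y \<bullet> u) *\<^sub>R u"
    have "z \<bullet> u = 0" using u by (simp add: z_def inner_diff_left unit_sphere_def norm_eq_1)
    moreover have "z \<in> euc d" using y u by (auto simp: z_def unit_sphere_def)
    ultimately have "b + z \<in> hyperplane_euc d u h"
      using b BH by (auto simp: hyperplane_euc_def inner_add_left)
    then have "b + z \<in> affine hull B" using B F by simp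
    then have "z \<in> span C" unfolding affine_hull_span[OF b] C'[symmetric] by auto
    then have "z \<in> span (insert u C)" by (metis span_mono subset_insertI subsetD)
    moreover have "(y \<bullet> u) *\<^sub>R u \<in> span (insert u C)" by (intro span_scale span_base) auto
    ultimately have "z + (y \<bullet> u) *\<^sub>R u \<in> span (insert u C)" by (rule span_add)
    then show "y \<in> span (insert u C)" by (simp add: z_def)
  qed
  then have "d \<le> card (insert u C)" using \<open>finite C\<close> by (intro euc_subset_span_card) auto
  moreover have "card (insert u C) \<le> d"
    using independent_in_euc[OF ind] Ceuc u by (auto simp: unit_sphere_def)
  ultimately have "card (insert u C) = d" by simp
  moreover have "u \<notin> C" using unot span_base by blast
  ultimately have "Suc (card C) = d" using \<open>finite C\<close> by simp
  moreover have "inj_on (\<lambda>x. - b + x) (B - {b})" by (auto simp: inj_on_def)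
  then have "card C = card (B - {b})" and "finite (B - {b})"
    using \<open>finite C\<close> by (auto simp: C_def card_image dest: finite_imageD)
  moreover have "card B = Suc (card (B - {b}))" using b \<open>finite (B - {b})\<close>
    by (metis card_Suc_Diff1 finite_insert insert_Diff)
  ultimately have "int (card B) = (int d - 1) + 1" "finite B" by auto
  then show ?thesis unfolding has_aff_dim_def using B by metis
qed

subsection \<open>Facets and support functions\<close>

text \<open>The only general position needed of points in \<open>euc d\<close>: no hyperplane
  contains them all, so the polytope is full-dimensional and has facets.\<close>

definition spread :: "nat \<Rightarrow> nat \<Rightarrow> (nat \<Rightarrow> fseq) \<Rightarrow> bool"
  where "spread d n x \<longleftrightarrow> (\<forall>w\<in>unit_sphere d. \<exists>i<n. \<exists>j<n. x i \<bullet> w \<noteq> x j \<bullet> w)"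

lemma convex_hull_halfspace:
  fixes x :: "'b \<Rightarrow> 'a::real_inner"
  assumes "\<And>i. i \<in> I \<Longrightarrow> x i \<bullet> u \<le> h" "y \<in> convex hull (x ` I)"
  shows "y \<bullet> u \<le> h"
proof -
  have "convex hull (x ` I) \<subseteq> {z. u \<bullet> z \<le> h}"
    by (intro hull_minimal convex_halfspace_le) (use assms(1) in \<open>auto simp: inner_commute[of u]\<close>)
  then show ?thesis using assms(2) by (auto simp: inner_commute[of u])
qed

lemma convex_hull_in_euc:
  assumes "\<And>i. i \<in> I \<Longrightarrow> x i \<in> euc d" shows "convex hull (x ` I) \<subseteq> euc d"
  by (rule hull_minimal) (use assms in \<open>auto simp: subspace_imp_convex\<close>)

text \<open>The facet comes from the linear program of maximising \<open>(q - c) \<bullet> y\<close> over the polar body of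
  \<open>P - c\<close>, where \<open>c\<close> is the mean of the points. A solution of largest norm is an extreme
  point of the polar body.\<close>

lemma exists_facet_not_beyond:
  fixes x :: "nat \<Rightarrow> fseq"
  assumes x: "\<And>i. i < n \<Longrightarrow> x i \<in> euc d" and sp: "spread d n x" and d: "0 < d"
    and q: "q \<in> euc d" and u0: "u0 \<in> unit_sphere d" "\<And>i. i < n \<Longrightarrow> x i \<bullet> u0 \<le> q \<bullet> u0"
  shows "\<exists>F h. facet_in d F (convex hull (x ` {..<n})) \<and> has_height d (convex hull (x ` {..<n})) F h \<and> h \<le> norm q"
proof -
  have n: "0 < n" using sp u0(1) by (auto simp: spread_def)
  define c where "c = (1 / real n) *\<^sub>R (\<Sum>i<n. x i)"
  have c: "c \<in> euc d" unfolding c_def by (intro euc_intros(5) sum_in_euc x) auto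
  define a where "a i = x i - c" for i
  have a: "a i \<in> euc d" if "i < n" for i using x[OF that] c by (simp add: a_def)
  have "(\<Sum>i<n. a i) = 0" using n by (simp add: a_def sum_subtractf sum_constant_scaleR c_def)
  then have sum0: "(\<Sum>i<n. a i \<bullet> w) = 0" for w by (metis inner_sum_left inner_zero_left)
  \<comment> \<open>The \<open>a i\<close> sum to \<open>0\<close>, so if none were positive on
    \<open>w\<close> they would all vanish there, against \<open>spread\<close>. Geometrically,
    \<open>0\<close> is interior to \<open>P - c\<close>, which makes the polar body
    bounded.\<close>
  have pos: "\<exists>i<n. a i \<bullet> w > 0" if w: "w \<in> unit_sphere d" for w
  proof (rule ccontr)
    assume "\<not> ?thesis"
    then have le: "- (a i \<bullet> w) \<ge> 0" if "i < n" for i using that by force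
    have "(\<Sum>i<n. - (a i \<bullet> w)) = 0" using sum0 by (simp add: sum_negf)
    then have "\<forall>i\<in>{..<n}. - (a i \<bullet> w) = 0"
      by (subst (asm) sum_nonneg_eq_0_iff) (use le in auto)
    then have "x i \<bullet> w = c \<bullet> w" if "i < n" for i
      using that by (auto simp: a_def inner_diff_left)
    then show False using sp w by (auto simp: spread_def)
  qed
  define K where "K = {y \<in> euc d. \<forall>i<n. a i \<bullet> y \<le> 1}"
  have "compact K"
  proof (rule compact_in_euc[of _ d])
    have "K = euc d \<inter> (\<Inter>i\<in>{..<n}. {y. a i \<bullet> y \<le> 1})" by (auto simp: K_def)
    then show "closed K" by (auto intro!: closed_Int closed_euc closed_INT closed_halfspace_le)
    \<comment> \<open>A continuous substitute for the support function: positive on the sphere,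
      hence bounded away from \<open>0\<close>, and at most \<open>n / norm y\<close> in the
      direction of \<open>y \<in> K\<close>.\<close>
    define G where "G w = (\<Sum>i<n. max 0 (a i \<bullet> w))" for w
    have "continuous_on (unit_sphere d) G" unfolding G_def by (intro continuous_intros)
    then obtain w0 where w0: "w0 \<in> unit_sphere d" "\<And>w. w \<in> unit_sphere d \<Longrightarrow> G w0 \<le> G w"
      using continuous_attains_inf[OF compact_unit_sphere, of d G] u0(1) by auto
    obtain i0 where i0: "i0 < n" "a i0 \<bullet> w0 > 0" using pos[OF w0(1)] by auto
    have "max 0 (a i0 \<bullet> w0) \<le> G w0"
      unfolding G_def by (rule member_le_sum) (use i0 in auto)
    then have G0: "G w0 > 0" using i0 by simp
    have "norm y \<le> n / G w0" if y: "y \<in> K" for y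
    proof (cases "y = 0")
      case False
      have "G w0 \<le> G (y /\<^sub>R norm y)"
        by (intro w0 normalize_in_unit_sphere False) (use y in \<open>auto simp: K_def\<close>)
      also have "\<dots> \<le> (\<Sum>i<n. 1 / norm y)"
        unfolding G_def by (intro sum_mono) (use y False in \<open>auto simp: K_def field_simps\<close>)
      finally show ?thesis using G0 False by (simp add: field_simps)
    qed (use G0 in auto)
    then show "bounded K" by (auto simp: bounded_iff)
  qed (auto simp: K_def)
  define f where "f y = (q - c) \<bullet> y" for y
  have contf: "continuous_on A f" for A unfolding f_def by (intro continuous_intros)
  have "0 \<in> K" by (auto simp: K_def)
  then obtain y1 where y1: "y1 \<in> K" "\<And>y. y \<in> K \<Longrightarrow> f y \<le> f y1"
    using continuous_attains_sup[OF \<open>compact K\<close> _ contf] by blast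
  define K' where "K' = K \<inter> {y. f y = f y1}"
  have "compact K'" unfolding K'_def
    by (intro compact_Int_closed \<open>compact K\<close> closed_Collect_eq contf continuous_on_const)
  then obtain y where y: "y \<in> K'" "\<And>z. z \<in> K' \<Longrightarrow> norm z \<le> norm y"
    using continuous_attains_sup[of K' norm] y1 by (auto simp: K'_def continuous_on_norm_id)
  have yK: "y \<in> euc d" "\<And>i. i < n \<Longrightarrow> a i \<bullet> y \<le> 1" "\<And>z. z \<in> K \<Longrightarrow> f z \<le> f y"
    using y y1 by (auto simp: K'_def K_def)
  \<comment> \<open>Since \<open>u0\<close> weakly separates \<open>q\<close> from the points,
    \<open>u0\<close> divided by \<open>\<tau>\<close> lies in the polar body, and \<open>f\<close>
    takes the value \<open>1\<close> there.\<close>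
  have fy: "f y \<ge> 1"
  proof -
    define \<tau> where "\<tau> = (q - c) \<bullet> u0"
    have le: "a i \<bullet> u0 \<le> \<tau>" if "i < n" for i
      using u0(2)[OF that] by (simp add: a_def \<tau>_def inner_diff_left)
    then have t: "\<tau> > 0" using pos[OF u0(1)] by fastforce
    have "(1 / \<tau>) *\<^sub>R u0 \<in> K" using t le u0(1) by (auto simp: K_def unit_sphereD)
    then have "f ((1 / \<tau>) *\<^sub>R u0) \<le> f y" by (rule yK(3))
    then show ?thesis using t by (simp add: f_def \<tau>_def)
  qed
  then have y0: "y \<noteq> 0" by (auto simp: f_def)
  \<comment> \<open>If the active constraints left \<open>w\<close> free, both
    \<open>y + t w\<close> and \<open>y - t w\<close> would lie in \<open>K\<close>. Optimality
    makes \<open>f\<close> constant along this segment, so both are maximisers, and by the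
    parallelogram identity one of them is longer than \<open>y\<close>.\<close>
  have extreme: False if w: "w \<in> unit_sphere d" and act: "\<And>i. i < n \<Longrightarrow> a i \<bullet> y = 1 \<Longrightarrow> a i \<bullet> w = 0" for w
  proof -
    \<comment> \<open>A step length that respects constraint \<open>i\<close> if it is inactive; the
      \<open>+ 1\<close> keeps the denominator positive.\<close>
    define T where "T i = (if a i \<bullet> y = 1 then 1 else (1 - a i \<bullet> y) / (\<bar>a i \<bullet> w\<bar> + 1))" for i
    define t where "t = Min (T ` {..<n})"
    have "T i > 0" if "i < n" for i
      using yK(2)[OF that] by (auto simp: T_def intro!: divide_pos_pos)
    then have t: "t > 0" unfolding t_def using n by (subst Min_gr_iff) auto
    have tT: "t * \<bar>a i \<bullet> w\<bar> \<le> 1 - a i \<bullet> y" if i: "i < n" for i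
    proof (cases "a i \<bullet> y = 1")
      case False
      have "t \<le> T i" using i by (auto simp: t_def)
      then have "t * \<bar>a i \<bullet> w\<bar> \<le> T i * (\<bar>a i \<bullet> w\<bar> + 1)" using t by (intro mult_mono) auto
      also have "\<dots> = 1 - a i \<bullet> y" using False by (simp add: T_def field_simps)
      finally show ?thesis .
    qed (use act i in auto)
    have weuc: "w \<in> euc d" and nw: "norm w = 1" using w by (auto simp: unit_sphereD)
    have in1: "y + s *\<^sub>R w \<in> K" if s: "\<bar>s\<bar> = t" for s
    proof -
      have "a i \<bullet> (y + s *\<^sub>R w) \<le> 1" if i: "i < n" for i
      proof -
        have "s * (a i \<bullet> w) \<le> \<bar>s * (a i \<bullet> w)\<bar>" by simp
        also have "\<dots> = t * \<bar>a i \<bullet> w\<bar>" using s by (simp add: abs_mult)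
        finally show ?thesis using tT[OF i] by (simp add: inner_add_right)
      qed
      then show ?thesis using yK(1) weuc by (simp add: K_def)
    qed
    have p: "y + t *\<^sub>R w \<in> K" "y + (- t) *\<^sub>R w \<in> K" using in1[of t] in1[of "- t"] t by auto
    have fw: "f (y + t *\<^sub>R w) = f y + t * f w" "f (y + (- t) *\<^sub>R w) = f y - t * f w"
      by (simp_all add: f_def inner_add_right inner_diff_right)
    have "t * f w = 0" using yK(3)[OF p(1)] yK(3)[OF p(2)] unfolding fw by linarith
    then have "y + t *\<^sub>R w \<in> K'" "y + (- t) *\<^sub>R w \<in> K'"
      using p fw y(1) by (auto simp: K'_def)
    then have "norm (y + t *\<^sub>R w) \<le> norm y" "norm (y + (- t) *\<^sub>R w) \<le> norm y"
      using y(2) by blast+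
    then have "(norm (y + t *\<^sub>R w))\<^sup>2 \<le> (norm y)\<^sup>2" "(norm (y + (- t) *\<^sub>R w))\<^sup>2 \<le> (norm y)\<^sup>2"
      by (auto intro: power_mono)
    moreover have "(norm (y + t *\<^sub>R w))\<^sup>2 + (norm (y + (- t) *\<^sub>R w))\<^sup>2 = 2 * (norm y)\<^sup>2 + 2 * t\<^sup>2"
    proof -
      have "w \<bullet> w = 1" using nw by (simp add: norm_eq_1)
      then show ?thesis
        unfolding power2_norm_eq_inner
        by (simp add: inner_add_left inner_add_right inner_diff_left inner_diff_right inner_commute[of w y] power2_eq_square algebra_simps)
    qed
    ultimately show False using t by (smt (verit) zero_less_power)
  qed
  define u where "u = y /\<^sub>R norm y"
  \<comment> \<open>The hyperplane \<open>(z - c) \<bullet> y = 1\<close> rewritten with unit normal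
    \<open>u\<close> and without the translation by \<open>c\<close>.\<close>
  define h where "h = (1 + c \<bullet> y) / norm y"
  have u: "u \<in> unit_sphere d" unfolding u_def by (intro normalize_in_unit_sphere yK y0)
  have xu: "x i \<bullet> u = h + (a i \<bullet> y - 1) / norm y" for i
    using y0 by (simp add: u_def h_def a_def inner_diff_left field_simps)
  have xu_le: "x i \<bullet> u \<le> h" if "i < n" for i
    using yK(2)[OF that] by (simp add: xu divide_le_0_iff)
  have xu_eq: "x i \<bullet> u = h \<longleftrightarrow> a i \<bullet> y = 1" for i using y0 by (simp add: xu)
  define A where "A = x ` {i. i < n \<and> a i \<bullet> y = 1}"
  let ?P = "convex hull (x ` {..<n})"
  have Peuc: "?P \<subseteq> euc d" using x by (intro convex_hull_in_euc) auto
  have "\<exists>i<n. a i \<bullet> y = 1"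
    using extreme[of "unit_vec 0"] unit_vec_in_unit_sphere[of 0 d] d by auto
  then have Ane: "A \<noteq> {}" by (auto simp: A_def)
  have Asub: "A \<subseteq> hyperplane_euc d u h"
    using x xu_eq by (auto simp: A_def hyperplane_euc_def)
  have hullA: "affine hull A = hyperplane_euc d u h"
  proof (subst affine_hull_eq_hyperplane_iff[OF u _ Ane Asub]; (intro ballI impI)?)
    fix w assume w: "w \<in> unit_sphere d" and wu: "w \<bullet> u = 0"
    obtain i0 where i0: "i0 < n" "a i0 \<bullet> y = 1" using Ane by (auto simp: A_def)
    show "\<exists>z\<in>A. \<exists>z'\<in>A. z \<bullet> w \<noteq> z' \<bullet> w"
    proof (rule ccontr)
      assume neg: "\<not> ?thesis"
      have const: "x i \<bullet> w = x i0 \<bullet> w" if "i < n" "a i \<bullet> y = 1" for i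
      proof -
        have "x i \<in> A" "x i0 \<in> A" using that i0 by (auto simp: A_def)
        then show ?thesis using neg by blast
      qed
      \<comment> \<open>On the active set \<open>a i \<bullet> w = k\<close> and
        \<open>a i \<bullet> y = 1\<close>, so \<open>w - k *\<^sub>R y\<close> annihilates every
        active \<open>a i\<close>. It is nonzero because \<open>w\<close> is orthogonal to
        \<open>y\<close>.\<close>
      define k where "k = x i0 \<bullet> w - c \<bullet> w"
      define w' where "w' = w - k *\<^sub>R y"
      have wy: "w \<bullet> y = 0" using wu y0 by (simp add: u_def)
      have "w' \<bullet> w = 1" using w wy
        by (simp add: w'_def inner_diff_left inner_commute[of y] unit_sphereD power2_norm_eq_inner[symmetric])
      then have "w' \<noteq> 0" by auto
      moreover have "w' \<in> euc d" using w yK(1) by (simp add: w'_def unit_sphereD)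
      ultimately have "w' /\<^sub>R norm w' \<in> unit_sphere d" by (intro normalize_in_unit_sphere)
      moreover have "a i \<bullet> (w' /\<^sub>R norm w') = 0" if "i < n" "a i \<bullet> y = 1" for i
      proof -
        have "a i \<bullet> w = k" using const[OF that] by (simp add: a_def k_def inner_diff_left)
        then show ?thesis using that(2) by (simp add: w'_def inner_diff_right)
      qed
      ultimately show False using extreme by blast
    qed
  qed (auto simp: A_def)
  define F where "F = ?P \<inter> {z. u \<bullet> z = h}"
  have face: "F face_of ?P" unfolding F_def
    using convex_hull_halfspace[of "{..<n}" x u h] xu_le
    by (intro face_of_Int_supporting_hyperplane_le convex_convex_hull) (auto simp: inner_commute[of u])
  have "A \<subseteq> F" using hull_subset[of "x ` {..<n}" convex] xu_eq
    by (auto simp: A_def F_def inner_commute[of u])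
  then have "affine hull A \<subseteq> affine hull F" by (rule hull_mono)
  moreover have "affine hull F \<subseteq> hyperplane_euc d u h"
    by (intro hull_minimal affine_hyperplane_euc) (use Peuc in \<open>auto simp: F_def hyperplane_euc_def inner_commute[of u]\<close>)
  ultimately have hullF: "affine hull F = hyperplane_euc d u h" using hullA by auto
  have "facet_in d F ?P" unfolding facet_in_def using face has_aff_dim_hyperplane[OF u hullF] by simp
  moreover have "has_height d ?P F h" unfolding has_height_def
    using u hullF convex_hull_halfspace[of "{..<n}" x u h] xu_le
    by (intro bexI[of _ u]) (auto simp: hyperplane_euc_def)
  moreover have "h \<le> norm q"
  proof -
    have "1 + c \<bullet> y \<le> q \<bullet> y" using fy by (simp add: f_def inner_diff_left)
    also have "\<dots> \<le> norm q * norm y" by (rule norm_cauchy_schwarz)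
    finally show ?thesis using y0 by (simp add: h_def field_simps)
  qed
  ultimately show ?thesis by blast
qed

section \<open>Hausdorff distance to the ball and smallest facet height\<close>

lemma convex_hull_subset_unit_ball:
  fixes x :: "nat \<Rightarrow> fseq"
  assumes "\<And>i. i < n \<Longrightarrow> x i \<in> unit_sphere d"
  shows "convex hull (x ` {..<n}) \<subseteq> unit_ball d"
  using assms
  by (intro hull_minimal) (auto simp: unit_ball_def unit_sphere_def convex_Int subspace_imp_convex)

lemma unit_sphere_nonempty: "0 < d \<Longrightarrow> unit_sphere d \<noteq> {}"
  using unit_vec_in_unit_sphere[of 0 d] by auto

text \<open>Let \<open>c\<close> be the point of the hull nearest to \<open>b\<close> and
  \<open>u\<close> the direction of \<open>b - c\<close>. The hull does not reach beyond
  \<open>c\<close> in direction \<open>u\<close>, so \<open>L \<le> c \<bullet> u\<close>, while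
  \<open>b \<bullet> u \<le> 1\<close>; the distance is the difference of the two heights.\<close>

lemma infdist_convex_hull_le:
  fixes x :: "nat \<Rightarrow> fseq"
  assumes x: "\<And>i. i < n \<Longrightarrow> x i \<in> unit_sphere d" and d: "0 < d"
    and L: "\<And>u. u \<in> unit_sphere d \<Longrightarrow> \<exists>i<n. L \<le> x i \<bullet> u"
    and b: "b \<in> unit_ball d"
  shows "infdist b (convex hull (x ` {..<n})) \<le> 1 - L"
proof -
  let ?P = "convex hull (x ` {..<n})"
  obtain u0 where u0: "u0 \<in> unit_sphere d" using unit_sphere_nonempty[OF d] by auto
  then obtain i0 where i0: "i0 < n" "L \<le> x i0 \<bullet> u0" using L by blast
  have "x i0 \<bullet> u0 \<le> 1"
    using norm_cauchy_schwarz[of "x i0" u0] u0 x[OF i0(1)] by (simp add: unit_sphereD)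
  then have L1: "L \<le> 1" using i0 by simp
  have "compact ?P" by (intro finite_imp_compact_convex_hull finite_imageI finite_lessThan)
  moreover have ne: "?P \<noteq> {}" using i0 by auto
  ultimately obtain c where c: "c \<in> ?P" "\<And>z. z \<in> ?P \<Longrightarrow> dist b c \<le> dist b z"
    using continuous_attains_inf[of ?P "dist b"] continuous_on_dist[OF continuous_on_const continuous_on_id] by blast
  show ?thesis
  proof (cases "b = c")
    case True
    then show ?thesis using c L1 by simp
  next
    case False
    define u where "u = (b - c) /\<^sub>R norm (b - c)"
    have "c \<in> euc d" using c(1) convex_hull_subset_unit_ball[of n x d, OF x] by (auto simp: unit_ball_def)
    then have u: "u \<in> unit_sphere d" unfolding u_def
      using b False by (intro normalize_in_unit_sphere) (auto simp: unit_ball_def)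
    obtain i where i: "i < n" "L \<le> x i \<bullet> u" using L[OF u] by blast
    have "x i \<in> ?P" using i by (auto intro: hull_inc)
    then have "(b - c) \<bullet> (x i - c) \<le> 0"
      using any_closest_point_dot[of ?P c "x i" b] c \<open>compact ?P\<close> by (auto simp: compact_imp_closed)
    then have "x i \<bullet> u \<le> c \<bullet> u"
    proof -
      assume le: "(b - c) \<bullet> (x i - c) \<le> 0"
      have "(x i - c) \<bullet> u = ((x i - c) \<bullet> (b - c)) / norm (b - c)"
        by (simp only: u_def inner_scaleR_right divide_inverse mult.commute)
      also have "\<dots> \<le> 0"
        using le unfolding inner_commute[of "b - c"] by (simp add: divide_le_0_iff)
      finally show ?thesis by (simp add: inner_diff_left)
    qed
    then have "L \<le> c \<bullet> u" using i by simp
    moreover have "dist b c = (b - c) \<bullet> u"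
      using False by (simp add: u_def dist_norm power2_norm_eq_inner[symmetric] power2_eq_square)
    moreover have "b \<bullet> u \<le> 1"
    proof -
      have "b \<bullet> u \<le> norm b * norm u" by (rule norm_cauchy_schwarz)
      then show ?thesis using b u by (simp add: unit_ball_def unit_sphereD)
    qed
    ultimately have "dist b c \<le> 1 - L" by (simp add: inner_diff_left)
    then show ?thesis using infdist_le2[OF c(1)] by blast
  qed
qed

lemma zero_in_unit_ball: "0 \<in> unit_ball d"
  by (simp add: unit_ball_def)

text \<open>The polytope lies in the ball, so one of the two suprema is \<open>0\<close>.
  Boundedness is recorded because a real supremum says nothing without it.\<close>

lemma hausdorff_dist_unit_ball_eq:
  fixes x :: "nat \<Rightarrow> fseq"
  assumes x: "\<And>i. i < n \<Longrightarrow> x i \<in> unit_sphere d" and n: "0 < n"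
  shows "hausdorff_dist (convex hull (x ` {..<n})) (unit_ball d)
    = (SUP b\<in>unit_ball d. infdist b (convex hull (x ` {..<n})))"
    and "bdd_above ((\<lambda>b. infdist b (convex hull (x ` {..<n}))) ` unit_ball d)"
proof -
  let ?P = "convex hull (x ` {..<n})"
  have x0: "x 0 \<in> ?P" using n by (auto intro: hull_inc)
  have "infdist a (unit_ball d) = 0" if "a \<in> ?P" for a
    using that convex_hull_subset_unit_ball[of n x d, OF x] by auto
  then have "(SUP a\<in>?P. infdist a (unit_ball d)) = (SUP a\<in>?P. 0)" by (intro SUP_cong) auto
  also have "\<dots> = 0" using x0 by (intro cSUP_const) auto
  finally have 1: "(SUP a\<in>?P. infdist a (unit_ball d)) = 0" .
  show bdd: "bdd_above ((\<lambda>b. infdist b ?P) ` unit_ball d)"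
  proof (rule bdd_aboveI2)
    fix b assume "b \<in> unit_ball d"
    then show "infdist b ?P \<le> 2"
      using norm_triangle_ineq4[of b "x 0"] x[OF n] 
      by (intro infdist_le2[OF x0]) (auto simp: dist_norm unit_ball_def unit_sphereD)
  qed
  have "infdist 0 ?P \<le> (SUP b\<in>unit_ball d. infdist b ?P)"
    by (rule cSUP_upper[OF zero_in_unit_ball bdd])
  then have "0 \<le> (SUP b\<in>unit_ball d. infdist b ?P)" using infdist_nonneg order_trans by blast
  then show "hausdorff_dist ?P (unit_ball d) = (SUP b\<in>unit_ball d. infdist b ?P)"
    unfolding hausdorff_dist_def 1 by simp
qed

lemma hausdorff_dist_unit_ball_le:
  fixes x :: "nat \<Rightarrow> fseq"
  assumes x: "\<And>i. i < n \<Longrightarrow> x i \<in> unit_sphere d" and d: "0 < d" and n: "0 < n"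
    and L: "\<And>u. u \<in> unit_sphere d \<Longrightarrow> \<exists>i<n. L \<le> x i \<bullet> u"
  shows "hausdorff_dist (convex hull (x ` {..<n})) (unit_ball d) \<le> 1 - L"
proof -
  have eq: "hausdorff_dist (convex hull (x ` {..<n})) (unit_ball d)
    = (SUP b\<in>unit_ball d. infdist b (convex hull (x ` {..<n})))"
    by (rule hausdorff_dist_unit_ball_eq(1)) (use x n in auto)
  show ?thesis unfolding eq
    by (rule cSUP_least) (use infdist_convex_hull_le[of n x d, OF x d L] zero_in_unit_ball in auto)
qed

lemma hausdorff_dist_unit_ball_ge:
  fixes x :: "nat \<Rightarrow> fseq"
  assumes x: "\<And>i. i < n \<Longrightarrow> x i \<in> unit_sphere d" and n: "0 < n"
    and u: "u \<in> unit_sphere d" "\<And>i. i < n \<Longrightarrow> x i \<bullet> u \<le> U"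
  shows "1 - U \<le> hausdorff_dist (convex hull (x ` {..<n})) (unit_ball d)"
proof -
  let ?P = "convex hull (x ` {..<n})"
  have ne: "?P \<noteq> {}" using n by auto
  have "1 - U \<le> dist u y" if "y \<in> ?P" for y
  proof -
    have "y \<bullet> u \<le> U" by (rule convex_hull_halfspace[OF _ that]) (use u in auto)
    then have "1 - U \<le> (u - y) \<bullet> u"
      using u(1) by (simp add: inner_diff_left unit_sphereD power2_norm_eq_inner[symmetric])
    also have "\<dots> \<le> norm (u - y) * norm u" by (rule norm_cauchy_schwarz)
    finally show ?thesis using u(1) by (simp add: unit_sphereD dist_norm)
  qed
  then have "1 - U \<le> infdist u ?P" using ne by (auto simp: infdist_notempty intro!: cINF_greatest)
  also have "\<dots> \<le> (SUP b\<in>unit_ball d. infdist b ?P)"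
    by (rule cSUP_upper[OF _ hausdorff_dist_unit_ball_eq(2)[of n x d, OF x n]])
       (use u(1) in \<open>auto simp: unit_ball_def unit_sphere_def\<close>)
  also have "\<dots> = hausdorff_dist ?P (unit_ball d)"
    by (rule hausdorff_dist_unit_ball_eq(1)[symmetric]) (use x n in auto)
  finally show ?thesis .
qed

lemma facet_height_ge:
  fixes x :: "nat \<Rightarrow> fseq"
  assumes h: "has_height d (convex hull (x ` {..<n})) F h" "facet_in d F (convex hull (x ` {..<n}))"
    and L: "\<And>u. u \<in> unit_sphere d \<Longrightarrow> \<exists>i<n. L \<le> x i \<bullet> u"
  shows "L \<le> h"
proof -
  obtain u where u: "u \<in> unit_sphere d" "convex hull (x ` {..<n}) \<subseteq> {z. z \<bullet> u \<le> h}"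
    using h(1) by (auto simp: has_height_def)
  obtain i where i: "i < n" "L \<le> x i \<bullet> u" using L[OF u(1)] by blast
  have "x i \<in> convex hull (x ` {..<n})" using i by (auto intro: hull_inc)
  then have "x i \<bullet> u \<le> h" using u(2) by auto
  then show ?thesis using i by simp
qed

text \<open>The upper bound applies \<open>exists_facet_not_beyond\<close> to the point
  \<open>U *\<^sub>R u0\<close>. Its norm is \<open>U\<close> only if \<open>0 \<le> U\<close>,
  which is why the smallest height is controlled by \<open>max 0 r\<close> and not by
  \<open>r\<close>.\<close>

lemma min_facet_height_bounds:
  fixes x :: "nat \<Rightarrow> fseq"
  assumes x: "\<And>i. i < n \<Longrightarrow> x i \<in> unit_sphere d" and sp: "spread d n x" and d: "0 < d"
  shows "(\<And>u. u \<in> unit_sphere d \<Longrightarrow> \<exists>i<n. L \<le> x i \<bullet> u) \<Longrightarrow> L \<le> min_facet_height d (convex hull (x ` {..<n}))"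
    and "u0 \<in> unit_sphere d \<Longrightarrow> (\<And>i. i < n \<Longrightarrow> x i \<bullet> u0 \<le> U) \<Longrightarrow> 0 \<le> U \<Longrightarrow>
      min_facet_height d (convex hull (x ` {..<n})) \<le> U"
proof -
  let ?P = "convex hull (x ` {..<n})"
  let ?H = "{h. \<exists>F. facet_in d F ?P \<and> has_height d ?P F h}"
  have upper: "\<exists>h\<in>?H. h \<le> U" if u0: "u0 \<in> unit_sphere d" "\<And>i. i < n \<Longrightarrow> x i \<bullet> u0 \<le> U" "0 \<le> U" for u0 U
  proof -
    have "norm (U *\<^sub>R u0) = U" using u0 by (simp add: unit_sphereD)
    moreover have "(U *\<^sub>R u0) \<bullet> u0 = U" using u0 by (simp add: unit_sphereD power2_norm_eq_inner[symmetric])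
    moreover have "U *\<^sub>R u0 \<in> euc d" using u0 by (simp add: unit_sphereD)
    ultimately show ?thesis
    proof -
      assume 1: "norm (U *\<^sub>R u0) = U" "U *\<^sub>R u0 \<bullet> u0 = U" "U *\<^sub>R u0 \<in> euc d"
      have xe: "x i \<in> euc d" if "i < n" for i using x[OF that] by (rule unit_sphereD)
      have "x i \<bullet> u0 \<le> U *\<^sub>R u0 \<bullet> u0" if "i < n" for i using u0(2)[OF that] unfolding 1(2) .
      from exists_facet_not_beyond[OF xe sp d 1(3) u0(1) this]
      show ?thesis unfolding 1(1) by blast
    qed
  qed
  have le1: "\<bar>x i \<bullet> u\<bar> \<le> 1" if "i < n" "u \<in> unit_sphere d" for i u
    using Cauchy_Schwarz_ineq2[of "x i" u] x[OF that(1)] that(2) by (simp add: unit_sphereD)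
  have lower: "L \<le> h" if "h \<in> ?H" "\<And>u. u \<in> unit_sphere d \<Longrightarrow> \<exists>i<n. L \<le> x i \<bullet> u" for L h
    using that facet_height_ge[of d x n _ h L] by blast
  obtain u1 where u1: "u1 \<in> unit_sphere d" using unit_sphere_nonempty[OF d] by auto
  have n: "0 < n" using sp u1 by (auto simp: spread_def)
  \<comment> \<open>The value \<open>U = 1\<close> is always admissible, so facets exist and the
    infimum is taken over a nonempty set.\<close>
  have ne: "?H \<noteq> {}" using upper[OF u1, of 1] le1[OF _ u1] by (force simp: abs_le_iff)
  show "L \<le> min_facet_height d ?P" if "\<And>u. u \<in> unit_sphere d \<Longrightarrow> \<exists>i<n. L \<le> x i \<bullet> u"
    unfolding min_facet_height_def by (rule cInf_greatest[OF ne]) (rule lower[OF _ that])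
  have bdd: "bdd_below ?H"
  proof (rule bdd_belowI)
    fix h assume "h \<in> ?H"
    then show "- 1 \<le> h" using n le1[OF n] by (intro lower) (auto simp: abs_le_iff)
  qed
  show "min_facet_height d ?P \<le> U" if "u0 \<in> unit_sphere d" "\<And>i. i < n \<Longrightarrow> x i \<bullet> u0 \<le> U" "0 \<le> U"
    using upper[OF that] cInf_lower[OF _ bdd] unfolding min_facet_height_def by force
qed

lemma continuous_on_Max_family:
  fixes f :: "nat \<Rightarrow> 'a::topological_space \<Rightarrow> real"
  assumes "\<And>i. i \<le> n \<Longrightarrow> continuous_on S (f i)"
  shows "continuous_on S (\<lambda>u. Max ((\<lambda>i. f i u) ` {..n}))"
  using assms
proof (induction n)
  case (Suc n)
  have "continuous_on S (\<lambda>u. max (f (Suc n) u) (Max ((\<lambda>i. f i u) ` {..n})))"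
    by (intro continuous_intros Suc) auto
  then show ?case by (simp add: atMost_Suc)
qed simp

text \<open>The sphere is compact, so the minimum of the support function is attained, and one
  number \<open>r\<close> serves as upper and as lower bound.\<close>

lemma exists_minimal_support:
  fixes x :: "nat \<Rightarrow> fseq"
  assumes "0 < d" "0 < n"
  shows "\<exists>r. \<exists>u\<in>unit_sphere d. (\<forall>i<n. x i \<bullet> u \<le> r) \<and> (\<forall>v\<in>unit_sphere d. \<exists>i<n. r \<le> x i \<bullet> v)"
proof -
  obtain m where m: "n = Suc m" using assms(2) by (cases n) auto
  define g where "g u = Max ((\<lambda>i. x i \<bullet> u) ` {..m})" for u
  have "continuous_on (unit_sphere d) g"
    unfolding g_def by (intro continuous_on_Max_family continuous_intros)
  then obtain u where u: "u \<in> unit_sphere d" "\<And>v. v \<in> unit_sphere d \<Longrightarrow> g u \<le> g v"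
    using continuous_attains_inf[OF compact_unit_sphere, of d g] unit_sphere_nonempty[OF assms(1)] by auto
  have "\<exists>i<n. g u \<le> x i \<bullet> v" if "v \<in> unit_sphere d" for v
  proof -
    have "g v \<in> (\<lambda>i. x i \<bullet> v) ` {..m}" unfolding g_def by (intro Max_in) auto
    then show ?thesis using u(2)[OF that] m by (auto simp: less_Suc_eq_le)
  qed
  moreover have "\<forall>i<n. x i \<bullet> u \<le> g u" by (auto simp: g_def m less_Suc_eq_le)
  ultimately show ?thesis using u(1) by blast
qed

text \<open>The last hypothesis says that \<open>r\<close> is nonnegative; then
  \<open>max 0 r = r\<close> and both sides equal \<open>1 - r\<close>.\<close>

lemma hausdorff_dist_eq_min_facet_height:
  fixes x :: "nat \<Rightarrow> fseq"
  assumes x: "\<And>i. i < n \<Longrightarrow> x i \<in> unit_sphere d" and sp: "spread d n x" and d: "0 < d"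
    and 0: "\<And>u. u \<in> unit_sphere d \<Longrightarrow> \<exists>i<n. 0 \<le> x i \<bullet> u"
  shows "hausdorff_dist (convex hull (x ` {..<n})) (unit_ball d) = 1 - min_facet_height d (convex hull (x ` {..<n}))"
proof -
  have n: "0 < n" using unit_sphere_nonempty[OF d] 0 by fastforce
  obtain r u where r: "u \<in> unit_sphere d" "\<And>i. i < n \<Longrightarrow> x i \<bullet> u \<le> r"
    "\<And>v. v \<in> unit_sphere d \<Longrightarrow> \<exists>i<n. r \<le> x i \<bullet> v"
    using exists_minimal_support[OF d n, of x] by blast
  have "0 \<le> r" using 0[OF r(1)] r(2) by fastforce
  then have "min_facet_height d (convex hull (x ` {..<n})) = r"
    using min_facet_height_bounds[where x = x, OF x sp d] r by (intro antisym) blast+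
  moreover have "hausdorff_dist (convex hull (x ` {..<n})) (unit_ball d) = 1 - r"
    using hausdorff_dist_unit_ball_le[where x = x, OF x d n r(3)]
      hausdorff_dist_unit_ball_ge[of n x d, OF x n r(1,2)] by simp
  ultimately show ?thesis by simp
qed

lemma zero_in_convex_hull_support:
  fixes x :: "nat \<Rightarrow> 'a::real_inner"
  assumes "0 \<in> convex hull (x ` {..<n})"
  shows "\<exists>i<n. 0 \<le> x i \<bullet> u"
proof (rule ccontr)
  assume "\<not> ?thesis"
  then have "convex hull (x ` {..<n}) \<subseteq> {z. u \<bullet> z < 0}"
    by (intro hull_minimal convex_halfspace_lt) (auto simp: not_le inner_commute[of u])
  then show False using assms by auto
qed

subsection \<open>Volumes and spherical caps\<close>

lemma sets_lebesgue_euc [simp, measurable_cong]: "sets (lebesgue_euc d) = sets borel"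
  by (simp add: lebesgue_euc_def)

lemma space_lebesgue_euc [simp]: "space (lebesgue_euc d) = UNIV"
  by (simp add: lebesgue_euc_def)

lemma sets_uniform_sphere [simp, measurable_cong]: "sets (uniform_sphere d) = sets borel"
  by (simp add: uniform_sphere_def)

lemma space_uniform_sphere [simp]: "space (uniform_sphere d) = UNIV"
  by (simp add: uniform_sphere_def)

text \<open>A product measure is determined by boxes, where the claim splits into one-dimensional
  substitutions, each contributing one factor \<open>r\<close>.\<close>

lemma PiM_lborel_affine:
  fixes t :: "nat \<Rightarrow> real"
  assumes "finite I" "0 < r"
  shows "Pi\<^sub>M I (\<lambda>_. lborel) =
    scale_measure (ennreal (r ^ card I)) (distr (Pi\<^sub>M I (\<lambda>_. lborel)) (Pi\<^sub>M I (\<lambda>_. lborel)) (\<lambda>f. \<lambda>i\<in>I. t i + r * f i))"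
    (is "?P = ?Q")
proof -
  interpret P: product_sigma_finite "\<lambda>_::nat. lborel :: real measure" by standard
  have T: "(\<lambda>f. \<lambda>i\<in>I. t i + r * f i) \<in> measurable ?P ?P"
    by measurable
  show ?thesis
  proof (rule P.PiM_eqI[symmetric])
    fix A :: "nat \<Rightarrow> real set" assume A: "\<And>i. i \<in> I \<Longrightarrow> A i \<in> sets lborel"
    have pre: "(\<lambda>f. \<lambda>i\<in>I. t i + r * f i) -` (Pi\<^sub>E I A) \<inter> space ?P = Pi\<^sub>E I (\<lambda>i. (\<lambda>x. t i + r * x) -` A i)"
      by (auto simp: space_PiM PiE_iff)
    have PA: "Pi\<^sub>E I A \<in> sets ?P" by (intro sets_PiM_I_finite assms A)
    have "emeasure ?Q (Pi\<^sub>E I A) = ennreal (r ^ card I) * emeasure ?P (Pi\<^sub>E I (\<lambda>i. (\<lambda>x. t i + r * x) -` A i))"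
      using T PA by (simp add: emeasure_distr pre)
    also have "emeasure ?P (Pi\<^sub>E I (\<lambda>i. (\<lambda>x. t i + r * x) -` A i)) = (\<Prod>i\<in>I. emeasure lborel ((\<lambda>x. t i + r * x) -` A i))"
    proof (rule P.emeasure_PiM[OF assms(1)])
      fix i assume "i \<in> I"
      have "(\<lambda>x. t i + r * x) \<in> borel_measurable borel" by simp
      from measurable_sets[OF this, of "A i"] A[OF \<open>i \<in> I\<close>]
      show "(\<lambda>x. t i + r * x) -` A i \<in> sets lborel" by simp
    qed
    also have "ennreal (r ^ card I) * \<dots> = (\<Prod>i\<in>I. ennreal r * emeasure lborel ((\<lambda>x. t i + r * x) -` A i))"
      using assms by (simp add: prod.distrib ennreal_power)
    also have "\<dots> = (\<Prod>i\<in>I. emeasure lborel (A i))"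
    proof (rule prod.cong[OF refl])
      fix i assume "i \<in> I"
      then have "A i \<in> sets borel" using A by auto
      then show "ennreal r * emeasure lborel ((\<lambda>x. t i + r * x) -` A i) = emeasure lborel (A i)"
        using assms(2) by (subst (2) lborel_real_affine[of r "t i"]) (simp_all add: emeasure_density nn_integral_cmult emeasure_distr)
    qed
    finally show "emeasure ?Q (Pi\<^sub>E I A) = (\<Prod>i\<in>I. emeasure lborel (A i))" .
  qed (use assms in auto)
qed

lemma emeasure_lebesgue_euc: "A \<in> sets borel \<Longrightarrow>
  emeasure (lebesgue_euc d) A = emeasure (Pi\<^sub>M {..<d} (\<lambda>_. lborel)) (embed d -` A \<inter> space (Pi\<^sub>M {..<d} (\<lambda>_. lborel)))"
  unfolding lebesgue_euc_def by (rule emeasure_distr) auto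

lemma emeasure_lebesgue_euc_affine:
  assumes c: "c \<in> euc d" and r: "0 < r" and A [measurable]: "A \<in> sets borel"
  shows "emeasure (lebesgue_euc d) A = ennreal (r ^ d) * emeasure (lebesgue_euc d) {y. c + r *\<^sub>R y \<in> A}"
proof -
  let ?L = "Pi\<^sub>M {..<d} (\<lambda>_. lborel :: real measure)"
  let ?T = "\<lambda>f. \<lambda>i\<in>{..<d}. coord c i + r * f i"
  have T: "?T \<in> measurable ?L ?L" by measurable
  have A2: "{y. c + r *\<^sub>R y \<in> A} \<in> sets borel" by measurable
  have eT: "embed d (?T f) = c + r *\<^sub>R embed d f" for f
    using c by (intro fseq_eqI) (auto simp: euc_def)
  have PA: "embed d -` A \<inter> space ?L \<in> sets ?L" by (rule measurable_sets[OF measurable_embed A])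
  have "emeasure (lebesgue_euc d) A = emeasure ?L (embed d -` A \<inter> space ?L)"
    by (rule emeasure_lebesgue_euc[OF A])
  also have "\<dots> = ennreal (r ^ d) * emeasure ?L (?T -` (embed d -` A \<inter> space ?L) \<inter> space ?L)"
    by (subst PiM_lborel_affine[of "{..<d}" r "coord c"]) (use T PA r in \<open>simp_all add: emeasure_distr\<close>)
  also have "?T -` (embed d -` A \<inter> space ?L) \<inter> space ?L = embed d -` {y. c + r *\<^sub>R y \<in> A} \<inter> space ?L"
    using eT measurable_space[OF T] by auto
  finally show ?thesis using A2 by (simp add: emeasure_lebesgue_euc)
qed

lemma measure_lebesgue_euc_affine:
  assumes "c \<in> euc d" "0 < r" "A \<in> sets borel"
  shows "measure (lebesgue_euc d) A = r ^ d * measure (lebesgue_euc d) {y. c + r *\<^sub>R y \<in> A}"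
  using assms by (simp add: measure_def emeasure_lebesgue_euc_affine[OF assms] enn2real_mult)

lemma sets_borel_euc [measurable]: "euc d \<in> sets borel"
  by (simp add: borel_closed closed_euc)

lemma sets_borel_unit_ball [measurable]: "unit_ball d \<in> sets borel"
  by (simp add: unit_ball_def)

lemma closed_unit_sphere: "closed (unit_sphere d)"
  by (intro compact_imp_closed compact_unit_sphere)

lemma sets_borel_unit_sphere [measurable]: "unit_sphere d \<in> sets borel"
  by (simp add: borel_closed closed_unit_sphere)

lemma borel_measurable_sgn_fseq [measurable]: "(sgn :: fseq \<Rightarrow> fseq) \<in> borel_measurable borel"
  by (simp add: sgn_div_norm[abs_def])

lemma emeasure_lebesgue_euc_Int_euc:
  assumes [measurable]: "A \<in> sets borel"
  shows "emeasure (lebesgue_euc d) (A \<inter> euc d) = emeasure (lebesgue_euc d) A"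
proof -
  have "embed d f \<in> euc d" for f by (auto simp: euc_def)
  then have "embed d -` (A \<inter> euc d) = embed d -` A" by auto
  then show ?thesis by (simp add: emeasure_lebesgue_euc)
qed

text \<open>Read off from the fact that \<open>uniform_sphere d\<close> is a probability measure:
  its total mass is \<open>V / V\<close>, which equals \<open>1\<close> only if \<open>V\<close> is
  neither \<open>0\<close> nor infinite.\<close>

lemma emeasure_unit_ball:
  "emeasure (lebesgue_euc d) (unit_ball d) \<noteq> 0" "emeasure (lebesgue_euc d) (unit_ball d) < \<infinity>"
proof -
  interpret prob_space "uniform_sphere d" by (rule prob_space_uniform_sphere)
  let ?V = "emeasure (lebesgue_euc d) (unit_ball d)"
  have "emeasure (uniform_sphere d) UNIV = ?V / ?V"
    unfolding uniform_sphere_def by (subst emeasure_distr) (auto simp: emeasure_uniform_measure)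
  moreover have "emeasure (uniform_sphere d) UNIV = 1" using emeasure_space_1 by simp
  ultimately have "?V / ?V = 1" by simp
  then show "?V \<noteq> 0" "?V < \<infinity>" by (auto simp: less_top[symmetric])
qed

section \<open>Volumes of balls and of cones over subsets of the sphere\<close>

definition ball_vol :: "nat \<Rightarrow> real"
  where "ball_vol d = measure (lebesgue_euc d) (unit_ball d)"

lemma ball_vol_pos: "0 < ball_vol d"
  using emeasure_unit_ball[of d] by (simp add: ball_vol_def measure_def enn2real_positive_iff less_top zero_less_iff_neq_zero)

lemma emeasure_cball_euc:
  assumes "c \<in> euc d" "0 < r"
  shows "emeasure (lebesgue_euc d) (cball c r) = ennreal (r ^ d * ball_vol d)"
proof -
  have "emeasure (lebesgue_euc d) (cball c r) = ennreal (r ^ d) * emeasure (lebesgue_euc d) {y. c + r *\<^sub>R y \<in> cball c r}"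
    using assms by (rule emeasure_lebesgue_euc_affine) simp
  also have "{y. c + r *\<^sub>R y \<in> cball c r} = cball 0 1"
    using assms(2) by (auto simp: dist_norm)
  also have "emeasure (lebesgue_euc d) (cball 0 1) = emeasure (lebesgue_euc d) (unit_ball d)"
    unfolding unit_ball_def by (subst emeasure_lebesgue_euc_Int_euc) auto
  also have "\<dots> = ennreal (ball_vol d)"
    using emeasure_unit_ball[of d] by (simp add: ball_vol_def emeasure_eq_ennreal_measure)
  finally show ?thesis using assms(2) ball_vol_pos[of d] by (simp add: ennreal_mult)
qed

lemma measure_cball_euc:
  "c \<in> euc d \<Longrightarrow> 0 < r \<Longrightarrow> measure (lebesgue_euc d) (cball c r) = r ^ d * ball_vol d"
  using ball_vol_pos[of d] by (simp add: measure_def emeasure_cball_euc)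

lemma fmeasurable_bounded:
  assumes "A \<in> sets borel" "A \<subseteq> cball 0 r"
  shows "A \<in> fmeasurable (lebesgue_euc d)"
proof (rule fmeasurableI2)
  show "cball 0 (max r 1) \<in> fmeasurable (lebesgue_euc d)"
    by (rule fmeasurableI) (auto simp: emeasure_cball_euc)
qed (use assms in auto)

lemma measure_lebesgue_euc_mono:
  assumes "A \<in> sets borel" "B \<in> sets borel" "B \<subseteq> cball 0 r" "A \<inter> euc d \<subseteq> B"
  shows "measure (lebesgue_euc d) A \<le> measure (lebesgue_euc d) B"
proof -
  have "measure (lebesgue_euc d) A = measure (lebesgue_euc d) (A \<inter> euc d)"
    using assms(1) by (simp add: measure_def emeasure_lebesgue_euc_Int_euc)
  also have "\<dots> \<le> measure (lebesgue_euc d) B"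
    by (rule measure_mono_fmeasurable[OF assms(4) _ fmeasurable_bounded[OF assms(2,3)]]) (use assms in auto)
  finally show ?thesis .
qed

lemma measure_uniform_sphere:
  assumes [measurable]: "C \<in> sets borel"
  shows "measure (lebesgue_euc d) {y \<in> cball 0 1. sgn y \<in> C} = measure (uniform_sphere d) C * ball_vol d"
proof -
  let ?U = "uniform_measure (lebesgue_euc d) (unit_ball d)"
  have "measure (uniform_sphere d) C = measure ?U (sgn -` C \<inter> space ?U)"
    unfolding uniform_sphere_def by (rule measure_distr) auto
  also have "\<dots> = measure (lebesgue_euc d) (unit_ball d \<inter> sgn -` C) / ball_vol d"
    unfolding ball_vol_def using emeasure_unit_ball[of d]
    by (subst measure_uniform_measure) (auto simp: measurable_sets_borel[OF borel_measurable_sgn_fseq])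
  also have "measure (lebesgue_euc d) (unit_ball d \<inter> sgn -` C) = measure (lebesgue_euc d) ({y \<in> cball 0 1. sgn y \<in> C} \<inter> euc d)"
    by (rule arg_cong[where f = "measure _"]) (auto simp: unit_ball_def)
  also have "\<dots> = measure (lebesgue_euc d) {y \<in> cball 0 1. sgn y \<in> C}"
    unfolding measure_def by (subst emeasure_lebesgue_euc_Int_euc) auto
  finally show ?thesis using ball_vol_pos[of d] by simp
qed

lemma measure_cone:
  assumes [measurable]: "C \<in> sets borel" and b: "0 < b"
  shows "measure (lebesgue_euc d) {y. norm y \<le> b \<and> sgn y \<in> C} = b ^ d * measure (uniform_sphere d) C * ball_vol d"
proof -
  have "measure (lebesgue_euc d) {y. norm y \<le> b \<and> sgn y \<in> C}
    = b ^ d * measure (lebesgue_euc d) {y. 0 + b *\<^sub>R y \<in> {y. norm y \<le> b \<and> sgn y \<in> C}}"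
    by (rule measure_lebesgue_euc_affine) (use b in auto)
  also have "{y. 0 + b *\<^sub>R y \<in> {y. norm y \<le> b \<and> sgn y \<in> C}} = {y \<in> cball 0 1. sgn y \<in> C}"
    using b by (auto simp: sgn_scaleR)
  finally show ?thesis unfolding measure_uniform_sphere[OF assms(1)] by (simp only: mult.assoc)
qed

text \<open>Doubling fixes the set but multiplies its measure by \<open>2 ^ d\<close>.\<close>

lemma measure_singleton_zero: "0 < d \<Longrightarrow> measure (lebesgue_euc d) {0} = 0"
proof -
  assume d: "0 < d"
  have "measure (lebesgue_euc d) {0} = 2 ^ d * measure (lebesgue_euc d) {y. 0 + 2 *\<^sub>R y \<in> {0}}"
    by (rule measure_lebesgue_euc_affine) auto
  also have "{y::fseq. 0 + 2 *\<^sub>R y \<in> {0}} = {0}" by auto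
  finally have "(2 ^ d - 1) * measure (lebesgue_euc d) {0} = 0" by (simp add: algebra_simps)
  moreover have "1 < (2::real) ^ d" using d by (intro one_less_power) auto
  ultimately show ?thesis by simp
qed

text \<open>The passage between spherical measure and volume. The inner inequality is strict, so the
  origin, which has no direction, is left out even for \<open>a = 0\<close>.\<close>

lemma measure_cone_annulus:
  assumes C [measurable]: "C \<in> sets borel" and d: "0 < d" and ab: "0 \<le> a" "a < b"
  shows "measure (lebesgue_euc d) {y. a < norm y \<and> norm y \<le> b \<and> sgn y \<in> C}
    = (b ^ d - a ^ d) * measure (uniform_sphere d) C * ball_vol d"
proof -
  let ?A = "\<lambda>r. {y. norm y \<le> r \<and> sgn y \<in> C}"
  have a: "measure (lebesgue_euc d) (?A a) = a ^ d * measure (uniform_sphere d) C * ball_vol d"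
  proof (cases "a = 0")
    case True
    have "measure (lebesgue_euc d) (?A 0) \<le> measure (lebesgue_euc d) {0}"
      by (rule measure_lebesgue_euc_mono[of _ _ 0]) auto
    then show ?thesis using d True measure_singleton_zero[OF d] by (simp add: measure_le_0_iff)
  qed (use ab measure_cone[OF C] in auto)
  have "{y. a < norm y \<and> norm y \<le> b \<and> sgn y \<in> C} = ?A b - ?A a" by auto
  also have "measure (lebesgue_euc d) (?A b - ?A a) = measure (lebesgue_euc d) (?A b) - measure (lebesgue_euc d) (?A a)"
    by (rule measurable_measure_Diff[OF fmeasurable_bounded[where r = b]]) (use ab in auto)
  finally show ?thesis using measure_cone[OF C, of b d] a ab by (simp add: algebra_simps)
qed

section \<open>Upper and lower bounds for the measure of caps\<close>

text \<open>A half-space instead of its trace on the sphere: for \<open>d > 0\<close> the uniform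
  measure does not see the difference, and the set is independent of \<open>d\<close>.\<close>

definition cap :: "fseq \<Rightarrow> real \<Rightarrow> fseq set"
  where "cap u h = {x. h \<le> x \<bullet> u}"

lemma sets_borel_cap [measurable]: "cap u h \<in> sets borel"
  unfolding cap_def by measurable

lemma sgn_in_cap: "y \<noteq> 0 \<Longrightarrow> sgn y \<in> cap u h \<longleftrightarrow> h * norm y \<le> y \<bullet> u"
  by (simp add: cap_def sgn_div_norm field_simps)

text \<open>The condition on \<open>y\<close> describes the cone over the cap, cut off at the radii
  \<open>a\<close> and \<open>b\<close>. A set inside this region bounds the cap from below;
  \<open>cap_le_measure\<close> is the counterpart for a set around it.\<close>

lemma measure_le_cap:
  assumes "A \<in> sets borel" "0 < d" "0 \<le> a" "a < b"
    and "\<And>y. y \<in> A \<Longrightarrow> y \<in> euc d \<Longrightarrow> a < norm y \<and> norm y \<le> b \<and> h * norm y \<le> y \<bullet> u"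
  shows "measure (lebesgue_euc d) A \<le> (b ^ d - a ^ d) * measure (uniform_sphere d) (cap u h) * ball_vol d"
  unfolding measure_cone_annulus[OF sets_borel_cap assms(2-4), symmetric]
proof (rule measure_lebesgue_euc_mono[of _ _ b])
  show "A \<inter> euc d \<subseteq> {y. a < norm y \<and> norm y \<le> b \<and> sgn y \<in> cap u h}"
  proof
    fix y assume "y \<in> A \<inter> euc d"
    then have *: "a < norm y \<and> norm y \<le> b \<and> h * norm y \<le> y \<bullet> u" using assms(5) by auto
    then have "y \<noteq> 0" using assms(3) by auto
    then show "y \<in> {y. a < norm y \<and> norm y \<le> b \<and> sgn y \<in> cap u h}" using * by (simp add: sgn_in_cap)
  qed
qed (use assms(1) in auto)

lemma cap_le_measure:
  assumes "A \<in> sets borel" "A \<subseteq> cball 0 r" "0 < d" "0 \<le> a" "a < b"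
    and "\<And>y. y \<in> euc d \<Longrightarrow> a < norm y \<Longrightarrow> norm y \<le> b \<Longrightarrow> h * norm y \<le> y \<bullet> u \<Longrightarrow> y \<in> A"
  shows "(b ^ d - a ^ d) * measure (uniform_sphere d) (cap u h) * ball_vol d \<le> measure (lebesgue_euc d) A"
  unfolding measure_cone_annulus[OF sets_borel_cap assms(3-5), symmetric]
proof (rule measure_lebesgue_euc_mono[OF _ assms(1,2)])
  show "{y. a < norm y \<and> norm y \<le> b \<and> sgn y \<in> cap u h} \<inter> euc d \<subseteq> A"
  proof
    fix y assume y: "y \<in> {y. a < norm y \<and> norm y \<le> b \<and> sgn y \<in> cap u h} \<inter> euc d"
    then have "y \<noteq> 0" using assms(4) by auto
    then show "y \<in> A" using y assms(6) by (simp add: sgn_in_cap)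
  qed
qed auto

lemma norm_diff_scaleR_unit:
  fixes y u :: "'a::real_inner"
  assumes "norm u = 1"
  shows "(norm (y - h *\<^sub>R u))\<^sup>2 = (norm y)\<^sup>2 - 2 * h * (y \<bullet> u) + h\<^sup>2"
proof -
  have "u \<bullet> u = 1" using assms by (simp add: norm_eq_1)
  then show ?thesis
    unfolding power2_norm_eq_inner
    by (simp add: inner_diff_left inner_diff_right inner_commute[of u y] power2_eq_square algebra_simps)
qed

text \<open>With \<open>s = sqrt (1 - h\<^sup>2)\<close>, the part of the cone over the cap with \<open>1 - \<eta> s < norm y \<le> 1\<close> lies in the
  ball of radius \<open>s * sqrt (1 + \<eta>\<^sup>2)\<close> around \<open>h *\<^sub>R u\<close>. Cutting off small radii gains the factor \<open>1 / s\<close>,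
  which matters when \<open>s\<close> tends to \<open>0\<close>.\<close>

lemma measure_cap_le:
  assumes u: "u \<in> unit_sphere d" and d: "0 < d" and h: "0 \<le> h" "h < 1" and \<eta>: "0 < \<eta>" "\<eta> \<le> 1"
  shows "measure (uniform_sphere d) (cap u h) \<le> sqrt (1 - h\<^sup>2) ^ (d - 1) * sqrt (1 + \<eta>\<^sup>2) ^ d / \<eta>"
proof -
  define s where "s = sqrt (1 - h\<^sup>2)"
  define a where "a = 1 - \<eta> * s"
  define p where "p = measure (uniform_sphere d) (cap u h)"
  have "h\<^sup>2 < 1" using h by (simp add: abs_square_less_1)
  then have s: "0 < s" "s\<^sup>2 = 1 - h\<^sup>2" "s \<le> 1" by (auto simp: s_def)
  have es: "0 < \<eta> * s" "\<eta> * s \<le> 1" using s \<eta> by (auto simp: mult_le_one)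
  have a: "0 \<le> a" "a < 1" using es by (auto simp: a_def)
  have R: "0 < s * sqrt (1 + \<eta>\<^sup>2)" using s by (simp add: add_pos_nonneg)
  have nu: "norm u = 1" "u \<in> euc d" using u by (auto simp: unit_sphereD)
  have "(1 ^ d - a ^ d) * p * ball_vol d \<le> measure (lebesgue_euc d) (cball (h *\<^sub>R u) (s * sqrt (1 + \<eta>\<^sup>2)))"
    unfolding p_def
  proof (rule cap_le_measure[where r = "h + s * sqrt (1 + \<eta>\<^sup>2)"])
    show "cball (h *\<^sub>R u) (s * sqrt (1 + \<eta>\<^sup>2)) \<subseteq> cball 0 (h + s * sqrt (1 + \<eta>\<^sup>2))"
    proof
      fix y assume "y \<in> cball (h *\<^sub>R u) (s * sqrt (1 + \<eta>\<^sup>2))"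
      then have "norm (y - h *\<^sub>R u) \<le> s * sqrt (1 + \<eta>\<^sup>2)" by (simp add: dist_norm norm_minus_commute)
      then show "y \<in> cball 0 (h + s * sqrt (1 + \<eta>\<^sup>2))"
        using norm_triangle_sub[of y "h *\<^sub>R u"] nu h by simp
    qed
  next
    fix y assume y: "a < norm y" "norm y \<le> 1" "h * norm y \<le> y \<bullet> u"
    define t where "t = 1 - norm y"
    have t: "0 \<le> t" "t \<le> \<eta> * s" using y by (auto simp: t_def a_def)
    have "2 * h * (h * norm y) \<le> 2 * h * (y \<bullet> u)" using y(3) h by (intro mult_left_mono) auto
    then have "(norm (y - h *\<^sub>R u))\<^sup>2 \<le> (norm y)\<^sup>2 - 2 * h * (h * norm y) + h\<^sup>2"
      unfolding norm_diff_scaleR_unit[OF nu(1)] by simp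
    also have "\<dots> = s\<^sup>2 - 2 * t * s\<^sup>2 + t\<^sup>2"
      unfolding s(2) by (simp add: t_def power2_eq_square algebra_simps)
    also have "\<dots> \<le> s\<^sup>2 + (\<eta> * s)\<^sup>2"
    proof -
      have "0 \<le> 2 * t * s\<^sup>2" using t by simp
      then show ?thesis using power_mono[OF t(2) t(1), of 2] by linarith
    qed
    also have "\<dots> = (s * sqrt (1 + \<eta>\<^sup>2))\<^sup>2" by (simp add: power_mult_distrib algebra_simps)
    finally have "norm (y - h *\<^sub>R u) \<le> s * sqrt (1 + \<eta>\<^sup>2)"
      by (rule power2_le_imp_le) (rule less_imp_le[OF R])
    then show "y \<in> cball (h *\<^sub>R u) (s * sqrt (1 + \<eta>\<^sup>2))" by (simp add: dist_norm norm_minus_commute)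
  qed (use d a in auto)
  also have "\<dots> = (s * sqrt (1 + \<eta>\<^sup>2)) ^ d * ball_vol d"
    using nu R by (intro measure_cball_euc) auto
  finally have "(1 - a ^ d) * p \<le> (s * sqrt (1 + \<eta>\<^sup>2)) ^ d"
    using ball_vol_pos[of d] by simp
  \<comment> \<open>From \<open>a ^ d \<le> a\<close> the annulus factor is at least
    \<open>\<eta> * s\<close>. Dividing by it turns \<open>s ^ d\<close> into
    \<open>s ^ (d - 1)\<close>, the right power for surface measure.\<close>
  moreover have "\<eta> * s * p \<le> (1 - a ^ d) * p"
  proof (rule mult_right_mono)
    have "a ^ d \<le> a" using d a by (metis less_imp_le power_decreasing power_one_right Suc_leI One_nat_def)
    then show "\<eta> * s \<le> 1 - a ^ d" by (simp add: a_def)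
  qed (simp add: p_def)
  ultimately have "\<eta> * s * p \<le> s ^ d * sqrt (1 + \<eta>\<^sup>2) ^ d" by (simp add: power_mult_distrib)
  also have "s ^ d = s * s ^ (d - 1)" using d by (metis power_Suc Suc_diff_1)
  finally have "\<eta> * p \<le> s ^ (d - 1) * sqrt (1 + \<eta>\<^sup>2) ^ d" using s(1) by (simp add: mult.assoc mult.left_commute[of _ s])
  then show ?thesis using \<eta> by (simp add: p_def s_def field_simps)
qed

lemma power_diff_le:
  fixes a b :: real
  assumes "0 \<le> a" "a \<le> b"
  shows "b ^ d - a ^ d \<le> real d * (b - a) * b ^ (d - 1)"
proof -
  have "b ^ d - a ^ d = (b - a) * (\<Sum>i<d. b ^ i * a ^ (d - 1 - i))"
    using power_diff_sumr2[of b d a] by (simp add: mult.commute)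
  also have "\<dots> \<le> (b - a) * (\<Sum>i<d. b ^ (d - 1))"
  proof (intro mult_left_mono sum_mono)
    fix i assume i: "i \<in> {..<d}"
    have "b ^ i * a ^ (d - 1 - i) \<le> b ^ i * b ^ (d - 1 - i)"
      using assms by (intro mult_left_mono power_mono) auto
    also have "\<dots> = b ^ (d - 1)" using i by (simp flip: power_add)
    finally show "b ^ i * a ^ (d - 1 - i) \<le> b ^ (d - 1)" .
  qed (use assms in auto)
  finally show ?thesis by (simp add: algebra_simps)
qed

text \<open>Here the cone contains the ball of radius \<open>s\<close> around \<open>u\<close>, whose points have norm between \<open>1 - s\<close>
  and \<open>1 + s\<close>.\<close>

lemma measure_cap_ge_small:
  assumes u: "u \<in> unit_sphere d" and d: "0 < d" and s: "0 < s" "s \<le> 1 / 2"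
  shows "s ^ (d - 1) / (3 * real d * (1 + s) ^ (d - 1)) \<le> measure (uniform_sphere d) (cap u (sqrt (1 - s\<^sup>2)))"
proof -
  define h where "h = sqrt (1 - s\<^sup>2)"
  define p where "p = measure (uniform_sphere d) (cap u h)"
  have "s\<^sup>2 < 1" using s by (simp add: abs_square_less_1)
  then have h: "0 < h" "h\<^sup>2 = 1 - s\<^sup>2" by (auto simp: h_def)
  have nu: "norm u = 1" "u \<in> euc d" using u by (auto simp: unit_sphereD)
  \<comment> \<open>The inner radius must be strict, so \<open>1 - 2 * s\<close> replaces
    \<open>1 - s\<close>. The assumption \<open>s \<le> 1 / 2\<close> keeps it nonnegative, and the
    width \<open>3 * s\<close> of the annulus is the source of the factor \<open>3\<close>.\<close>
  have "measure (lebesgue_euc d) (cball u s) \<le> ((1 + s) ^ d - (1 - 2 * s) ^ d) * p * ball_vol d"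
    unfolding p_def
  proof (rule measure_le_cap)
    fix y assume "y \<in> cball u s"
    then have y: "norm (y - u) \<le> s" by (simp add: dist_norm norm_minus_commute)
    have 1: "norm y \<le> norm (y - u) + 1" "1 \<le> norm (y - u) + norm y"
      using norm_triangle_sub[of y u] norm_triangle_sub[of u y] nu by (auto simp: norm_minus_commute)
    have "(norm (y - u))\<^sup>2 \<le> s\<^sup>2" using y by (intro power_mono) auto
    then have "(norm y)\<^sup>2 + h\<^sup>2 \<le> 2 * (y \<bullet> u)"
      using norm_diff_scaleR_unit[OF nu(1), of y 1] h by simp
    \<comment> \<open>The arithmetic-geometric mean inequality; the previous bound says that
      \<open>y\<close> is close to \<open>u\<close>.\<close>
    moreover have "2 * (h * norm y) \<le> (norm y)\<^sup>2 + h\<^sup>2"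
      using sum_squares_bound[of "norm y" h] by (simp add: algebra_simps)
    ultimately have "h * norm y \<le> y \<bullet> u" by simp
    then show "1 - 2 * s < norm y \<and> norm y \<le> 1 + s \<and> h * norm y \<le> y \<bullet> u" using 1 y s by auto
  qed (use d s in auto)
  moreover have "measure (lebesgue_euc d) (cball u s) = s ^ d * ball_vol d"
    using nu s by (intro measure_cball_euc) auto
  ultimately have "s ^ d \<le> ((1 + s) ^ d - (1 - 2 * s) ^ d) * p" using ball_vol_pos[of d] by simp
  also have "\<dots> \<le> (real d * (1 + s - (1 - 2 * s)) * (1 + s) ^ (d - 1)) * p"
    by (intro mult_right_mono power_diff_le) (use s in \<open>auto simp: p_def\<close>)
  finally have "s ^ d \<le> s * (3 * real d * (1 + s) ^ (d - 1) * p)" by (simp add: algebra_simps)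
  moreover have "s ^ d = s * s ^ (d - 1)" using d by (metis power_Suc Suc_diff_1)
  ultimately have "s ^ (d - 1) \<le> 3 * real d * (1 + s) ^ (d - 1) * p" using s by simp
  then show ?thesis using s d by (simp add: p_def h_def field_simps)
qed

text \<open>The cone contains the part of the ball of radius \<open>s = sqrt (1 - h\<^sup>2)\<close> around \<open>h *\<^sub>R u\<close> that is close to
  the hyperplane at height \<open>h\<close>. The rest of that ball is covered by two cones, which are small by
  the upper bound for caps.\<close>

lemma measure_cap_ge_slab:
  assumes u: "u \<in> unit_sphere d" and d: "0 < d" and h: "0 < h" "h < 1" and \<eta>: "0 < \<eta>" "\<eta> < h"
  shows "(sqrt (1 - h\<^sup>2) / sqrt (1 + 2 * h * \<eta>)) ^ d
      * (1 - measure (uniform_sphere d) (cap u \<eta>) - measure (uniform_sphere d) (cap (- u) \<eta>))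
    \<le> measure (uniform_sphere d) (cap u ((h - \<eta>) / sqrt (1 + 2 * h * \<eta>)))"
proof -
  define s where "s = sqrt (1 - h\<^sup>2)"
  \<comment> \<open>The largest possible norm of \<open>h *\<^sub>R u + s *\<^sub>R z\<close> with
    \<open>norm z \<le> 1\<close> and \<open>z \<bullet> u \<le> \<eta>\<close>: its square is at
    most \<open>s\<^sup>2 + 2 * h * \<eta> + h\<^sup>2\<close>.\<close>
  define b where "b = sqrt (1 + 2 * h * \<eta>)"
  define p where "p = measure (uniform_sphere d) (cap u ((h - \<eta>) / b))"
  let ?L = "lebesgue_euc d"
  have "h\<^sup>2 < 1" using h by (simp add: abs_square_less_1)
  then have s: "0 < s" "s\<^sup>2 = 1 - h\<^sup>2" "s \<le> 1" by (auto simp: s_def)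
  have b: "1 < b" "b\<^sup>2 = 1 + 2 * h * \<eta>" using h \<eta> by (auto simp: b_def)
  have nu: "norm u = 1" "u \<in> euc d" using u by (auto simp: unit_sphereD)
  have uu: "u \<bullet> u = 1" using nu by (simp add: norm_eq_1)
  define S where "S = {z \<in> cball 0 1. \<bar>z \<bullet> u\<bar> \<le> \<eta>}"
  define A where "A = (\<lambda>z. h *\<^sub>R u + s *\<^sub>R z) ` S"
  have A_eq: "A = {y. (1 / s) *\<^sub>R (y - h *\<^sub>R u) \<in> S}"
  proof (intro set_eqI iffI)
    fix y assume "y \<in> {y. (1 / s) *\<^sub>R (y - h *\<^sub>R u) \<in> S}"
    moreover have "y = h *\<^sub>R u + s *\<^sub>R ((1 / s) *\<^sub>R (y - h *\<^sub>R u))" using s by simp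
    ultimately show "y \<in> A" unfolding A_def by blast
  qed (use s in \<open>auto simp: A_def\<close>)
  have S [measurable]: "S \<in> sets borel" unfolding S_def by measurable
  have A [measurable]: "A \<in> sets borel" unfolding A_eq by measurable
  have "measure ?L A = s ^ d * measure ?L {z. h *\<^sub>R u + s *\<^sub>R z \<in> A}"
    using s nu by (intro measure_lebesgue_euc_affine A) auto
  also have "{z. h *\<^sub>R u + s *\<^sub>R z \<in> A} = S" using s by (auto simp: A_eq)
  finally have mA: "measure ?L A = s ^ d * measure ?L S" .
  have "measure ?L A \<le> (b ^ d - 0 ^ d) * p * ball_vol d"
    unfolding p_def
  proof (rule measure_le_cap)
    fix y assume "y \<in> A"
    then obtain z where z: "norm z \<le> 1" "\<bar>z \<bullet> u\<bar> \<le> \<eta>" "y = h *\<^sub>R u + s *\<^sub>R z"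
      by (auto simp: A_def S_def)
    have szu: "\<bar>s * (z \<bullet> u)\<bar> \<le> \<eta>"
    proof -
      have "s * \<bar>z \<bullet> u\<bar> \<le> 1 * \<eta>" using s z by (intro mult_mono) auto
      then show ?thesis using s by (simp add: abs_mult)
    qed
    have yu: "y \<bullet> u = h + s * (z \<bullet> u)" by (simp add: z(3) inner_add_left uu)
    then have lo: "h - \<eta> \<le> y \<bullet> u" using szu by simp
    have "(norm y)\<^sup>2 = s\<^sup>2 * (norm z)\<^sup>2 + 2 * h * (s * (z \<bullet> u)) + h\<^sup>2"
      unfolding z(3) power2_norm_eq_inner
      by (simp add: inner_add_left inner_add_right uu inner_commute[of u z] power2_eq_square algebra_simps)
    also have "\<dots> \<le> s\<^sup>2 * 1 + 2 * h * \<eta> + h\<^sup>2"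
      using szu z(1) h by (intro add_mono mult_left_mono) (auto simp: power_le_one)
    also have "\<dots> = b\<^sup>2" using s b by simp
    finally have nb: "norm y \<le> b" by (rule power2_le_imp_le) (use b in simp)
    have "y \<noteq> 0" using lo \<eta> by auto
    moreover have "(h - \<eta>) * (norm y / b) \<le> (h - \<eta>) * 1"
      using nb b \<eta> by (intro mult_left_mono) auto
    then have "(h - \<eta>) / b * norm y \<le> h - \<eta>" by simp
    ultimately show "0 < norm y \<and> norm y \<le> b \<and> (h - \<eta>) / b * norm y \<le> y \<bullet> u"
      using lo nb by auto
  qed (use d b in auto)
  then have up: "s ^ d * measure ?L S \<le> b ^ d * p * ball_vol d" using d mA by (simp add: power_0_left)
  have capn: "measure ?L {z \<in> cball 0 1. \<eta> < z \<bullet> v} \<le> measure (uniform_sphere d) (cap v \<eta>) * ball_vol d" if "norm v = 1" for v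
  proof -
    have "measure ?L {z \<in> cball 0 1. \<eta> < z \<bullet> v} \<le> (1 ^ d - 0 ^ d) * measure (uniform_sphere d) (cap v \<eta>) * ball_vol d"
    proof (rule measure_le_cap)
      fix z assume z: "z \<in> {z \<in> cball 0 1. \<eta> < z \<bullet> v}"
      then have "z \<noteq> 0" using \<eta> by auto
      moreover have "\<eta> * norm z \<le> \<eta>" using z \<eta> by (simp add: mult_left_le)
      ultimately show "0 < norm z \<and> norm z \<le> 1 \<and> \<eta> * norm z \<le> z \<bullet> v" using z by auto
    qed (use d in auto)
    then show ?thesis using d by (simp add: power_0_left)
  qed
  \<comment> \<open>The unit ball is covered by the slab \<open>S\<close> and the two parts beyond
    height \<open>\<eta>\<close> on either side, which lie in cones over caps since
    \<open>norm z \<le> 1\<close>.\<close>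
  have "ball_vol d = measure ?L (cball 0 1)" using measure_cball_euc[of 0 d 1] by simp
  also have "\<dots> \<le> measure ?L (S \<union> ({z \<in> cball 0 1. \<eta> < z \<bullet> u} \<union> {z \<in> cball 0 1. \<eta> < z \<bullet> - u}))"
    by (rule measure_lebesgue_euc_mono[where r = 1]) (auto simp: S_def)
  also have "\<dots> \<le> measure ?L S + measure ?L ({z \<in> cball 0 1. \<eta> < z \<bullet> u} \<union> {z \<in> cball 0 1. \<eta> < z \<bullet> - u})"
    by (rule measure_Un_le) auto
  also have "measure ?L ({z \<in> cball 0 1. \<eta> < z \<bullet> u} \<union> {z \<in> cball 0 1. \<eta> < z \<bullet> - u})
      \<le> measure ?L {z \<in> cball 0 1. \<eta> < z \<bullet> u} + measure ?L {z \<in> cball 0 1. \<eta> < z \<bullet> - u}"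
    by (rule measure_Un_le) auto
  also have "\<dots> \<le> measure (uniform_sphere d) (cap u \<eta>) * ball_vol d + measure (uniform_sphere d) (cap (-u) \<eta>) * ball_vol d"
    using capn[of u] capn[of "- u"] nu by simp
  finally have lo: "(1 - measure (uniform_sphere d) (cap u \<eta>) - measure (uniform_sphere d) (cap (- u) \<eta>)) * ball_vol d \<le> measure ?L S"
    by (simp add: algebra_simps)
  have "s ^ d * ((1 - measure (uniform_sphere d) (cap u \<eta>) - measure (uniform_sphere d) (cap (- u) \<eta>)) * ball_vol d) \<le> s ^ d * measure ?L S"
    using s by (intro mult_left_mono lo) auto
  also note up
  finally have "s ^ d * (1 - measure (uniform_sphere d) (cap u \<eta>) - measure (uniform_sphere d) (cap (- u) \<eta>)) \<le> b ^ d * p"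
    using ball_vol_pos[of d] by (simp flip: mult.assoc)
  then have "s ^ d * (1 - measure (uniform_sphere d) (cap u \<eta>) - measure (uniform_sphere d) (cap (- u) \<eta>)) / b ^ d \<le> p"
    using b(1) by (simp add: divide_le_eq mult.commute)
  then show ?thesis unfolding p_def s_def[symmetric] b_def[symmetric] by (simp add: power_divide)
qed

section \<open>Null sets of the uniform measure on the sphere\<close>

text \<open>The translates of \<open>A\<close> by \<open>v / (k + 1)\<close> are disjoint, have the
  same measure and all fit into a ball of radius \<open>2\<close>, whose volume is finite.\<close>

lemma measure_zero_disjoint_translates:
  assumes A [measurable]: "A \<in> sets borel" and bdd: "A \<subseteq> cball 0 1" and v: "v \<in> euc d" "norm v \<le> 1"
    and dis: "\<And>y c. y \<in> A \<Longrightarrow> y + c *\<^sub>R v \<in> A \<Longrightarrow> c = 0"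
  shows "measure (lebesgue_euc d) A = 0"
proof (rule ccontr)
  assume "measure (lebesgue_euc d) A \<noteq> 0"
  then have pos: "measure (lebesgue_euc d) A > 0" by (simp add: zero_less_measure_iff)
  define T where "T k = {y. y - (1 / real (Suc k)) *\<^sub>R v \<in> A}" for k :: nat
  have T [measurable]: "T k \<in> sets borel" for k unfolding T_def by measurable
  have mT: "measure (lebesgue_euc d) (T k) = measure (lebesgue_euc d) A" for k
    using measure_lebesgue_euc_affine[of "(1 / real (Suc k)) *\<^sub>R v" d 1 "T k"] v by (simp add: T_def)
  have Tsub: "T k \<subseteq> cball 0 2" for k
  proof
    fix y assume "y \<in> T k"
    then have "norm (y - (1 / real (Suc k)) *\<^sub>R v) \<le> 1" using bdd by (auto simp: T_def)
    moreover have "norm ((1 / real (Suc k)) *\<^sub>R v) \<le> 1" using v by (simp add: divide_le_eq)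
    ultimately have "norm y \<le> 2"
      using norm_triangle_sub[of y "(1 / real (Suc k)) *\<^sub>R v"] by linarith
    then show "y \<in> cball 0 2" by simp
  qed
  have disT: "T j \<inter> T k = {}" if "j \<noteq> k" for j k
  proof (rule ccontr)
    assume "T j \<inter> T k \<noteq> {}"
    then obtain y where y: "y - (1 / real (Suc j)) *\<^sub>R v \<in> A" "y - (1 / real (Suc k)) *\<^sub>R v \<in> A" by (auto simp: T_def)
    have "(y - (1 / real (Suc j)) *\<^sub>R v) + (1 / real (Suc j) - 1 / real (Suc k)) *\<^sub>R v = y - (1 / real (Suc k)) *\<^sub>R v"
      by (simp add: algebra_simps)
    then have "1 / real (Suc j) - 1 / real (Suc k) = 0" using dis[OF y(1)] y(2) by metis
    then show False using that by simp
  qed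
  obtain K :: nat where K: "2 ^ d * ball_vol d < real K * measure (lebesgue_euc d) A"
    using pos reals_Archimedean3 by blast
  have "real K * measure (lebesgue_euc d) A = (\<Sum>k<K. measure (lebesgue_euc d) (T k))" by (simp add: mT)
  also have "\<dots> = measure (lebesgue_euc d) (\<Union>k<K. T k)"
  proof (rule measure_UNION'[symmetric])
    show "T k \<in> fmeasurable (lebesgue_euc d)" for k by (rule fmeasurable_bounded[OF T Tsub])
    show "pairwise (\<lambda>i j. disjnt (T i) (T j)) {..<K}" using disT by (auto simp: pairwise_def disjnt_def)
  qed auto
  also have "\<dots> \<le> measure (lebesgue_euc d) (cball 0 2)"
    by (rule measure_lebesgue_euc_mono[where r = 2]) (use Tsub in auto)
  also have "\<dots> = 2 ^ d * ball_vol d" by (rule measure_cball_euc) auto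
  finally show False using K by simp
qed

text \<open>The null set is the cone of directions \<open>x\<close> with \<open>x \<bullet> w = t\<close>. Its translates along \<open>w\<close>
  are disjoint if \<open>\<bar>t\<bar> < 1\<close>; otherwise it is part of the line spanned by \<open>w\<close>, whose translates in any
  orthogonal direction are disjoint.\<close>

lemma measure_uniform_sphere_hyperplane:
  assumes w: "w \<in> unit_sphere d" and d: "2 \<le> d"
  shows "measure (uniform_sphere d) {x. x \<bullet> w = t} = 0"
proof -
  define A where "A = {y \<in> cball 0 1. y \<bullet> w = t * norm y}"
  have A [measurable]: "A \<in> sets borel" unfolding A_def by measurable
  have nw: "norm w = 1" "w \<in> euc d" using w by (auto simp: unit_sphereD)
  then have ww: "w \<bullet> w = 1" by (simp only: norm_eq_1)
  have "\<exists>v\<in>unit_sphere d. \<forall>y c. y \<in> A \<longrightarrow> y + c *\<^sub>R v \<in> A \<longrightarrow> c = 0"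
  proof (cases "\<bar>t\<bar> < 1")
    case True
    have "c = 0" if y: "y \<in> A" "y + c *\<^sub>R w \<in> A" for y c
    proof -
      \<comment> \<open>Subtracting the equations of \<open>y\<close> and of its translate and using
        the triangle inequality leaves
        \<open>\<bar>c\<bar> \<le> \<bar>t\<bar> * \<bar>c\<bar>\<close>.\<close>
      have "c = t * (norm (y + c *\<^sub>R w) - norm y)"
        using y ww by (simp add: A_def inner_add_left algebra_simps)
      then have "\<bar>c\<bar> = \<bar>t\<bar> * \<bar>norm (y + c *\<^sub>R w) - norm y\<bar>" by (simp add: abs_mult[symmetric])
      also have "\<dots> \<le> \<bar>t\<bar> * \<bar>c\<bar>"
        using norm_triangle_ineq3[of "y + c *\<^sub>R w" y] nw by (intro mult_left_mono) auto
      finally have le: "\<bar>c\<bar> \<le> \<bar>t\<bar> * \<bar>c\<bar>" .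
      show "c = 0"
      proof (rule ccontr)
        assume "c \<noteq> 0"
        then have "\<bar>t\<bar> * \<bar>c\<bar> < 1 * \<bar>c\<bar>" using True by (intro mult_strict_right_mono) auto
        then show False using le by simp
      qed
    qed
    then show ?thesis using w by blast
  next
    case False
    obtain v where v: "v \<in> unit_sphere d" "v \<bullet> w = 0"
      using unit_orthogonal_to_few[of "{w}" d] nw d by auto
    \<comment> \<open>For \<open>\<bar>t\<bar> \<ge> 1\<close> the defining equation forces equality
      in the Cauchy-Schwarz inequality, so \<open>y\<close> is a multiple of
      \<open>w\<close>.\<close>
    have line: "y \<bullet> v = 0" if "y \<in> A" for y
    proof -
      have "1 \<le> t\<^sup>2" using False abs_square_less_1[of t] by auto
      then have "(norm y)\<^sup>2 \<le> t\<^sup>2 * (norm y)\<^sup>2" by (simp add: mult_le_cancel_right1)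
      then have "(norm y)\<^sup>2 \<le> (y \<bullet> w)\<^sup>2" using that by (simp add: A_def power_mult_distrib)
      then have "(norm (y - (y \<bullet> w) *\<^sub>R w))\<^sup>2 \<le> 0"
        unfolding norm_diff_scaleR_unit[OF nw(1)] by (simp add: power2_eq_square)
      then have "y = (y \<bullet> w) *\<^sub>R w" by simp
      then have "y \<bullet> v = (y \<bullet> w) * (w \<bullet> v)" by (metis inner_scaleR_left)
      then show ?thesis using v by (simp add: inner_commute[of w])
    qed
    have "c = 0" if "y \<in> A" "y + c *\<^sub>R v \<in> A" for y c
      using line[OF that(1)] line[OF that(2)] unit_sphereD(1)[OF v(1)] by (auto simp: inner_add_left)
    then show ?thesis using v by blast
  qed
  then obtain v where v: "v \<in> unit_sphere d" "\<And>y c. y \<in> A \<Longrightarrow> y + c *\<^sub>R v \<in> A \<Longrightarrow> c = 0" by blast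
  have A0: "measure (lebesgue_euc d) A = 0"
    by (rule measure_zero_disjoint_translates[OF A _ _ _ v(2)]) (use v(1) in \<open>auto simp: A_def unit_sphereD\<close>)
  have "measure (lebesgue_euc d) {y \<in> cball 0 1. sgn y \<in> {x. x \<bullet> w = t}} \<le> measure (lebesgue_euc d) A"
  proof (rule measure_lebesgue_euc_mono[where r = 1])
    show "{y \<in> cball 0 1. sgn y \<in> {x. x \<bullet> w = t}} \<inter> euc d \<subseteq> A"
    proof
      fix y assume y: "y \<in> {y \<in> cball 0 1. sgn y \<in> {x. x \<bullet> w = t}} \<inter> euc d"
      then show "y \<in> A" by (cases "y = 0") (auto simp: A_def sgn_div_norm)
    qed
  qed (auto simp: A_def)
  then have "measure (uniform_sphere d) {x. x \<bullet> w = t} * ball_vol d \<le> 0"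
    unfolding A0 by (subst measure_uniform_sphere[symmetric]) auto
  then have "measure (uniform_sphere d) {x. x \<bullet> w = t} \<le> 0"
    using ball_vol_pos[of d] by (simp add: mult_le_0_iff)
  then show ?thesis by (simp add: measure_le_0_iff)
qed

lemma measure_uniform_sphere_unit_sphere:
  assumes "0 < d"
  shows "measure (uniform_sphere d) (- unit_sphere d) = 0"
proof -
  have "measure (lebesgue_euc d) {y \<in> cball 0 1. sgn y \<in> - unit_sphere d} \<le> measure (lebesgue_euc d) {0}"
  proof (rule measure_lebesgue_euc_mono[where r = 1])
    show "{y \<in> cball 0 1. sgn y \<in> - unit_sphere d} \<inter> euc d \<subseteq> {0}"
      using normalize_in_unit_sphere by (auto simp: sgn_div_norm)
  qed auto
  then have "measure (uniform_sphere d) (- unit_sphere d) * ball_vol d \<le> 0"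
    unfolding measure_singleton_zero[OF assms] by (subst measure_uniform_sphere[symmetric]) auto
  then have "measure (uniform_sphere d) (- unit_sphere d) \<le> 0"
    using ball_vol_pos[of d] by (simp add: mult_le_0_iff)
  then show ?thesis by (simp add: measure_le_0_iff)
qed

subsection \<open>Measurability of the Hausdorff distance and of the facet heights\<close>

text \<open>The weights are indexed by \<open>J\<close>, not by points: repeated points do no harm,
  and the weights range over a simplex that does not depend on \<open>x\<close>, as the
  measurability proof requires.\<close>

lemma convex_hull_image_eq:
  assumes "finite J"
  shows "convex hull (x ` J) = {\<Sum>i\<in>J. l i *\<^sub>R x i |l. (\<forall>i\<in>J. 0 \<le> l i) \<and> sum l J = (1::real)}" (is "_ = ?R")
proof
  show "?R \<subseteq> convex hull (x ` J)"
  proof clarify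
    fix l assume "\<forall>i\<in>J. 0 \<le> l i" "sum l J = (1::real)"
    then show "(\<Sum>i\<in>J. l i *\<^sub>R x i) \<in> convex hull (x ` J)"
      by (intro convex_sum assms convex_convex_hull) (auto intro: hull_inc)
  qed
  show "convex hull (x ` J) \<subseteq> ?R"
  proof (rule hull_minimal)
    show "x ` J \<subseteq> ?R"
    proof
      fix y assume "y \<in> x ` J"
      then obtain j where j: "j \<in> J" "y = x j" by auto
      have "(\<Sum>i\<in>J. (if i = j then 1 else 0) *\<^sub>R x i) = (\<Sum>i\<in>J. if i = j then x i else 0)"
        by (intro sum.cong) auto
      then have "y = (\<Sum>i\<in>J. (if i = j then 1 else 0) *\<^sub>R x i)" using assms j by (simp add: sum.delta')
      then show "y \<in> ?R" using assms j by (intro CollectI exI[of _ "\<lambda>i. if i = j then 1 else 0"]) auto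
    qed
    show "convex ?R"
    proof (rule convexI)
      fix y z u v assume "y \<in> ?R" "z \<in> ?R" and uv: "0 \<le> u" "0 \<le> v" "u + v = (1::real)"
      then obtain l m where l: "y = (\<Sum>i\<in>J. l i *\<^sub>R x i)" "\<forall>i\<in>J. 0 \<le> l i" "sum l J = 1"
        and m: "z = (\<Sum>i\<in>J. m i *\<^sub>R x i)" "\<forall>i\<in>J. 0 \<le> m i" "sum m J = 1" by blast
      have "u *\<^sub>R y + v *\<^sub>R z = (\<Sum>i\<in>J. (u * l i + v * m i) *\<^sub>R x i)"
        by (simp add: l m scaleR_sum_right sum.distrib scaleR_add_left)
      moreover have "(\<Sum>i\<in>J. u * l i + v * m i) = 1"
        using l m uv by (simp add: sum.distrib flip: sum_distrib_left)
      ultimately show "u *\<^sub>R y + v *\<^sub>R z \<in> ?R"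
        using l m uv by (intro CollectI exI[of _ "\<lambda>i. u * l i + v * m i"]) auto
    qed
  qed
qed

text \<open>Collect all other terms in a point \<open>z\<close> of the hull. The given point of
  \<open>F\<close> lies in the open segment between \<open>z\<close> and \<open>x k\<close> unless
  it equals \<open>x k\<close>, so the face contains \<open>x k\<close>.\<close>

lemma face_of_positive_weight:
  fixes x :: "'b \<Rightarrow> 'a::real_vector"
  assumes F: "F face_of convex hull (x ` J)" and J: "finite J" and l: "\<forall>i\<in>J. 0 \<le> l i" "sum l J = (1::real)"
    and y: "(\<Sum>i\<in>J. l i *\<^sub>R x i) \<in> F" and k: "k \<in> J" "0 < l k"
  shows "x k \<in> F"
proof -
  have split: "(\<Sum>i\<in>J. l i *\<^sub>R x i) = l k *\<^sub>R x k + (\<Sum>i\<in>J - {k}. l i *\<^sub>R x i)"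
    using J k by (simp add: sum.remove)
  have lk: "sum l (J - {k}) = 1 - l k" using J k l by (simp add: sum.remove)
  show ?thesis
  proof (cases "l k = 1")
    case True
    then have "\<forall>i\<in>J - {k}. l i = 0"
      using lk l J sum_nonneg_eq_0_iff[of "J - {k}" l] by auto
    then show ?thesis using y True split by simp
  next
    case False
    have lk1: "l k < 1" using False lk sum_nonneg[of "J - {k}" l] l by fastforce
    define z where "z = (\<Sum>i\<in>J - {k}. (l i / (1 - l k)) *\<^sub>R x i)"
    have "z \<in> convex hull (x ` J)"
      unfolding z_def
      by (rule convex_sum) (use J l lk lk1 in \<open>auto simp: sum_divide_distrib[symmetric] intro: hull_inc\<close>)
    moreover have eq: "(\<Sum>i\<in>J. l i *\<^sub>R x i) = l k *\<^sub>R x k + (1 - l k) *\<^sub>R z"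
      using lk1 by (simp add: split z_def scaleR_sum_right)
    moreover have "x k \<in> convex hull (x ` J)" using k by (auto intro: hull_inc)
    ultimately show ?thesis
    proof (cases "z = x k")
      case True
      then have "(\<Sum>i\<in>J. l i *\<^sub>R x i) = x k" using eq by (simp flip: scaleR_add_left)
      then show ?thesis using y by simp
    next
      case False
      have "(\<Sum>i\<in>J. l i *\<^sub>R x i) \<in> open_segment z (x k)"
        using False eq lk1 k by (auto simp: in_segment intro!: exI[of _ "l k"])
      then show ?thesis using face_ofD[OF F, of _ z "x k"] y \<open>z \<in> _\<close> \<open>x k \<in> _\<close> by blast
    qed
  qed
qed

text \<open>The barycentre \<open>c\<close> of \<open>A\<close> is relatively interior to
  \<open>convex hull A\<close>, so moving slightly past \<open>c\<close>, away from
  \<open>z\<close>, stays inside it. Thus \<open>c\<close>, a point of the face, lies between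
  \<open>z\<close> and the new point \<open>c'\<close>.\<close>

lemma face_of_affine_hull_finite:
  fixes A :: "'a::real_vector set"
  assumes F: "F face_of S" and A: "finite A" "A \<noteq> {}" "A \<subseteq> F" and z: "z \<in> S" "z \<in> affine hull A"
  shows "z \<in> F"
proof -
  have conv: "convex hull A \<subseteq> F" by (intro hull_minimal A face_of_imp_convex[OF F])
  obtain \<mu> where \<mu>: "sum \<mu> A = 1" "z = (\<Sum>v\<in>A. \<mu> v *\<^sub>R v)"
    using z(2) unfolding affine_hull_finite[OF A(1)] by auto
  define N where "N = real (card A)"
  have N: "0 < N" using A by (simp add: N_def card_gt_0_iff)
  define c where "c = (\<Sum>v\<in>A. (1 / N) *\<^sub>R v)"
  have "c \<in> convex hull A" unfolding c_def
    by (intro convex_sum A convex_convex_hull) (use N in \<open>auto intro: hull_inc simp: N_def\<close>)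
  then have cF: "c \<in> F" using conv by blast
  define M where "M = (\<Sum>v\<in>A. \<bar>\<mu> v\<bar>)"
  \<comment> \<open>Small enough that \<open>e * \<mu> v \<le> 1 / N\<close>, so that the weights of
    \<open>c'\<close> remain nonnegative.\<close>
  define e where "e = 1 / (N * (M + 1))"
  have M: "0 \<le> M" by (simp add: M_def sum_nonneg)
  have e: "0 < e" using N M by (auto simp: e_def)
  have nonneg: "0 \<le> (1 + e) / N - e * \<mu> v" if "v \<in> A" for v
  proof -
    have "\<mu> v \<le> \<bar>\<mu> v\<bar>" by simp
    also have "\<dots> \<le> M" unfolding M_def by (rule member_le_sum) (use that A in auto)
    finally have "e * \<mu> v \<le> e * (M + 1)" using e by (intro mult_left_mono) auto
    also have "\<dots> = 1 / N"
    proof -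
      have "M + 1 \<noteq> 0" using M by simp
      then show ?thesis by (simp add: e_def)
    qed
    also have "\<dots> \<le> (1 + e) / N" using N e by (simp add: divide_right_mono)
    finally show ?thesis by simp
  qed
  define c' where "c' = c + e *\<^sub>R (c - z)"
  have c'_eq: "c' = (\<Sum>v\<in>A. ((1 + e) / N - e * \<mu> v) *\<^sub>R v)"
    unfolding c'_def c_def \<mu>(2)
    by (simp add: scaleR_diff_left sum_subtractf scaleR_sum_right scaleR_diff_right add_divide_distrib
        scaleR_add_left sum.distrib algebra_simps)
  have "c' \<in> convex hull A"
    unfolding c'_eq
    by (intro convex_sum A convex_convex_hull nonneg hull_inc)
       (use \<mu>(1) N in \<open>simp_all add: sum_subtractf N_def flip: sum_distrib_left\<close>)
  then have c'F: "c' \<in> F" using conv by blast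
  show ?thesis
  proof (cases "z = c'")
    case False
    have "c = (1 - 1 / (1 + e)) *\<^sub>R z + (1 / (1 + e)) *\<^sub>R c'"
    proof -
      define k where "k = 1 / (1 + e)"
      have "1 + e \<noteq> 0" using e by simp
      then have ke: "k * (1 + e) = 1" by (simp add: k_def)
      have "(1 - k) *\<^sub>R z + k *\<^sub>R c' = (1 - k * (1 + e)) *\<^sub>R z + (k * (1 + e)) *\<^sub>R c"
        by (simp add: c'_def algebra_simps)
      also have "\<dots> = c" unfolding ke by simp
      finally show ?thesis by (simp add: k_def)
    qed
    then have "c \<in> open_segment z c'"
      using False e by (auto simp: in_segment intro!: exI[of _ "1 / (1 + e)"])
    then show ?thesis using face_ofD[OF F] z(1) c'F cF face_of_imp_subset[OF F] by blast
  qed (use c'F in simp)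
qed

text \<open>Each conjunct on the right is a closed or an open condition on \<open>(x, u, h)\<close>. No general position is
  assumed, since measurability has to hold on the null set of degenerate samples as well.\<close>

lemma exists_facet_height_iff:
  fixes x :: "nat \<Rightarrow> fseq"
  shows "(\<exists>F. facet_in d F (convex hull (x ` {..<n})) \<and> has_height d (convex hull (x ` {..<n})) F h) \<longleftrightarrow>
    (\<exists>I u. I \<subseteq> {..<n} \<and> I \<noteq> {} \<and> u \<in> unit_sphere d \<and> (\<forall>i\<in>I. x i \<in> hyperplane_euc d u h) \<and>
      (\<forall>i<n. x i \<bullet> u \<le> h) \<and>
      (\<forall>w\<in>unit_sphere d. w \<bullet> u = 0 \<longrightarrow> (\<exists>i\<in>I. \<exists>j\<in>I. x i \<bullet> w \<noteq> x j \<bullet> w)) \<and>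
      convex hull (x ` ({..<n} - I)) \<inter> hyperplane_euc d u h = {})"
    (is "?l \<longleftrightarrow> (\<exists>I u. ?r I u)")
proof
  let ?P = "convex hull (x ` {..<n})"
  assume ?l
  then obtain F u where F: "F face_of ?P" and u: "u \<in> unit_sphere d"
    and hF: "affine hull F = hyperplane_euc d u h" and le: "?P \<subseteq> {z. z \<bullet> u \<le> h}"
    by (auto simp: facet_in_def has_height_def hyperplane_euc_def)
  define I where "I = {i. i < n \<and> x i \<in> F}"
  have fin: "finite I" by (auto simp: I_def)
  have Fsub: "F \<subseteq> ?P" using F by (rule face_of_imp_subset)
  \<comment> \<open>Every point of \<open>F\<close> is a convex combination of the given points, and
    those with positive weight lie in \<open>F\<close> themselves.\<close>
  have FI: "F \<subseteq> convex hull (x ` I)"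
  proof
    fix y assume y: "y \<in> F"
    then obtain l where l: "\<forall>i\<in>{..<n}. 0 \<le> l i" "sum l {..<n} = 1" "y = (\<Sum>i<n. l i *\<^sub>R x i)"
      using Fsub convex_hull_image_eq[of "{..<n}" x] by auto
    have l0: "l i = 0" if "i < n" "i \<notin> I" for i
    proof (rule ccontr)
      assume "l i \<noteq> 0"
      then have "0 < l i" using l(1) that by (auto simp: order_le_less)
      then have "x i \<in> F"
        using face_of_positive_weight[OF F _ l(1,2), of i] y l(3) that by auto
      then show False using that by (simp add: I_def)
    qed
    have "y = (\<Sum>i\<in>I. l i *\<^sub>R x i)" unfolding l(3)
      by (rule sum.mono_neutral_right) (use l0 in \<open>auto simp: I_def\<close>)
    moreover have "sum l I = 1" unfolding l(2)[symmetric]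
      by (rule sum.mono_neutral_left) (use l0 in \<open>auto simp: I_def\<close>)
    ultimately show "y \<in> convex hull (x ` I)"
      unfolding convex_hull_image_eq[OF fin] using l(1) by (auto simp: I_def)
  qed
  have "h *\<^sub>R u \<in> hyperplane_euc d u h"
    using u by (auto simp: hyperplane_euc_def unit_sphere_def norm_eq_1)
  then have "F \<noteq> {}" using hF by auto
  then have Ine: "I \<noteq> {}" using FI by auto
  have IF: "x ` I \<subseteq> F" by (auto simp: I_def)
  have FH: "F \<subseteq> hyperplane_euc d u h" using hull_subset[of F affine] hF by simp
  have hI: "affine hull (x ` I) = hyperplane_euc d u h"
  proof
    show "affine hull (x ` I) \<subseteq> hyperplane_euc d u h"
      using IF FH by (intro hull_minimal affine_hyperplane_euc) auto
    have "F \<subseteq> affine hull (x ` I)" using FI convex_hull_subset_affine_hull by blast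
    then have "affine hull F \<subseteq> affine hull (x ` I)" by (intro hull_minimal affine_affine_hull)
    then show "hyperplane_euc d u h \<subseteq> affine hull (x ` I)" using hF by simp
  qed
  have 3: "\<forall>w\<in>unit_sphere d. w \<bullet> u = 0 \<longrightarrow> (\<exists>i\<in>I. \<exists>j\<in>I. x i \<bullet> w \<noteq> x j \<bullet> w)"
    using affine_hull_eq_hyperplane_iff[OF u, of "x ` I" h] fin Ine IF FH hI by auto
  \<comment> \<open>A common point would lie in \<open>F\<close>, being in the affine hull of the
    points indexed by \<open>I\<close>; then an index outside \<open>I\<close> with positive weight
    would have its point in \<open>F\<close>.\<close>
  have 4: "convex hull (x ` ({..<n} - I)) \<inter> hyperplane_euc d u h = {}"
  proof (rule ccontr)
    assume "\<not> ?thesis"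
    then obtain z where z: "z \<in> convex hull (x ` ({..<n} - I))" "z \<in> hyperplane_euc d u h" by blast
    have "convex hull (x ` ({..<n} - I)) \<subseteq> ?P" by (intro hull_mono) auto
    then have "z \<in> ?P" using z by blast
    then have zF: "z \<in> F"
      using face_of_affine_hull_finite[OF F _ _ IF] fin Ine z(2) hI by simp
    obtain l where l: "\<forall>i\<in>{..<n} - I. 0 \<le> l i" "sum l ({..<n} - I) = 1" "z = (\<Sum>i\<in>{..<n} - I. l i *\<^sub>R x i)"
      using z(1) convex_hull_image_eq[of "{..<n} - I" x] by auto
    have "\<exists>k\<in>{..<n} - I. l k \<noteq> 0" using l(2) by (metis sum.neutral zero_neq_one)
    then obtain k where k: "k \<in> {..<n} - I" "0 < l k" using l(1) by force
    have "F face_of convex hull (x ` {..<n})" by (rule F)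
    define l' where "l' i = (if i \<in> I then 0 else l i)" for i
    have "(\<Sum>i<n. l' i *\<^sub>R x i) = z" unfolding l(3)
      by (rule sum.mono_neutral_cong_right) (auto simp: l'_def)
    moreover have "sum l' {..<n} = 1" unfolding l(2)[symmetric]
      by (rule sum.mono_neutral_cong_right) (auto simp: l'_def)
    moreover have "\<forall>i\<in>{..<n}. 0 \<le> l' i" using l(1) by (auto simp: l'_def)
    ultimately have "x k \<in> F"
      using face_of_positive_weight[OF F, of l' k] zF k by (auto simp: l'_def)
    then show False using k by (simp add: I_def)
  qed
  have "x i \<bullet> u \<le> h" if "i < n" for i
    using le hull_inc[of "x i" "x ` {..<n}" convex] that by auto
  moreover have "\<forall>i\<in>I. x i \<in> hyperplane_euc d u h" using IF FH by auto
  moreover have "I \<subseteq> {..<n}" by (auto simp: I_def)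
  ultimately have "?r I u" using Ine u 3 4 by blast
  then show "\<exists>I u. ?r I u" by blast
next
  let ?P = "convex hull (x ` {..<n})"
  assume "\<exists>I u. ?r I u"
  then obtain I u where r: "?r I u" by blast
  then have I: "I \<subseteq> {..<n}" "I \<noteq> {}" and u: "u \<in> unit_sphere d"
    and xI: "x ` I \<subseteq> hyperplane_euc d u h" and le: "\<And>i. i < n \<Longrightarrow> x i \<bullet> u \<le> h"
    and nd: "\<forall>w\<in>unit_sphere d. w \<bullet> u = 0 \<longrightarrow> (\<exists>i\<in>I. \<exists>j\<in>I. x i \<bullet> w \<noteq> x j \<bullet> w)"
    and dis: "convex hull (x ` ({..<n} - I)) \<inter> hyperplane_euc d u h = {}" by blast+
  have fin: "finite I" using I by (auto intro: finite_subset)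
  have hI: "affine hull (x ` I) = hyperplane_euc d u h"
    using affine_hull_eq_hyperplane_iff[OF u, of "x ` I" h] fin I xI nd by auto
  have "convex hull (x ` {..<n} - x ` I) \<subseteq> convex hull (x ` ({..<n} - I))" by (intro hull_mono) auto
  then have "affine hull (x ` I) \<inter> convex hull (x ` {..<n} - x ` I) = {}" using dis hI by blast
  then have face: "convex hull (x ` I) face_of ?P"
    using I by (intro face_of_convex_hulls) auto
  have hF: "affine hull (convex hull (x ` I)) = hyperplane_euc d u h" using hI by (simp add: affine_hull_convex_hull)
  have "facet_in d (convex hull (x ` I)) ?P"
    unfolding facet_in_def using face has_aff_dim_hyperplane[OF u hF] by simp
  moreover have "has_height d ?P (convex hull (x ` I)) h" unfolding has_height_def
    using u hF convex_hull_halfspace[of "{..<n}" x u h] le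
    by (intro bexI[of _ u]) (auto simp: hyperplane_euc_def)
  ultimately show ?l by blast
qed

section \<open>Borel sets obtained by projection\<close>

text \<open>Projection along a compact factor is a closed map. It is used to eliminate quantifiers
  over unit vectors and over convex weights.\<close>

lemma closed_compact_projection_metric:
  fixes K :: "'a::metric_space set" and C :: "('a \<times> 'b::metric_space) set"
  assumes K: "compact K" and C: "closed C"
  shows "closed {y. \<exists>k\<in>K. (k, y) \<in> C}"
  unfolding closed_sequential_limits
proof (intro allI impI, elim conjE)
  fix Y y assume Y: "\<forall>n. Y n \<in> {y. \<exists>k\<in>K. (k, y) \<in> C}" "Y \<longlonglongrightarrow> y"
  then obtain k where k: "\<And>n. k n \<in> K" "\<And>n. (k n, Y n) \<in> C" by simp metis
  obtain l r where l: "l \<in> K" "strict_mono (r :: nat \<Rightarrow> nat)" "(k \<circ> r) \<longlonglongrightarrow> l"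
    using K k(1) unfolding compact_def by blast
  have lim: "(\<lambda>n. ((k \<circ> r) n, (Y \<circ> r) n)) \<longlonglongrightarrow> (l, y)"
    by (intro tendsto_Pair l LIMSEQ_subseq_LIMSEQ[OF Y(2)])
  have "((k \<circ> r) n, (Y \<circ> r) n) \<in> C" for n using k(2) by simp
  then have "(l, y) \<in> C" by (rule closed_sequentially[OF C _ lim])
  then show "y \<in> {y. \<exists>k\<in>K. (k, y) \<in> C}" using l(1) by blast
qed

text \<open>The pieces consist of the points at distance at least \<open>1 / (k + 1)\<close> from
  every point outside \<open>G\<close>; phrased pointwise, this also covers an empty
  complement.\<close>

lemma open_eq_Union_closed_metric:
  fixes G :: "'a::metric_space set"
  assumes "open G"
  shows "\<exists>C. (\<forall>k::nat. closed (C k)) \<and> G = (\<Union>k. C k)"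
proof -
  define C where "C k = (\<Inter>y\<in>- G. {z. 1 / real (Suc k) \<le> dist z y})" for k
  have "closed (C k)" for k
    unfolding C_def by (intro closed_INT ballI closed_Collect_le continuous_intros)
  moreover have "G = (\<Union>k. C k)"
  proof (intro set_eqI iffI)
    fix z assume "z \<in> G"
    then obtain e where e: "0 < e" "ball z e \<subseteq> G" using assms open_contains_ball by blast
    obtain k where "1 / real (Suc k) < e" using e(1) nat_approx_posE by blast
    then have "z \<in> C k" using e(2) by (force simp: C_def not_less[symmetric])
    then show "z \<in> (\<Union>k. C k)" by blast
  next
    fix z assume "z \<in> (\<Union>k. C k)"
    then obtain k where "z \<in> C k" by blast
    then show "z \<in> G" unfolding C_def by (rule_tac ccontr) force
  qed
  ultimately show ?thesis by blast
qed

text \<open>Open sets of a metric space are countable unions of closed sets, so \<open>E \<inter> G\<close> is \<open>\<sigma>\<close>-compact, and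
  this is preserved by the projection.\<close>

lemma borel_projection_locally_closed:
  fixes S :: "'a::metric_space set" and T :: "'b::metric_space set"
  assumes S: "S = (\<Union>m::nat. KS m)" "\<And>m. compact (KS m)" and T: "T = (\<Union>m::nat. KT m)" "\<And>m. compact (KT m)"
    and E: "closed E" and G: "open G"
  shows "{x \<in> S. \<exists>t\<in>T. (x, t) \<in> E \<and> (x, t) \<in> G} \<in> sets borel"
proof -
  obtain C where C: "\<And>k::nat. closed (C k)" "G = (\<Union>k. C k)"
    using open_eq_Union_closed_metric[OF G] by auto
  have "{x \<in> S. \<exists>t\<in>T. (x, t) \<in> E \<and> (x, t) \<in> G}
      = (\<Union>m. \<Union>m'. \<Union>k. fst ` ((KS m \<times> KT m') \<inter> (E \<inter> C k)))"
  proof (intro set_eqI iffI)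
    fix x assume "x \<in> {x \<in> S. \<exists>t\<in>T. (x, t) \<in> E \<and> (x, t) \<in> G}"
    then obtain t m m' k where "x \<in> KS m" "t \<in> KT m'" "(x, t) \<in> E" "(x, t) \<in> C k"
      unfolding S(1) T(1) C(2) by blast
    then have "(x, t) \<in> (KS m \<times> KT m') \<inter> (E \<inter> C k)" by blast
    then have "fst (x, t) \<in> fst ` ((KS m \<times> KT m') \<inter> (E \<inter> C k))" by (rule imageI)
    then show "x \<in> (\<Union>m. \<Union>m'. \<Union>k. fst ` ((KS m \<times> KT m') \<inter> (E \<inter> C k)))"
      unfolding fst_conv by blast
  next
    fix x assume "x \<in> (\<Union>m. \<Union>m'. \<Union>k. fst ` ((KS m \<times> KT m') \<inter> (E \<inter> C k)))"
    then obtain m m' k t where "(x, t) \<in> (KS m \<times> KT m') \<inter> (E \<inter> C k)" by (auto simp: image_iff)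
    then show "x \<in> {x \<in> S. \<exists>t\<in>T. (x, t) \<in> E \<and> (x, t) \<in> G}" unfolding S(1) T(1) C(2) by blast
  qed
  also have "\<dots> \<in> sets borel"
  proof (intro sets.countable_UN'' countableI_type borel_closed compact_imp_closed)
    show "compact (fst ` ((KS m \<times> KT m') \<inter> (E \<inter> C k)))" for m m' k
      by (intro compact_continuous_image continuous_intros compact_Int_closed compact_Times S T closed_Int E C)
  qed
  finally show ?thesis .
qed

lemma continuous_on_fst_coordinate: "continuous_on A (\<lambda>p. fst p i)"
  by (rule continuous_on_product_then_coordinatewise) (rule continuous_on_fst[OF continuous_on_id])

text \<open>Tuples of \<open>n\<close> points are padded with zeros to functions on all of
  \<open>nat\<close>, so that they live in a single metric space; the padding keeps the set of
  tuples \<sigma>-compact.\<close>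

definition supported_tuples :: "nat \<Rightarrow> (nat \<Rightarrow> fseq) set"
  where "supported_tuples n = {x. \<forall>i\<ge>n. x i = 0}"

lemma supported_tuples_sigma_compact:
  "\<exists>K. supported_tuples n = (\<Union>m::nat. K m) \<and> (\<forall>m. compact (K m))"
proof -
  define K where "K m = PiE UNIV (\<lambda>i. if i < n then cball 0 (real m) \<inter> euc m else {0})" for m
  have "compact (K m)" for m
  proof -
    have "compactin (product_topology (\<lambda>_. euclidean) UNIV) (K m)"
      unfolding K_def compactin_PiE by (auto simp: compact_cball_euc)
    then show ?thesis by (simp add: euclidean_product_topology)
  qed
  moreover have "supported_tuples n = (\<Union>m. K m)"
  proof (intro set_eqI iffI)
    fix x assume x: "x \<in> supported_tuples n"
    have "\<exists>m. norm (x i) \<le> real m \<and> x i \<in> euc m" for i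
    proof -
      obtain a where a: "x i \<in> euc a" using euc_exhaust by blast
      obtain b :: nat where b: "norm (x i) \<le> real b" using real_arch_simple by blast
      show ?thesis using a b euc_mono[of a "max a b"] by (intro exI[of _ "max a b"]) auto
    qed
    then obtain m where m: "\<And>i. norm (x i) \<le> real (m i)" "\<And>i. x i \<in> euc (m i)" by metis
    define k where "k = Max (insert 0 (m ` {..<n}))"
    have "m i \<le> k" if "i < n" for i using that by (auto simp: k_def)
    then have "x i \<in> cball 0 (real k) \<inter> euc k" if "i < n" for i
      using that m euc_mono[of "m i" k] by (fastforce intro: order_trans[OF m(1)])
    then have "x \<in> K k" using x by (auto simp: K_def PiE_iff supported_tuples_def)
    then show "x \<in> (\<Union>m. K m)" by blast
  next
    fix x assume "x \<in> (\<Union>m. K m)"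
    then obtain m where m: "x \<in> K m" by blast
    have "x i = 0" if "i \<ge> n" for i
    proof -
      have "x i \<in> (if i < n then cball 0 (real m) \<inter> euc m else {0})"
        using m unfolding K_def by (rule PiE_mem) simp
      then show ?thesis using that by simp
    qed
    then show "x \<in> supported_tuples n" by (simp add: supported_tuples_def)
  qed
  ultimately show ?thesis by blast
qed

text \<open>By \<open>exists_facet_height_iff\<close> the set is a finite union, over index sets
  \<open>I\<close>, of projections along \<open>(u, h)\<close>. The set \<open>E I\<close> is
  closed. \<open>B1 I\<close> and \<open>B2 I\<close> describe the failure of the other two
  conditions and are closed as projections along a sphere and a simplex, so avoiding them is an open
  condition.\<close>

lemma facet_height_less_borel:
  "{x \<in> supported_tuples n. \<exists>h<c. \<exists>F. facet_in d F (convex hull (x ` {..<n})) \<and>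
      has_height d (convex hull (x ` {..<n})) F h} \<in> sets borel"
proof -
  obtain KS where KS: "supported_tuples n = (\<Union>m::nat. KS m)" "\<And>m. compact (KS m)"
    using supported_tuples_sigma_compact[of n] by blast
  define T where "T = unit_sphere d \<times> {..<c}"
  \<comment> \<open>The half-open range \<open>h < c\<close> is exhausted by compact intervals
    ending at \<open>c - 1 / (m + 1)\<close>.\<close>
  define KT where "KT m = unit_sphere d \<times> {- real m..c - 1 / real (Suc m)}" for m
  have KT: "compact (KT m)" for m unfolding KT_def by (intro compact_Times compact_unit_sphere compact_Icc)
  have TK: "T = (\<Union>m. KT m)"
  proof (intro set_eqI iffI)
    fix p assume p: "p \<in> T"
    obtain u h where uh: "p = (u, h)" "u \<in> unit_sphere d" "h < c" using p by (auto simp: T_def)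
    obtain a where a: "1 / real (Suc a) < c - h" using uh(3) by (metis diff_gt_0_iff_gt nat_approx_posE)
    obtain b :: nat where b: "- h \<le> real b" using real_arch_simple by blast
    have "1 / real (Suc (max a b)) \<le> 1 / real (Suc a)" by (intro divide_left_mono) auto
    then have "p \<in> KT (max a b)" using uh a b by (auto simp: KT_def)
    then show "p \<in> (\<Union>m. KT m)" by blast
  next
    fix p assume "p \<in> (\<Union>m. KT m)"
    then obtain m where m: "p \<in> KT m" by blast
    have "0 < 1 / real (Suc m)" by simp
    moreover have "snd p \<le> c - 1 / real (Suc m)" "fst p \<in> unit_sphere d" using m by (auto simp: KT_def)
    ultimately have "snd p < c" "fst p \<in> unit_sphere d" by linarith+
    then show "p \<in> T" by (auto simp: T_def mem_Times_iff)
  qed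
  define E :: "nat set \<Rightarrow> ((nat \<Rightarrow> fseq) \<times> fseq \<times> real) set" where
    "E I = {p. (\<forall>i\<in>I. fst p i \<in> hyperplane_euc d (fst (snd p)) (snd (snd p))) \<and> (\<forall>i<n. fst p i \<bullet> fst (snd p) \<le> snd (snd p))}" for I
  define B1 :: "nat set \<Rightarrow> ((nat \<Rightarrow> fseq) \<times> fseq \<times> real) set" where
    "B1 I = {p. \<exists>w\<in>unit_sphere d. (w, p) \<in> {q. fst q \<bullet> fst (snd (snd q)) = 0 \<and>
        (\<forall>i\<in>I. \<forall>j\<in>I. fst (snd q) i \<bullet> fst q = fst (snd q) j \<bullet> fst q)}}" for I
  \<comment> \<open>The simplex of convex weights, encoded inside \<open>euc n\<close> so that
    closed and bounded gives compact.\<close>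
  define \<Delta> :: "nat set \<Rightarrow> fseq set" where
    "\<Delta> J = {l \<in> euc n. (\<forall>i\<in>J. 0 \<le> coord l i) \<and> (\<Sum>i\<in>J. coord l i) = 1 \<and> (\<forall>i\<in>- J. coord l i = 0)}" for J
  define B2 :: "nat set \<Rightarrow> ((nat \<Rightarrow> fseq) \<times> fseq \<times> real) set" where
    "B2 I = {p. \<exists>l\<in>\<Delta> ({..<n} - I). (l, p) \<in> {q. (\<Sum>i\<in>{..<n} - I. coord (fst q) i *\<^sub>R fst (snd q) i)
        \<in> hyperplane_euc d (fst (snd (snd q))) (snd (snd (snd q)))}}" for I
  have c1: "continuous_on UNIV (\<lambda>q. fst (snd q) i)" for i
    by (rule continuous_on_product_then_coordinatewise) (intro continuous_intros)
  have c0: "continuous_on UNIV (\<lambda>q. fst q i)" for i by (rule continuous_on_fst_coordinate)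
  have cl_euc: "closed {q. f q \<in> euc d}" if "continuous_on UNIV f" for f :: "'z::topological_space \<Rightarrow> fseq"
    using closed_vimage[OF closed_euc that] by (simp add: vimage_def)
  have closedE: "closed (E I)" for I
  proof -
    have "E I = (\<Inter>i\<in>I. {p. fst p i \<in> euc d} \<inter> {p. fst p i \<bullet> fst (snd p) = snd (snd p)}) \<inter>
        (\<Inter>i\<in>{..<n}. {p. fst p i \<bullet> fst (snd p) \<le> snd (snd p)})"
      by (auto simp: E_def hyperplane_euc_def)
    then show ?thesis
      by (auto intro!: closed_Int closed_INT cl_euc closed_Collect_eq closed_Collect_le c0 continuous_intros)
  qed
  have closedB1: "closed (B1 I)" for I
    unfolding B1_def
  proof (rule closed_compact_projection_metric[OF compact_unit_sphere])
    have "{q :: fseq \<times> (nat \<Rightarrow> fseq) \<times> fseq \<times> real. fst q \<bullet> fst (snd (snd q)) = 0 \<and> (\<forall>i\<in>I. \<forall>j\<in>I. fst (snd q) i \<bullet> fst q = fst (snd q) j \<bullet> fst q)}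
      = {q. fst q \<bullet> fst (snd (snd q)) = 0} \<inter> (\<Inter>i\<in>I. \<Inter>j\<in>I. {q. fst (snd q) i \<bullet> fst q = fst (snd q) j \<bullet> fst q})"
      by auto
    then show "closed {q :: fseq \<times> (nat \<Rightarrow> fseq) \<times> fseq \<times> real. fst q \<bullet> fst (snd (snd q)) = 0 \<and> (\<forall>i\<in>I. \<forall>j\<in>I. fst (snd q) i \<bullet> fst q = fst (snd q) j \<bullet> fst q)}"
      by (auto intro!: closed_Int closed_INT closed_Collect_eq c1 continuous_intros)
  qed
  have compact\<Delta>: "compact (\<Delta> J)" if J: "J \<subseteq> {..<n}" for J
  proof (rule compact_in_euc[of _ n])
    have "\<Delta> J = euc n \<inter> (\<Inter>i\<in>J. {l. 0 \<le> coord l i}) \<inter> {l. (\<Sum>i\<in>J. coord l i) = 1} \<inter> (\<Inter>i\<in>- J. {l. coord l i = 0})"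
      by (auto simp: \<Delta>_def)
    then show "closed (\<Delta> J)"
      by (auto intro!: closed_Int closed_euc closed_INT closed_Collect_eq closed_Collect_le continuous_intros)
    have "norm l \<le> 1" if l: "l \<in> \<Delta> J" for l
    proof -
      have "l = (\<Sum>i<n. coord l i *\<^sub>R unit_vec i)" using l by (intro euc_expansion) (simp add: \<Delta>_def)
      also have "norm \<dots> \<le> (\<Sum>i<n. norm (coord l i *\<^sub>R unit_vec i))" by (rule norm_sum)
      also have "\<dots> = (\<Sum>i\<in>J. coord l i)"
        by (rule sum.mono_neutral_cong_right) (use J l in \<open>auto simp: \<Delta>_def\<close>)
      finally show ?thesis using l by (simp add: \<Delta>_def)
    qed
    then show "bounded (\<Delta> J)" by (auto simp: bounded_iff)
  qed (auto simp: \<Delta>_def)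
  have closedB2: "closed (B2 I)" for I
    unfolding B2_def
  proof (rule closed_compact_projection_metric[OF compact\<Delta>])
    let ?s = "\<lambda>q :: fseq \<times> (nat \<Rightarrow> fseq) \<times> fseq \<times> real. \<Sum>i\<in>{..<n} - I. coord (fst q) i *\<^sub>R fst (snd q) i"
    have cs: "continuous_on UNIV ?s" by (intro continuous_intros c1)
    have "{q. ?s q \<in> hyperplane_euc d (fst (snd (snd q))) (snd (snd (snd q)))}
      = {q. ?s q \<in> euc d} \<inter> {q. ?s q \<bullet> fst (snd (snd q)) = snd (snd (snd q))}"
      by (auto simp: hyperplane_euc_def)
    also have "closed \<dots>"
      by (intro closed_Int cl_euc closed_Collect_eq cs continuous_intros)
    finally show "closed {q. ?s q \<in> hyperplane_euc d (fst (snd (snd q))) (snd (snd (snd q)))}" .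
  qed auto
  have B2_iff: "(x, u, h) \<in> B2 I \<longleftrightarrow> convex hull (x ` ({..<n} - I)) \<inter> hyperplane_euc d u h \<noteq> {}" for x u h I
  proof
    assume "(x, u, h) \<in> B2 I"
    then obtain l where l: "l \<in> \<Delta> ({..<n} - I)" "(\<Sum>i\<in>{..<n} - I. coord l i *\<^sub>R x i) \<in> hyperplane_euc d u h"
      by (auto simp: B2_def)
    have "(\<Sum>i\<in>{..<n} - I. coord l i *\<^sub>R x i) \<in> convex hull (x ` ({..<n} - I))"
      unfolding convex_hull_image_eq[OF finite_Diff[OF finite_lessThan]] using l(1) by (auto simp: \<Delta>_def)
    then show "convex hull (x ` ({..<n} - I)) \<inter> hyperplane_euc d u h \<noteq> {}" using l(2) by blast
  next
    assume "convex hull (x ` ({..<n} - I)) \<inter> hyperplane_euc d u h \<noteq> {}"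
    then obtain z where z: "z \<in> convex hull (x ` ({..<n} - I))" "z \<in> hyperplane_euc d u h" by blast
    obtain f where f: "\<forall>i\<in>{..<n} - I. 0 \<le> f i" "sum f ({..<n} - I) = 1" "z = (\<Sum>i\<in>{..<n} - I. f i *\<^sub>R x i)"
      using z(1) unfolding convex_hull_image_eq[OF finite_Diff[OF finite_lessThan]] by blast
    define l where "l = embed n (\<lambda>i. if i \<in> I then 0 else f i)"
    have cl: "coord l i = f i" if "i \<in> {..<n} - I" for i using that by (simp add: l_def)
    have "l \<in> \<Delta> ({..<n} - I)"
      using f cl by (auto simp: \<Delta>_def l_def euc_def)
    moreover have "(\<Sum>i\<in>{..<n} - I. coord l i *\<^sub>R x i) = z" unfolding f(3) by (intro sum.cong) (auto simp: cl)
    ultimately show "(x, u, h) \<in> B2 I" using z(2) unfolding B2_def by force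
  qed
  have B1_iff: "(x, u, h) \<in> B1 I \<longleftrightarrow> \<not> (\<forall>w\<in>unit_sphere d. w \<bullet> u = 0 \<longrightarrow> (\<exists>i\<in>I. \<exists>j\<in>I. x i \<bullet> w \<noteq> x j \<bullet> w))" for x u h I
    unfolding B1_def by simp
  have E_iff: "(x, u, h) \<in> E I \<longleftrightarrow> (\<forall>i\<in>I. x i \<in> hyperplane_euc d u h) \<and> (\<forall>i<n. x i \<bullet> u \<le> h)" for x u h I
    unfolding E_def by simp
  have key: "(\<exists>F. facet_in d F (convex hull (x ` {..<n})) \<and> has_height d (convex hull (x ` {..<n})) F h) \<longleftrightarrow>
    (\<exists>I u. I \<subseteq> {..<n} \<and> I \<noteq> {} \<and> u \<in> unit_sphere d \<and> (x, u, h) \<in> E I \<and> (x, u, h) \<notin> B1 I \<and> (x, u, h) \<notin> B2 I)" for x h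
    unfolding exists_facet_height_iff E_iff B1_iff B2_iff by (simp only: not_not conj_assoc)
  have "{x \<in> supported_tuples n. \<exists>h<c. \<exists>F. facet_in d F (convex hull (x ` {..<n})) \<and> has_height d (convex hull (x ` {..<n})) F h}
    = (\<Union>I\<in>Pow {..<n} - {{}}. {x \<in> supported_tuples n. \<exists>t\<in>T. (x, t) \<in> E I \<and> (x, t) \<in> - B1 I \<inter> - B2 I})"
    (is "?lhs = ?rhs")
  proof (intro set_eqI iffI)
    fix x assume "x \<in> ?lhs"
    then obtain h I u where "x \<in> supported_tuples n" "h < c" "I \<subseteq> {..<n}" "I \<noteq> {}" "u \<in> unit_sphere d"
      "(x, u, h) \<in> E I" "(x, u, h) \<notin> B1 I" "(x, u, h) \<notin> B2 I"
      unfolding key by blast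
    then show "x \<in> ?rhs" unfolding T_def by blast
  next
    fix x assume "x \<in> ?rhs"
    then obtain h I u where "x \<in> supported_tuples n" "h < c" "I \<subseteq> {..<n}" "I \<noteq> {}" "u \<in> unit_sphere d"
      "(x, u, h) \<in> E I" "(x, u, h) \<notin> B1 I" "(x, u, h) \<notin> B2 I"
      unfolding T_def by blast
    then show "x \<in> ?lhs" unfolding key by blast
  qed
  also have "\<dots> \<in> sets borel"
    by (intro sets.finite_UN finite_Diff finite_Pow_iff[THEN iffD2] finite_lessThan
        borel_projection_locally_closed[OF KS TK KT closedE] open_Int open_Compl closedB1 closedB2)
  finally show ?thesis .
qed

text \<open>Convex combinations with equal weights of two \<open>e\<close>-close tuples are
  \<open>e\<close>-close, so each of the two suprema changes by at most \<open>e\<close>.\<close>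

lemma hausdorff_dist_convex_hull_Lipschitz:
  fixes x y :: "nat \<Rightarrow> fseq"
  assumes n: "0 < n" and e: "\<And>i. i < n \<Longrightarrow> dist (x i) (y i) \<le> e"
  shows "hausdorff_dist (convex hull (y ` {..<n})) (unit_ball d) \<le> hausdorff_dist (convex hull (x ` {..<n})) (unit_ball d) + e"
proof -
  let ?A = "convex hull (x ` {..<n})" and ?B = "convex hull (y ` {..<n})"
  have close: "\<exists>b\<in>convex hull (g ` {..<n}). dist a b \<le> e"
    if a: "a \<in> convex hull (f ` {..<n})" and fg: "\<And>i. i < n \<Longrightarrow> dist (f i) (g i) \<le> e" for a and f g :: "nat \<Rightarrow> fseq"
  proof -
    obtain l where l: "\<forall>i\<in>{..<n}. 0 \<le> l i" "sum l {..<n} = 1" "a = (\<Sum>i<n. l i *\<^sub>R f i)"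
      using a unfolding convex_hull_image_eq[OF finite_lessThan] by blast
    have "(\<Sum>i<n. l i *\<^sub>R g i) \<in> convex hull (g ` {..<n})"
      unfolding convex_hull_image_eq[OF finite_lessThan] using l by blast
    moreover have "dist a (\<Sum>i<n. l i *\<^sub>R g i) \<le> e"
    proof -
      have "dist a (\<Sum>i<n. l i *\<^sub>R g i) = norm (\<Sum>i<n. l i *\<^sub>R (f i - g i))"
        by (simp add: l(3) dist_norm scaleR_diff_right sum_subtractf)
      also have "\<dots> \<le> (\<Sum>i<n. norm (l i *\<^sub>R (f i - g i)))" by (rule norm_sum)
      also have "\<dots> \<le> (\<Sum>i<n. l i * e)"
        using l(1) fg by (intro sum_mono) (auto simp: dist_norm intro!: mult_left_mono)
      also have "\<dots> = e" using l(2) by (simp flip: sum_distrib_right)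
      finally show ?thesis .
    qed
    ultimately show ?thesis by blast
  qed
  have ne: "?A \<noteq> {}" "?B \<noteq> {}" using n by auto
  have bdd1: "bdd_above ((\<lambda>a. infdist a (unit_ball d)) ` ?A)"
  proof -
    have "bounded ?A" by (intro compact_imp_bounded finite_imp_compact_convex_hull finite_imageI finite_lessThan)
    then obtain R where R: "\<And>a. a \<in> ?A \<Longrightarrow> norm a \<le> R" by (auto simp: bounded_iff)
    show ?thesis
      by (rule bdd_aboveI2[of _ _ R]) (use R infdist_le2[OF zero_in_unit_ball] in auto)
  qed
  have bdd2: "bdd_above ((\<lambda>b. infdist b ?A) ` unit_ball d)"
  proof -
    have x0: "x 0 \<in> ?A" using n by (auto intro: hull_inc)
    show ?thesis
    proof (rule bdd_aboveI2)
      fix b assume "b \<in> unit_ball d"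
      then show "infdist b ?A \<le> 1 + norm (x 0)"
        using norm_triangle_ineq4[of b "x 0"]
        by (intro infdist_le2[OF x0]) (auto simp: dist_norm unit_ball_def)
    qed
  qed
  have "(SUP a\<in>?B. infdist a (unit_ball d)) \<le> (SUP a\<in>?A. infdist a (unit_ball d)) + e"
  proof (rule cSUP_least[OF ne(2)])
    fix b assume "b \<in> ?B"
    then obtain a where a: "a \<in> ?A" "dist b a \<le> e"
      using close[of b y x] e by (auto simp: dist_commute)
    have "infdist b (unit_ball d) \<le> infdist a (unit_ball d) + dist b a" by (rule infdist_triangle)
    also have "infdist a (unit_ball d) \<le> (SUP a\<in>?A. infdist a (unit_ball d))" by (rule cSUP_upper[OF a(1) bdd1])
    finally show "infdist b (unit_ball d) \<le> (SUP a\<in>?A. infdist a (unit_ball d)) + e" using a(2) by simp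
  qed
  moreover have "(SUP b\<in>unit_ball d. infdist b ?B) \<le> (SUP b\<in>unit_ball d. infdist b ?A) + e"
  proof (rule cSUP_least)
    show "unit_ball d \<noteq> {}" using zero_in_unit_ball by auto
    fix b assume b: "b \<in> unit_ball d"
    have "infdist b ?B - e \<le> infdist b ?A"
      unfolding infdist_notempty[OF ne(1)]
    proof (rule cINF_greatest[OF ne(1)])
      fix a assume "a \<in> ?A"
      then obtain a' where a': "a' \<in> ?B" "dist a a' \<le> e" using close[of a x y] e by auto
      have "infdist b ?B \<le> dist b a'" by (rule infdist_le[OF a'(1)])
      also have "\<dots> \<le> dist b a + dist a a'" by (rule dist_triangle)
      finally show "infdist b ?B - e \<le> dist b a" using a'(2) by simp
    qed
    also have "infdist b ?A \<le> (SUP b\<in>unit_ball d. infdist b ?A)" by (rule cSUP_upper[OF b bdd2])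
    finally show "infdist b ?B \<le> (SUP b\<in>unit_ball d. infdist b ?A) + e" by simp
  qed
  ultimately show ?thesis unfolding hausdorff_dist_def by linarith
qed

lemma continuous_on_hausdorff_dist_convex_hull:
  assumes n: "0 < n"
  shows "continuous_on UNIV (\<lambda>x :: nat \<Rightarrow> fseq. hausdorff_dist (convex hull (x ` {..<n})) (unit_ball d))" (is "continuous_on _ ?f")
  unfolding continuous_on
proof (intro ballI tendstoI)
  fix x :: "nat \<Rightarrow> fseq" and e :: real assume e: "0 < e"
  have "\<forall>\<^sub>F y in at x within UNIV. \<forall>i\<in>{..<n}. dist (y i) (x i) < e / 2"
  proof (rule eventually_ball_finite[OF finite_lessThan], intro ballI)
    fix i
    have "((\<lambda>y. y i) \<longlongrightarrow> x i) (at x within UNIV)"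
      using continuous_on_product_coordinates[of i] unfolding continuous_on by blast
    then show "\<forall>\<^sub>F y in at x within UNIV. dist (y i) (x i) < e / 2" using e by (intro tendstoD) auto
  qed
  then show "\<forall>\<^sub>F y in at x within UNIV. dist (?f y) (?f x) < e"
  proof eventually_elim
    fix y assume y: "\<forall>i\<in>{..<n}. dist (y i) (x i) < e / 2"
    have "?f y \<le> ?f x + e / 2"
      using y by (intro hausdorff_dist_convex_hull_Lipschitz[OF n]) (auto simp: dist_commute less_imp_le)
    moreover have "?f x \<le> ?f y + e / 2"
      using y by (intro hausdorff_dist_convex_hull_Lipschitz[OF n]) (auto simp: less_imp_le)
    ultimately show "dist (?f y) (?f x) < e" using e by (auto simp: dist_real_def abs_less_iff)
  qed
qed

section \<open>From functions of tuples to random variables\<close>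

definition zero_extend :: "nat \<Rightarrow> (nat \<Rightarrow> 'w \<Rightarrow> fseq) \<Rightarrow> 'w \<Rightarrow> nat \<Rightarrow> fseq"
  where "zero_extend n X \<omega> = (\<lambda>i. if i < n then X i \<omega> else 0)"

lemma measurable_zero_extend:
  fixes X :: "nat \<Rightarrow> 'w \<Rightarrow> fseq"
  assumes "\<And>i. i < n \<Longrightarrow> X i \<in> borel_measurable M"
  shows "zero_extend n X \<in> borel_measurable M"
  unfolding zero_extend_def[abs_def] measurable_cong_sets[OF refl sets_PiM_equal_borel[symmetric]]
proof (rule measurable_PiM_single')
  fix i :: nat
  show "(\<lambda>\<omega>. if i < n then X i \<omega> else 0) \<in> borel_measurable M" by (cases "i < n") (use assms in auto)
qed auto

lemma rand_polytope_zero_extend: "rand_polytope n X \<omega> = convex hull (zero_extend n X \<omega> ` {..<n})"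
  unfolding rand_polytope_def
  by (intro arg_cong[where f = "\<lambda>A. convex hull A"] image_cong) (auto simp: zero_extend_def)

lemma borel_measurable_hausdorff_dist_rand_polytope:
  assumes "\<And>i. i < n \<Longrightarrow> X i \<in> borel_measurable M" "0 < n"
  shows "(\<lambda>\<omega>. hausdorff_dist (rand_polytope n X \<omega>) (unit_ball d)) \<in> borel_measurable M"
  unfolding rand_polytope_zero_extend
  by (rule measurable_compose[OF measurable_zero_extend
      borel_measurable_continuous_onI[OF continuous_on_hausdorff_dist_convex_hull]]) (use assms in auto)

text \<open>On degenerate samples there may be no facet, and the infimum is then the fixed number
  \<open>Inf {}\<close>. This event is measurable and treated apart; elsewhere the infimum is below
  \<open>c\<close> exactly when some height is, because the heights are bounded below.\<close>

lemma borel_measurable_min_facet_height_rand_polytope: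
  assumes X: "\<And>i. i < n \<Longrightarrow> X i \<in> borel_measurable M" and n: "0 < n"
  shows "(\<lambda>\<omega>. min_facet_height d (rand_polytope n X \<omega>)) \<in> borel_measurable M"
proof (rule borel_measurableI_less)
  fix c :: real
  let ?x = "zero_extend n X"
  have x: "?x \<in> borel_measurable M" by (rule measurable_zero_extend[OF X])
  have xS: "?x \<omega> \<in> supported_tuples n" for \<omega> by (auto simp: zero_extend_def supported_tuples_def)
  define H where "H \<omega> = {h. \<exists>F. facet_in d F (rand_polytope n X \<omega>) \<and> has_height d (rand_polytope n X \<omega>) F h}" for \<omega>
  have m: "{\<omega> \<in> space M. \<exists>h\<in>H \<omega>. h < c} \<in> sets M" for c
  proof -
    have "{\<omega> \<in> space M. \<exists>h\<in>H \<omega>. h < c} = ?x -` {x \<in> supported_tuples n. \<exists>h<c. \<exists>F. facet_in d F (convex hull (x ` {..<n})) \<and>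
      has_height d (convex hull (x ` {..<n})) F h} \<inter> space M"
      using xS by (auto simp: H_def rand_polytope_zero_extend)
    also have "\<dots> \<in> sets M" by (rule measurable_sets[OF x facet_height_less_borel])
    finally show ?thesis .
  qed
  have bdd: "bdd_below (H \<omega>)" for \<omega>
  proof (rule bdd_belowI)
    fix h assume "h \<in> H \<omega>"
    then obtain u where u: "u \<in> unit_sphere d" "rand_polytope n X \<omega> \<subseteq> {z. z \<bullet> u \<le> h}"
      by (auto simp: H_def has_height_def)
    have "X 0 \<omega> \<in> rand_polytope n X \<omega>" using n by (auto simp: rand_polytope_def intro: hull_inc)
    then have "X 0 \<omega> \<bullet> u \<le> h" using u by auto
    moreover have "\<bar>X 0 \<omega> \<bullet> u\<bar> \<le> norm (X 0 \<omega>)"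
      using Cauchy_Schwarz_ineq2[of "X 0 \<omega>" u] u by (simp add: unit_sphereD)
    ultimately show "- norm (X 0 \<omega>) \<le> h" by linarith
  qed
  have ne: "{\<omega> \<in> space M. H \<omega> \<noteq> {}} \<in> sets M"
  proof -
    have "{\<omega> \<in> space M. H \<omega> \<noteq> {}} = (\<Union>k::nat. {\<omega> \<in> space M. \<exists>h\<in>H \<omega>. h < real k})"
    proof (intro set_eqI iffI)
      fix \<omega> assume "\<omega> \<in> {\<omega> \<in> space M. H \<omega> \<noteq> {}}"
      then obtain h where "h \<in> H \<omega>" "\<omega> \<in> space M" by blast
      moreover obtain k :: nat where "h < real k" using reals_Archimedean2 by blast
      ultimately show "\<omega> \<in> (\<Union>k::nat. {\<omega> \<in> space M. \<exists>h\<in>H \<omega>. h < real k})" by blast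
    qed auto
    also have "\<dots> \<in> sets M" using m by auto
    finally show ?thesis .
  qed
  have "{\<omega> \<in> space M. min_facet_height d (rand_polytope n X \<omega>) < c}
    = {\<omega> \<in> space M. \<exists>h\<in>H \<omega>. h < c} \<union> (if Inf {} < c then space M - {\<omega> \<in> space M. H \<omega> \<noteq> {}} else {})"
  proof (rule set_eqI)
    fix \<omega>
    show "\<omega> \<in> {\<omega> \<in> space M. min_facet_height d (rand_polytope n X \<omega>) < c} \<longleftrightarrow>
      \<omega> \<in> {\<omega> \<in> space M. \<exists>h\<in>H \<omega>. h < c} \<union> (if Inf {} < c then space M - {\<omega> \<in> space M. H \<omega> \<noteq> {}} else {})"
    proof (cases "H \<omega> = {}")
      case True
      then show ?thesis unfolding min_facet_height_def H_def[symmetric] by simp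
    next
      case False
      then show ?thesis unfolding min_facet_height_def H_def[symmetric]
        using cInf_less_iff[OF False bdd] by auto
    qed
  qed
  also have "\<dots> \<in> sets M" using m ne by auto
  finally show "{\<omega> \<in> space M. min_facet_height d (rand_polytope n X \<omega>) < c} \<in> sets M" .
qed

subsection \<open>General position\<close>

text \<open>The coefficient vector of a dependence is normalised, so it ranges over a compact sphere
  and dependence becomes a closed condition on the tuple.\<close>

definition affinely_dependent_tuple :: "nat \<Rightarrow> (nat \<Rightarrow> fseq) \<Rightarrow> bool"
  where "affinely_dependent_tuple k x \<longleftrightarrow>
    (\<exists>l\<in>unit_sphere (Suc k). (\<Sum>i\<le>k. coord l i) = 0 \<and> (\<Sum>i\<le>k. coord l i *\<^sub>R x i) = 0)"

lemma affinely_dependent_tupleI: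
  assumes "(\<Sum>i\<le>k. l i) = 0" "(\<Sum>i\<le>k. l i *\<^sub>R x i) = 0" "j \<le> k" "l j \<noteq> 0"
  shows "affinely_dependent_tuple k x"
proof -
  define v where "v = embed (Suc k) l"
  have cv: "coord v i = l i" if "i \<le> k" for i using that by (simp add: v_def)
  have "v \<in> euc (Suc k)" by (auto simp: v_def euc_def)
  moreover have "v \<noteq> 0" using cv[OF assms(3)] assms(4) by auto
  ultimately have "v /\<^sub>R norm v \<in> unit_sphere (Suc k)" by (rule normalize_in_unit_sphere)
  moreover have "(\<Sum>i\<le>k. coord (v /\<^sub>R norm v) i) = (\<Sum>i\<le>k. l i) /\<^sub>R norm v"
    by (simp add: sum_distrib_left cv)
  moreover have "(\<Sum>i\<le>k. coord (v /\<^sub>R norm v) i *\<^sub>R x i) = (\<Sum>i\<le>k. l i *\<^sub>R x i) /\<^sub>R norm v"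
    by (simp add: scaleR_sum_right cv)
  ultimately show ?thesis
    unfolding affinely_dependent_tuple_def assms(1,2) by (intro bexI[of _ "v /\<^sub>R norm v"]) auto
qed

text \<open>Homogenisation: the vectors \<open>x\<^sub>i + e\<^sub>d\<close> are linearly dependent because they are all
  orthogonal to \<open>w - t e\<^sub>d\<close>, where \<open>t\<close> is the common value of \<open>x\<^sub>i \<bullet> w\<close>.\<close>

lemma affinely_dependent_tuple_hyperplane:
  assumes x: "\<And>i. i \<le> d \<Longrightarrow> x i \<in> euc d" and w: "w \<in> unit_sphere d" "\<And>i. i \<le> d \<Longrightarrow> x i \<bullet> w = t"
  shows "affinely_dependent_tuple d x"
proof -
  define z where "z i = x i + unit_vec d" for i
  have xd: "coord (x i) d = 0" if "i \<le> d" for i using x[OF that] by (auto simp: euc_def)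
  have zeuc: "z i \<in> euc (Suc d)" if "i \<le> d" for i
    using x[OF that] euc_mono[of d "Suc d"] unit_vec_in_euc[of d "Suc d"] by (auto simp: z_def)
  have comb: "(\<Sum>i\<le>d. l i) = 0" "(\<Sum>i\<le>d. l i *\<^sub>R x i) = 0" if "(\<Sum>i\<le>d. l i *\<^sub>R z i) = 0" for l
  proof -
    have "coord (\<Sum>i\<le>d. l i *\<^sub>R z i) d = (\<Sum>i\<le>d. l i)"
      by (simp add: coord_sum z_def xd)
    then show "(\<Sum>i\<le>d. l i) = 0" using that by simp
    moreover have "(\<Sum>i\<le>d. l i *\<^sub>R z i) = (\<Sum>i\<le>d. l i *\<^sub>R x i) + (\<Sum>i\<le>d. l i) *\<^sub>R unit_vec d"
      by (simp add: z_def scaleR_add_right sum.distrib scaleR_sum_left)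
    ultimately show "(\<Sum>i\<le>d. l i *\<^sub>R x i) = 0" using that by simp
  qed
  show ?thesis
  proof (cases "inj_on z {..d}")
    \<comment> \<open>A repeated point is dependent by itself; it is separated because the set
      \<open>S\<close> below forgets multiplicities.\<close>
    case False
    then obtain i j where ij: "i \<le> d" "j \<le> d" "i \<noteq> j" "z i = z j" by (auto simp: inj_on_def)
    define l where "l m = (if m = i then 1 else if m = j then -1 else 0 :: real)" for m
    have "(\<Sum>m\<le>d. l m *\<^sub>R z m) = (\<Sum>m\<in>{i, j}. l m *\<^sub>R z m)"
      by (rule sum.mono_neutral_right) (use ij in \<open>auto simp: l_def\<close>)
    also have "\<dots> = 0" using ij by (simp add: l_def)
    finally show ?thesis
      using comb[of l] ij by (intro affinely_dependent_tupleI[where l = l and j = i]) (auto simp: l_def)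
  next
    case inj: True
    define S where "S = z ` {..d}"
    define v where "v = w - t *\<^sub>R unit_vec d"
    have weuc: "w \<in> euc d" and nw: "norm w = 1" using w by (auto simp: unit_sphereD)
    then have wd: "coord w d = 0" by (auto simp: euc_def)
    have vz: "v \<bullet> z i = 0" if "i \<le> d" for i
      using w(2)[OF that] xd[OF that] wd
      by (simp add: v_def z_def inner_diff_left inner_add_right inner_unit_vec inner_commute[of w])
    have vw: "v \<bullet> w = 1"
      using nw wd by (simp add: v_def inner_diff_left inner_unit_vec power2_norm_eq_inner[symmetric])
    then have v0: "v \<noteq> 0" by auto
    have "v \<notin> span S"
    proof
      assume "v \<in> span S"
      then have "v \<bullet> v = 0"
        using orthogonal_to_span[of v S v] vz by (auto simp: orthogonal_def S_def)
      then show False using v0 by simp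
    qed
    moreover have "v \<in> euc (Suc d)"
      using weuc euc_mono[of d "Suc d"] unit_vec_in_euc[of d "Suc d"] by (auto simp: v_def)
    moreover have "S \<subseteq> euc (Suc d)" using zeuc by (auto simp: S_def)
    moreover have fin: "finite S" and card: "card S = Suc d" using inj by (auto simp: S_def card_image)
    ultimately have "dependent S"
    proof -
      assume v: "v \<notin> span S" "v \<in> euc (Suc d)" "S \<subseteq> euc (Suc d)" and S: "finite S" "card S = Suc d"
      have vS: "v \<notin> S" using v(1) span_base by blast
      show ?thesis
      proof (rule ccontr)
        assume "independent S"
        then have "independent (insert v S)" using v(1) vS by (simp add: independent_insert)
        then have "card (insert v S) \<le> Suc d" using independent_in_euc[of "insert v S" "Suc d"] v by simp
        then show False using S vS by simp
      qed
    qed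
    then obtain u b where u: "b \<in> S" "u b \<noteq> 0" "(\<Sum>b\<in>S. u b *\<^sub>R b) = 0"
      unfolding dependent_finite[OF fin] by blast
    then obtain j where j: "j \<le> d" "b = z j" by (auto simp: S_def)
    have "(\<Sum>i\<le>d. u (z i) *\<^sub>R z i) = 0"
      using u(3) inj unfolding S_def by (subst (asm) sum.reindex) (auto simp: o_def)
    then show ?thesis
      using comb[of "\<lambda>i. u (z i)"] u j
      by (intro affinely_dependent_tupleI[where l = "\<lambda>i. u (z i)" and j = j]) auto
  qed
qed

lemma closed_affinely_dependent_tuple: "closed {x. affinely_dependent_tuple k x}"
proof -
  have c1: "continuous_on UNIV (\<lambda>q :: fseq \<times> (nat \<Rightarrow> fseq). snd q i)" for i
    by (rule continuous_on_product_then_coordinatewise) (intro continuous_intros)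
  define C where "C = {q :: fseq \<times> (nat \<Rightarrow> fseq). (\<Sum>i\<le>k. coord (fst q) i) = 0} \<inter> {q. (\<Sum>i\<le>k. coord (fst q) i *\<^sub>R snd q i) = 0}"
  have "closed C" unfolding C_def by (intro closed_Int closed_Collect_eq continuous_intros c1)
  then have "closed {x. \<exists>l\<in>unit_sphere (Suc k). (l, x) \<in> C}"
    by (rule closed_compact_projection_metric[OF compact_unit_sphere])
  then show ?thesis by (simp add: affinely_dependent_tuple_def C_def)
qed

lemma emeasure_uniform_sphere_hyperplane:
  assumes "w \<in> unit_sphere d" "2 \<le> d"
  shows "emeasure (uniform_sphere d) {x. x \<bullet> w = t} = 0"
proof -
  interpret prob_space "uniform_sphere d" by (rule prob_space_uniform_sphere)
  show ?thesis by (simp add: emeasure_eq_measure measure_uniform_sphere_hyperplane[OF assms])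
qed

lemma sets_PiM_affinely_dependent:
  "{x \<in> space (Pi\<^sub>M {..k} (\<lambda>_. uniform_sphere d)). (\<forall>i\<le>k. x i \<in> unit_sphere d) \<and> affinely_dependent_tuple k x}
    \<in> sets (Pi\<^sub>M {..k} (\<lambda>_. uniform_sphere d))" (is "?D \<in> sets ?N")
proof -
  define ext where "ext x = (\<lambda>i. if i \<le> k then x i else 0)" for x :: "nat \<Rightarrow> fseq"
  have "ext \<in> borel_measurable ?N"
    unfolding ext_def measurable_cong_sets[OF refl sets_PiM_equal_borel[symmetric]]
  proof (rule measurable_PiM_single')
    fix i :: nat
    show "(\<lambda>x. if i \<le> k then x i else 0) \<in> borel_measurable ?N"
      by (cases "i \<le> k") auto
  qed auto
  then have "ext -` {x. affinely_dependent_tuple k x} \<inter> space ?N \<in> sets ?N"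
    by (rule measurable_sets) (simp add: borel_closed closed_affinely_dependent_tuple)
  also have "ext -` {x. affinely_dependent_tuple k x} \<inter> space ?N = {x \<in> space ?N. affinely_dependent_tuple k x}"
  proof -
    have "affinely_dependent_tuple k (ext x) = affinely_dependent_tuple k x" for x
    proof -
      have "(\<Sum>i\<le>k. coord l i *\<^sub>R ext x i) = (\<Sum>i\<le>k. coord l i *\<^sub>R x i)" for l
        by (intro sum.cong) (auto simp: ext_def)
      then show ?thesis unfolding affinely_dependent_tuple_def by simp
    qed
    then show ?thesis by auto
  qed
  finally have "{x \<in> space ?N. affinely_dependent_tuple k x} \<in> sets ?N" .
  moreover have "{x \<in> space ?N. \<forall>i\<in>{..k}. x i \<in> unit_sphere d} \<in> sets ?N"
  proof (rule sets.sets_Collect_finite_All)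
    fix i assume "i \<in> {..k}"
    then have "(\<lambda>x. x i) -` unit_sphere d \<inter> space ?N \<in> sets ?N"
      by (intro measurable_sets[OF measurable_component_singleton]) auto
    also have "(\<lambda>x. x i) -` unit_sphere d \<inter> space ?N = {x \<in> space ?N. x i \<in> unit_sphere d}" by auto
    finally show "{x \<in> space ?N. x i \<in> unit_sphere d} \<in> sets ?N" .
  qed simp
  moreover have "?D = {x \<in> space ?N. \<forall>i\<in>{..k}. x i \<in> unit_sphere d} \<inter> {x \<in> space ?N. affinely_dependent_tuple k x}"
    by auto
  ultimately show ?thesis by auto
qed

text \<open>Fubini over the last point: if the first \<open>k + 1 \<le> d\<close> points are
  affinely independent, a dependent extension puts the new point into their affine hull, hence into
  a hyperplane, which is a null set.\<close>

lemma emeasure_PiM_affinely_dependent: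
  assumes d: "2 \<le> d" and "k \<le> d"
  shows "emeasure (Pi\<^sub>M {..k} (\<lambda>_. uniform_sphere d))
    {x \<in> space (Pi\<^sub>M {..k} (\<lambda>_. uniform_sphere d)). (\<forall>i\<le>k. x i \<in> unit_sphere d) \<and> affinely_dependent_tuple k x} = 0"
  using assms(2)
proof (induction k)
  case 0
  have "\<not> affinely_dependent_tuple 0 x" for x
  proof
    assume "affinely_dependent_tuple 0 x"
    then obtain l where l: "l \<in> unit_sphere 1" "coord l 0 = 0" by (auto simp: affinely_dependent_tuple_def)
    then have "coord l i = 0" for i by (cases i) (auto simp: unit_sphere_def euc_def)
    then have "l = 0" by (intro fseq_eqI) simp
    then show False using l by (simp add: unit_sphere_def)
  qed
  then show ?case by simp
next
  case (Suc k)
  interpret U: prob_space "uniform_sphere d" by (rule prob_space_uniform_sphere)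
  interpret P: product_sigma_finite "\<lambda>_::nat. uniform_sphere d" by standard
  let ?N = "\<lambda>k. Pi\<^sub>M {..k} (\<lambda>_::nat. uniform_sphere d)"
  let ?D = "\<lambda>k. {x \<in> space (?N k). (\<forall>i\<le>k. x i \<in> unit_sphere d) \<and> affinely_dependent_tuple k x}"
  have Dsets: "?D k \<in> sets (?N k)" for k by (rule sets_PiM_affinely_dependent)
  have ins: "{..Suc k} = insert (Suc k) {..k}" by auto
  have "emeasure (?N (Suc k)) (?D (Suc k)) = (\<integral>\<^sup>+ x. indicator (?D (Suc k)) x \<partial>?N (Suc k))"
    by (rule nn_integral_indicator[symmetric, OF Dsets])
  also have "\<dots> = (\<integral>\<^sup>+ x. (\<integral>\<^sup>+ y. indicator (?D (Suc k)) (x(Suc k := y)) \<partial>uniform_sphere d) \<partial>?N k)"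
    unfolding ins
    by (rule P.product_nn_integral_insert[OF finite_atMost _ borel_measurable_indicator[OF Dsets[of "Suc k", unfolded ins]]]) simp
  also have "\<dots> = (\<integral>\<^sup>+ x. 0 \<partial>?N k)"
  proof (rule nn_integral_cong_AE)
    have "AE x in ?N k. x \<notin> ?D k"
      by (rule AE_not_in[OF null_setsI[OF Suc.IH[OF Suc_leD[OF Suc.prems]] Dsets]])
    with AE_space[of "?N k"] show "AE x in ?N k. (\<integral>\<^sup>+ y. indicator (?D (Suc k)) (x(Suc k := y)) \<partial>uniform_sphere d) = 0"
    proof (eventually_elim)
      fix x assume xsp: "x \<in> space (?N k)" and xD: "x \<notin> ?D k"
      have "\<exists>w\<in>unit_sphere d. \<exists>t. \<forall>y. x(Suc k := y) \<in> ?D (Suc k) \<longrightarrow> y \<bullet> w = t"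
      proof (cases "\<exists>y. x(Suc k := y) \<in> ?D (Suc k)")
        case False
        moreover have "unit_vec 0 \<in> unit_sphere d" using unit_vec_in_unit_sphere[of 0 d] d by simp
        ultimately show ?thesis by blast
      next
        case True
        then obtain y0 where y0: "x(Suc k := y0) \<in> ?D (Suc k)" by blast
        have xS: "x i \<in> unit_sphere d" if "i \<le> k" for i
        proof -
          have "\<forall>i\<le>Suc k. (x(Suc k := y0)) i \<in> unit_sphere d"
            using y0 unfolding mem_Collect_eq by (elim conjE)
          then have "(x(Suc k := y0)) i \<in> unit_sphere d" using le_SucI[OF that] by metis
          moreover have "i \<noteq> Suc k" using that by simp
          ultimately show ?thesis by simp
        qed
        \<comment> \<open>The at most \<open>k < d\<close> difference vectors leave a unit normal
          \<open>w\<close>, on which all previous points agree.\<close>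
        define B where "B = (\<lambda>i. x i - x 0) ` {1..k}"
        have "card B \<le> k" unfolding B_def using card_image_le[of "{1..k}" "\<lambda>i. x i - x 0"] by simp
        then have "card B < d" using Suc.prems by simp
        moreover have "B \<subseteq> euc d" using xS by (auto simp: B_def unit_sphereD)
        ultimately obtain w where w: "w \<in> unit_sphere d" "\<forall>b\<in>B. w \<bullet> b = 0"
          using unit_orthogonal_to_few[of B d] by (auto simp: B_def)
        have xw: "x i \<bullet> w = x 0 \<bullet> w" if "i \<le> k" for i
        proof (cases "i = 0")
          case False
          then have "w \<bullet> (x i - x 0) = 0" using w(2) that by (auto simp: B_def)
          then show ?thesis by (simp add: inner_diff_right inner_commute[of w])
        qed simp
        have "y \<bullet> w = x 0 \<bullet> w" if y: "x(Suc k := y) \<in> ?D (Suc k)" for y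
        proof -
          have "affinely_dependent_tuple (Suc k) (x(Suc k := y))"
            using y unfolding mem_Collect_eq by (elim conjE)
          then obtain l where l: "l \<in> unit_sphere (Suc (Suc k))" "(\<Sum>i\<le>Suc k. coord l i) = 0"
            "(\<Sum>i\<le>Suc k. coord l i *\<^sub>R (x(Suc k := y)) i) = 0"
            unfolding affinely_dependent_tuple_def by blast
          have s1: "(\<Sum>i\<le>k. coord l i) + coord l (Suc k) = 0" using l(2) by simp
          have "(\<Sum>i\<le>k. coord l i *\<^sub>R (x(Suc k := y)) i) = (\<Sum>i\<le>k. coord l i *\<^sub>R x i)"
            by (intro sum.cong) auto
          then have s2: "(\<Sum>i\<le>k. coord l i *\<^sub>R x i) + coord l (Suc k) *\<^sub>R y = 0" using l(3) by simp
          \<comment> \<open>Without the last point the relation would already be a dependence of the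
            earlier points.\<close>
          have lk: "coord l (Suc k) \<noteq> 0"
          proof
            assume 0: "coord l (Suc k) = 0"
            have "coord l i = 0" if "i \<ge> Suc k" for i
              using l(1) 0 that by (cases "i = Suc k") (auto simp: unit_sphere_def euc_def)
            then have "l \<in> unit_sphere (Suc k)" using l(1) by (auto simp: unit_sphere_def euc_def)
            then have "affinely_dependent_tuple k x"
              unfolding affinely_dependent_tuple_def using s1 s2 0 by auto
            then have "x \<in> ?D k" using xS xsp by (intro CollectI conjI allI impI)
            then show False using xD by (rule notE[rotated])
          qed
          have "(\<Sum>i\<le>k. coord l i *\<^sub>R x i) \<bullet> w = (\<Sum>i\<le>k. coord l i * (x 0 \<bullet> w))"
            unfolding inner_sum_left
          proof (intro sum.cong refl)
            fix i assume "i \<in> {..k}"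
            then have "x i \<bullet> w = x 0 \<bullet> w" by (intro xw) simp
            then show "coord l i *\<^sub>R x i \<bullet> w = coord l i * (x 0 \<bullet> w)" by (simp only: inner_scaleR_left)
          qed
          also have "\<dots> = (\<Sum>i\<le>k. coord l i) * (x 0 \<bullet> w)" by (simp add: sum_distrib_right)
          also have "\<dots> = - coord l (Suc k) * (x 0 \<bullet> w)" by (simp only: s1[THEN eq_neg_iff_add_eq_0[THEN iffD2]])
          finally have "(\<Sum>i\<le>k. coord l i *\<^sub>R x i) \<bullet> w = - coord l (Suc k) * (x 0 \<bullet> w)" .
          moreover have "(\<Sum>i\<le>k. coord l i *\<^sub>R x i) \<bullet> w = - coord l (Suc k) * (y \<bullet> w)"
            using arg_cong[OF s2, of "\<lambda>z. z \<bullet> w"] by (simp add: inner_add_left)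
          ultimately show ?thesis using lk by simp
        qed
        then show ?thesis using w(1) by blast
      qed
      then obtain w t where w: "w \<in> unit_sphere d" "\<And>y. x(Suc k := y) \<in> ?D (Suc k) \<Longrightarrow> y \<bullet> w = t" by blast
      have "(\<integral>\<^sup>+ y. indicator (?D (Suc k)) (x(Suc k := y)) \<partial>uniform_sphere d)
          \<le> (\<integral>\<^sup>+ y. indicator {y. y \<bullet> w = t} y \<partial>uniform_sphere d)"
        by (intro nn_integral_mono) (use w(2) in \<open>auto simp: indicator_def\<close>)
      also have "\<dots> = 0" using emeasure_uniform_sphere_hyperplane[OF w(1) d] by simp
      finally show "(\<integral>\<^sup>+ y. indicator (?D (Suc k)) (x(Suc k := y)) \<partial>uniform_sphere d) = 0" by simp
    qed
  qed
  finally show ?case by simp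
qed

section \<open>Almost sure properties of a sample\<close>

lemma uniform_sphere_sampleD:
  assumes "uniform_sphere_sample M n d X"
  shows "prob_space M" "i < n \<Longrightarrow> X i \<in> borel_measurable M"
    "i < n \<Longrightarrow> A \<in> sets borel \<Longrightarrow> measure M {\<omega> \<in> space M. X i \<omega> \<in> A} = measure (uniform_sphere d) A"
proof -
  show p: "prob_space M" using assms by (simp add: uniform_sphere_sample_def)
  interpret prob_space M by (rule p)
  show m: "X i \<in> borel_measurable M" if "i < n" for i
    using assms that by (auto simp: uniform_sphere_sample_def indep_vars_def)
  assume i: "i < n" and A: "A \<in> sets borel"
  have "measure (uniform_sphere d) A = measure (distr M borel (X i)) A"
    using assms i by (simp add: uniform_sphere_sample_def)
  also have "\<dots> = measure M (X i -` A \<inter> space M)" by (rule measure_distr[OF m[OF i] A])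
  also have "X i -` A \<inter> space M = {\<omega> \<in> space M. X i \<omega> \<in> A}" by auto
  finally show "measure M {\<omega> \<in> space M. X i \<omega> \<in> A} = measure (uniform_sphere d) A" by simp
qed

lemma sample_AE_unit_sphere:
  assumes S: "uniform_sphere_sample M n d X" and d: "0 < d"
  shows "AE \<omega> in M. \<forall>i<n. X i \<omega> \<in> unit_sphere d"
proof -
  interpret prob_space M by (rule uniform_sphere_sampleD[OF S])
  have "AE \<omega> in M. X i \<omega> \<in> unit_sphere d" if i: "i < n" for i
  proof -
    have m: "{\<omega> \<in> space M. X i \<omega> \<in> - unit_sphere d} \<in> sets M"
      using measurable_sets[OF uniform_sphere_sampleD(2)[OF S i], of "- unit_sphere d"]
      by (simp add: vimage_def Int_def conj_commute)
    have "measure M {\<omega> \<in> space M. X i \<omega> \<in> - unit_sphere d} = 0"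
      using uniform_sphere_sampleD(3)[OF S i, of "- unit_sphere d"] measure_uniform_sphere_unit_sphere[OF d] by simp
    then have "{\<omega> \<in> space M. X i \<omega> \<in> - unit_sphere d} \<in> null_sets M"
      using m by (simp add: null_sets_def emeasure_eq_measure)
    then show ?thesis by (rule AE_I') auto
  qed
  then have "AE \<omega> in M. \<forall>i\<in>{..<n}. X i \<omega> \<in> unit_sphere d" by (intro AE_finite_allI) auto
  then show ?thesis by (rule eventually_mono) auto
qed

text \<open>The first \<open>d + 1\<close> points suffice. By independence their joint law is the
  product measure, and lying in a common hyperplane would make them affinely dependent.\<close>

lemma sample_AE_spread:
  assumes S: "uniform_sphere_sample M n d X" and d: "2 \<le> d" "d < n"
  shows "AE \<omega> in M. spread d n (\<lambda>i. X i \<omega>)"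
proof -
  interpret prob_space M by (rule uniform_sphere_sampleD[OF S])
  let ?U = "\<lambda>_::nat. uniform_sphere d"
  let ?r = "\<lambda>\<omega>. \<lambda>i\<in>{..d}. X i \<omega>"
  have sub: "{..d} \<subseteq> {..<n}" using d by auto
  have m: "X i \<in> borel_measurable M" if "i \<in> {..d}" for i
    using uniform_sphere_sampleD(2)[OF S, of i] that d by simp
  have "indep_vars (\<lambda>_. borel) X {..d}"
    using S sub by (auto simp: uniform_sphere_sample_def intro: indep_vars_subset)
  then have "distr M (\<Pi>\<^sub>M i\<in>{..d}. borel) ?r = (\<Pi>\<^sub>M i\<in>{..d}. distr M borel (X i))"
    using indep_vars_iff_distr_eq_PiM'[of "{..d}" X "\<lambda>_. borel"] m by auto
  also have "\<dots> = Pi\<^sub>M {..d} ?U"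
    by (intro PiM_cong refl) (use S d in \<open>auto simp: uniform_sphere_sample_def\<close>)
  finally have eq: "distr M (\<Pi>\<^sub>M i\<in>{..d}. borel) ?r = Pi\<^sub>M {..d} ?U" .
  have mr: "?r \<in> measurable M (\<Pi>\<^sub>M i\<in>{..d}. borel)"
    by (intro measurable_restrict m)
  have "AE x in Pi\<^sub>M {..d} ?U. \<not> ((\<forall>i\<le>d. x i \<in> unit_sphere d) \<and> affinely_dependent_tuple d x)"
    using AE_not_in[OF null_setsI[OF emeasure_PiM_affinely_dependent[OF d(1) order_refl] sets_PiM_affinely_dependent]] AE_space
    by eventually_elim blast
  then have "AE \<omega> in M. \<not> ((\<forall>i\<le>d. ?r \<omega> i \<in> unit_sphere d) \<and> affinely_dependent_tuple d (?r \<omega>))"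
    unfolding eq[symmetric] by (rule AE_distrD[OF mr])
  moreover have "AE \<omega> in M. \<forall>i<n. X i \<omega> \<in> unit_sphere d" using sample_AE_unit_sphere[OF S] d by simp
  ultimately show ?thesis
  proof eventually_elim
    fix \<omega> assume nd: "\<not> ((\<forall>i\<le>d. ?r \<omega> i \<in> unit_sphere d) \<and> affinely_dependent_tuple d (?r \<omega>))"
      and X: "\<forall>i<n. X i \<omega> \<in> unit_sphere d"
    have rS: "?r \<omega> i \<in> unit_sphere d" if "i \<le> d" for i using X that d by simp
    show "spread d n (\<lambda>i. X i \<omega>)"
    proof (rule ccontr)
      assume "\<not> ?thesis"
      then obtain w where w: "w \<in> unit_sphere d" "\<And>i j. i < n \<Longrightarrow> j < n \<Longrightarrow> X i \<omega> \<bullet> w = X j \<omega> \<bullet> w"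
        unfolding spread_def by blast
      have "affinely_dependent_tuple d (?r \<omega>)"
      proof (rule affinely_dependent_tuple_hyperplane[OF _ w(1)])
        show "?r \<omega> i \<in> euc d" if "i \<le> d" for i using rS[OF that] by (rule unit_sphereD)
        show "?r \<omega> i \<bullet> w = X 0 \<omega> \<bullet> w" if "i \<le> d" for i using w(2)[of i 0] that d by simp
      qed
      then show False using nd rS by blast
    qed
  qed
qed

subsection \<open>Exceptional events\<close>

text \<open>Divide space into cubes of side \<open>1 / K\<close> and choose one point of the sphere
  from each cube that meets it. Each coordinate has at most \<open>2 * K + 1\<close> integer parts,
  and two points in one cube differ by at most \<open>1 / K\<close> in each coordinate.\<close>

lemma unit_sphere_net:
  assumes K: "0 < K"
  shows "\<exists>T. finite T \<and> T \<subseteq> unit_sphere d \<and> card T \<le> (2 * K + 1) ^ d \<and>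
    (\<forall>u\<in>unit_sphere d. \<exists>v\<in>T. norm (u - v) \<le> sqrt (real d) / real K)"
proof -
  define g where "g u = (\<lambda>j\<in>{..<d}. \<lfloor>real K * coord u j\<rfloor>)" for u
  have gK: "g u \<in> PiE {..<d} (\<lambda>_. {- int K..int K})" if "u \<in> unit_sphere d" for u
  proof -
    have "\<lfloor>real K * coord u j\<rfloor> \<in> {- int K..int K}" for j
    proof -
      have "\<bar>coord u j\<bar> \<le> 1" using abs_coord_le_norm[of u j] that by (simp add: unit_sphereD)
      then have "\<bar>real K * coord u j\<bar> \<le> real K" using K by (simp add: abs_mult mult_left_le)
      then have "- real K \<le> real K * coord u j" "real K * coord u j \<le> real K" by (auto simp: abs_le_iff)
      then show ?thesis by (simp add: le_floor_iff floor_le_iff)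
    qed
    then show ?thesis by (auto simp: g_def)
  qed
  define T where "T = (\<lambda>c. SOME u. u \<in> unit_sphere d \<and> g u = c) ` (g ` unit_sphere d)"
  have sel: "(SOME u. u \<in> unit_sphere d \<and> g u = g u') \<in> unit_sphere d \<and> g (SOME u. u \<in> unit_sphere d \<and> g u = g u') = g u'"
    if "u' \<in> unit_sphere d" for u' by (rule someI) (use that in simp)
  have sub: "g ` unit_sphere d \<subseteq> PiE {..<d} (\<lambda>_. {- int K..int K})" using gK by blast
  have finP: "finite (PiE {..<d} (\<lambda>_. {- int K..int K}))" by (intro finite_PiE) auto
  have fin: "finite (g ` unit_sphere d)" by (rule finite_subset[OF sub finP])
  have "card T \<le> card (g ` unit_sphere d)" unfolding T_def by (rule card_image_le[OF fin])
  also have "\<dots> \<le> card (PiE {..<d} (\<lambda>_. {- int K..int K}))" by (rule card_mono[OF finP sub])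
  also have "\<dots> = (2 * K + 1) ^ d"
  proof -
    have "nat (2 * int K + 1) = 2 * K + 1" by simp
    then show ?thesis by (simp add: card_PiE)
  qed
  finally have card: "card T \<le> (2 * K + 1) ^ d" .
  have "\<exists>v\<in>T. norm (u - v) \<le> sqrt (real d) / real K" if u: "u \<in> unit_sphere d" for u
  proof -
    define v where "v = (SOME v. v \<in> unit_sphere d \<and> g v = g u)"
    have v: "v \<in> unit_sphere d" "g v = g u" using sel[OF u] by (auto simp: v_def)
    have "v \<in> T" using u by (auto simp: T_def v_def)
    have cj: "(coord (u - v) j)\<^sup>2 \<le> (1 / real K)\<^sup>2" if j: "j < d" for j
    proof -
      have "\<lfloor>real K * coord u j\<rfloor> = \<lfloor>real K * coord v j\<rfloor>"
        using fun_cong[OF v(2), of j] j by (simp add: g_def)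
      then have "\<bar>real K * coord u j - real K * coord v j\<bar> < 1" by linarith
      then have "\<bar>real K * coord (u - v) j\<bar> < 1" by (simp add: right_diff_distrib)
      then have "real K * \<bar>coord (u - v) j\<bar> < 1" by (simp only: abs_mult abs_of_nat)
      then have "\<bar>coord (u - v) j\<bar> \<le> 1 / real K"
        using K by (simp add: pos_le_divide_eq mult.commute del: coord_simps)
      then have "\<bar>coord (u - v) j\<bar> \<le> \<bar>1 / real K\<bar>" by simp
      then show ?thesis by (simp only: abs_le_square_iff)
    qed
    have "u - v \<in> euc d" using u v by (simp add: unit_sphereD)
    then have "(norm (u - v))\<^sup>2 = (\<Sum>j<d. (coord (u - v) j)\<^sup>2)"
      unfolding power2_norm_eq_inner
      by (subst inner_fseq_superset[of "{..<d}"]) (auto simp: euc_def power2_eq_square)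
    also have "\<dots> \<le> (\<Sum>j<d. (1 / real K)\<^sup>2)" by (intro sum_mono cj) simp
    also have "\<dots> = (sqrt (real d) / real K)\<^sup>2" by (simp add: power_divide)
    finally have "norm (u - v) \<le> sqrt (real d) / real K" by (rule power2_le_imp_le) simp
    then show ?thesis using \<open>v \<in> T\<close> by blast
  qed
  moreover have "T \<subseteq> unit_sphere d" using sel by (auto simp: T_def)
  moreover have "finite T" using fin by (simp add: T_def)
  ultimately show ?thesis using card by blast
qed

text \<open>The support function of the polytope at \<open>u\<close> is \<open>max\<^sub>i X\<^sub>i \<bullet> u\<close>; the two predicates bound its minimum
  over the sphere off an event of probability at most \<open>p\<close>.\<close>

definition support_ge_outside ::
    "'w measure \<Rightarrow> nat \<Rightarrow> nat \<Rightarrow> (nat \<Rightarrow> 'w \<Rightarrow> fseq) \<Rightarrow> real \<Rightarrow> real \<Rightarrow> bool"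
  where "support_ge_outside M n d X L p \<longleftrightarrow> (\<exists>B\<in>sets M. measure M B \<le> p \<and>
    (AE \<omega> in M. \<omega> \<notin> B \<longrightarrow> (\<forall>u\<in>unit_sphere d. \<exists>i<n. L \<le> X i \<omega> \<bullet> u)))"

definition support_le_outside ::
    "'w measure \<Rightarrow> nat \<Rightarrow> nat \<Rightarrow> (nat \<Rightarrow> 'w \<Rightarrow> fseq) \<Rightarrow> real \<Rightarrow> real \<Rightarrow> bool"
  where "support_le_outside M n d X U p \<longleftrightarrow> (\<exists>B\<in>sets M. measure M B \<le> p \<and>
    (AE \<omega> in M. \<omega> \<notin> B \<longrightarrow> (\<exists>u\<in>unit_sphere d. \<forall>i<n. X i \<omega> \<bullet> u \<le> U)))"

text \<open>By independence a fixed cap is missed by all points with probability at most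
  \<open>q ^ n\<close>. If a point lies in the cap around \<open>v\<close>, its height in a nearby
  direction \<open>u\<close> drops by at most \<open>norm (u - v)\<close>, since the point is a unit
  vector.\<close>

lemma support_ge_outside_net:
  assumes S: "uniform_sphere_sample M n d X" and d: "0 < d" and n: "0 < n" and K: "0 < K"
    and q: "\<And>v. v \<in> unit_sphere d \<Longrightarrow> measure (uniform_sphere d) (- cap v h) \<le> q"
    and L: "L \<le> h - sqrt (real d) / real K"
  shows "support_ge_outside M n d X L ((2 * real K + 1) ^ d * q ^ n)"
proof -
  interpret prob_space M by (rule uniform_sphere_sampleD[OF S])
  obtain T where T: "finite T" "T \<subseteq> unit_sphere d" "card T \<le> (2 * K + 1) ^ d"
    "\<And>u. u \<in> unit_sphere d \<Longrightarrow> \<exists>v\<in>T. norm (u - v) \<le> sqrt (real d) / real K"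
    using unit_sphere_net[OF K, of d] by blast
  define B where "B v = (\<Inter>i\<in>{..<n}. X i -` (- cap v h) \<inter> space M)" for v
  have Bm: "B v \<in> sets M" for v
    unfolding B_def using n uniform_sphere_sampleD(2)[OF S]
    by (intro sets.finite_INT) (auto intro: measurable_sets)
  have pB: "prob (B v) \<le> q ^ n" if v: "v \<in> unit_sphere d" for v
  proof -
    have "prob (B v) = (\<Prod>i\<in>{..<n}. prob (X i -` (- cap v h) \<inter> space M))"
      unfolding B_def
      by (rule indep_varsD[where M' = "\<lambda>_. borel" and I = "{..<n}"]) (use S n in \<open>auto simp: uniform_sphere_sample_def\<close>)
    also have "\<dots> = (\<Prod>i\<in>{..<n}. measure (uniform_sphere d) (- cap v h))"
    proof (rule prod.cong[OF refl])
      fix i assume "i \<in> {..<n}"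
      moreover have "X i -` (- cap v h) \<inter> space M = {\<omega> \<in> space M. X i \<omega> \<in> - cap v h}" by auto
      ultimately show "prob (X i -` (- cap v h) \<inter> space M) = measure (uniform_sphere d) (- cap v h)"
        using uniform_sphere_sampleD(3)[OF S, of i "- cap v h"] by simp
    qed
    also have "\<dots> \<le> q ^ n" using q[OF v] by (simp add: power_mono)
    finally show ?thesis .
  qed
  have q0: "0 \<le> q" using q[OF unit_vec_in_unit_sphere[OF d]] measure_nonneg order_trans by blast
  have "prob (\<Union>v\<in>T. B v) \<le> (\<Sum>v\<in>T. prob (B v))"
    by (rule measure_UNION_le[OF T(1)]) (use Bm in auto)
  also have "\<dots> \<le> (\<Sum>v\<in>T. q ^ n)" using T(2) by (intro sum_mono pB) auto
  also have "\<dots> = real (card T) * q ^ n" by simp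
  also have "\<dots> \<le> real ((2 * K + 1) ^ d) * q ^ n"
    using T(3) q0 by (intro mult_right_mono) (auto simp del: of_nat_power)
  finally have p: "prob (\<Union>v\<in>T. B v) \<le> (2 * real K + 1) ^ d * q ^ n" by (simp add: add.commute)
  have "AE \<omega> in M. \<omega> \<notin> (\<Union>v\<in>T. B v) \<longrightarrow> (\<forall>u\<in>unit_sphere d. \<exists>i<n. L \<le> X i \<omega> \<bullet> u)"
    using sample_AE_unit_sphere[OF S d] AE_space[of M]
  proof eventually_elim
    fix \<omega> assume X: "\<forall>i<n. X i \<omega> \<in> unit_sphere d" and sp: "\<omega> \<in> space M"
    show "\<omega> \<notin> (\<Union>v\<in>T. B v) \<longrightarrow> (\<forall>u\<in>unit_sphere d. \<exists>i<n. L \<le> X i \<omega> \<bullet> u)"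
    proof (intro impI ballI)
      fix u assume nB: "\<omega> \<notin> (\<Union>v\<in>T. B v)" and u: "u \<in> unit_sphere d"
      obtain v where v: "v \<in> T" "norm (u - v) \<le> sqrt (real d) / real K" using T(4)[OF u] by blast
      then have "\<omega> \<notin> B v" using nB by blast
      then obtain i where "i \<in> {..<n}" "\<omega> \<notin> X i -` (- cap v h) \<inter> space M" unfolding B_def by blast
      then have i: "i < n" "h \<le> X i \<omega> \<bullet> v" using sp by (auto simp: cap_def)
      have "X i \<omega> \<bullet> v - X i \<omega> \<bullet> u \<le> norm (X i \<omega>) * norm (v - u)"
        using norm_cauchy_schwarz[of "X i \<omega>" "v - u"] by (simp add: inner_diff_right)
      also have "\<dots> \<le> sqrt (real d) / real K"
      proof -
        have "norm (X i \<omega>) = 1" using X i(1) by (intro unit_sphereD) blast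
        then show ?thesis using v(2) by (simp add: norm_minus_commute)
      qed
      finally show "\<exists>i<n. L \<le> X i \<omega> \<bullet> u" using i L by (intro exI[of _ i]) auto
    qed
  qed
  moreover have "(\<Union>v\<in>T. B v) \<in> sets M" using T(1) Bm by auto
  ultimately show ?thesis unfolding support_ge_outside_def using p by blast
qed

lemma support_le_outside_direction:
  assumes S: "uniform_sphere_sample M n d X" and u: "u \<in> unit_sphere d"
  shows "support_le_outside M n d X U (real n * measure (uniform_sphere d) (cap u U))"
proof -
  interpret prob_space M by (rule uniform_sphere_sampleD[OF S])
  define B where "B = (\<Union>i\<in>{..<n}. {\<omega> \<in> space M. X i \<omega> \<in> cap u U})"
  have m: "{\<omega> \<in> space M. X i \<omega> \<in> cap u U} \<in> sets M" if "i < n" for i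
    using measurable_sets[OF uniform_sphere_sampleD(2)[OF S that], of "cap u U"]
    by (simp add: vimage_def Int_def conj_commute)
  have "prob B \<le> (\<Sum>i<n. prob {\<omega> \<in> space M. X i \<omega> \<in> cap u U})"
    unfolding B_def by (rule measure_UNION_le) (use m in auto)
  also have "\<dots> = real n * measure (uniform_sphere d) (cap u U)"
    using uniform_sphere_sampleD(3)[OF S, of _ "cap u U"] by simp
  finally have "prob B \<le> real n * measure (uniform_sphere d) (cap u U)" .
  moreover have "B \<in> sets M" using m by (auto simp: B_def)
  moreover have "AE \<omega> in M. \<omega> \<notin> B \<longrightarrow> (\<exists>u\<in>unit_sphere d. \<forall>i<n. X i \<omega> \<bullet> u \<le> U)"
    using AE_space[of M]
  proof eventually_elim
    fix \<omega> assume "\<omega> \<in> space M"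
    then show "\<omega> \<notin> B \<longrightarrow> (\<exists>u\<in>unit_sphere d. \<forall>i<n. X i \<omega> \<bullet> u \<le> U)"
      using u by (intro impI bexI[of _ u]) (force simp: B_def cap_def not_le)+
  qed
  ultimately show ?thesis unfolding support_le_outside_def by blast
qed

section \<open>From exceptional events to convergence in probability\<close>

lemma tendsto_in_probI:
  assumes Y: "\<forall>\<^sub>F n in sequentially. Y n \<in> borel_measurable (M n)"
    and P: "\<forall>\<^sub>F n in sequentially. prob_space (M n)"
    and bound: "\<And>\<epsilon>. 0 < \<epsilon> \<Longrightarrow> \<exists>b. b \<longlonglongrightarrow> 0 \<and> (\<forall>\<^sub>F n in sequentially. \<exists>B\<in>sets (M n). measure (M n) B \<le> b n \<and>
      (AE \<omega> in M n. \<omega> \<notin> B \<longrightarrow> \<bar>Y n \<omega> - c\<bar> \<le> \<epsilon>))"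
  shows "tendsto_in_prob M Y c"
  unfolding tendsto_in_prob_def
proof (intro conjI Y allI impI)
  fix \<epsilon> :: real assume "0 < \<epsilon>"
  then obtain b where b: "b \<longlonglongrightarrow> 0" "\<forall>\<^sub>F n in sequentially. \<exists>B\<in>sets (M n). measure (M n) B \<le> b n \<and>
      (AE \<omega> in M n. \<omega> \<notin> B \<longrightarrow> \<bar>Y n \<omega> - c\<bar> \<le> \<epsilon>)" using bound by blast
  have "\<forall>\<^sub>F n in sequentially. measure (M n) {\<omega> \<in> space (M n). \<bar>Y n \<omega> - c\<bar> > \<epsilon>} \<le> b n"
    using b(2) P
  proof eventually_elim
    fix n assume "\<exists>B\<in>sets (M n). measure (M n) B \<le> b n \<and> (AE \<omega> in M n. \<omega> \<notin> B \<longrightarrow> \<bar>Y n \<omega> - c\<bar> \<le> \<epsilon>)"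
      and p: "prob_space (M n)"
    then obtain B where B: "B \<in> sets (M n)" "measure (M n) B \<le> b n"
      "AE \<omega> in M n. \<omega> \<notin> B \<longrightarrow> \<bar>Y n \<omega> - c\<bar> \<le> \<epsilon>" by blast
    interpret prob_space "M n" by (rule p)
    have "measure (M n) {\<omega> \<in> space (M n). \<bar>Y n \<omega> - c\<bar> > \<epsilon>} \<le> measure (M n) B"
      by (rule finite_measure_mono_AE[OF _ B(1)]) (use B(3) in \<open>eventually_elim, auto\<close>)
    then show "measure (M n) {\<omega> \<in> space (M n). \<bar>Y n \<omega> - c\<bar> > \<epsilon>} \<le> b n" using B(2) by simp
  qed
  then show "(\<lambda>n. measure (M n) {\<omega> \<in> space (M n). \<bar>Y n \<omega> - c\<bar> > \<epsilon>}) \<longlonglongrightarrow> 0"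
    by (intro tendsto_sandwich[OF _ _ tendsto_const b(1)]) auto
qed

locale random_sphere_polytopes =
  fixes d :: "nat \<Rightarrow> nat" and N :: nat
    and M :: "nat \<Rightarrow> 'w measure" and X :: "nat \<Rightarrow> nat \<Rightarrow> 'w \<Rightarrow> fseq"
  assumes d_range: "\<And>n. n \<ge> N \<Longrightarrow> d n \<in> {2..n - 1}"
    and sample: "\<And>n. n \<ge> N \<Longrightarrow> uniform_sphere_sample (M n) n (d n) (X n)"
begin

abbreviation dH :: "nat \<Rightarrow> 'w \<Rightarrow> real"
  where "dH n \<omega> \<equiv> hausdorff_dist (rand_polytope n (X n) \<omega>) (unit_ball (d n))"

abbreviation Hmin :: "nat \<Rightarrow> 'w \<Rightarrow> real"
  where "Hmin n \<omega> \<equiv> min_facet_height (d n) (rand_polytope n (X n) \<omega>)"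

lemma d_bounds: "n \<ge> N \<Longrightarrow> 2 \<le> d n" "n \<ge> N \<Longrightarrow> d n < n" "n \<ge> N \<Longrightarrow> 0 < d n" "n \<ge> N \<Longrightarrow> 0 < n"
  using d_range[of n] by auto

lemma prob_space_M: "n \<ge> N \<Longrightarrow> prob_space (M n)"
  using sample by (rule uniform_sphere_sampleD(1))

lemma measurable_dH: "n \<ge> N \<Longrightarrow> dH n \<in> borel_measurable (M n)"
  using uniform_sphere_sampleD(2)[OF sample] d_bounds by (intro borel_measurable_hausdorff_dist_rand_polytope) auto

lemma measurable_Hmin: "n \<ge> N \<Longrightarrow> Hmin n \<in> borel_measurable (M n)"
  using uniform_sphere_sampleD(2)[OF sample] d_bounds by (intro borel_measurable_min_facet_height_rand_polytope) auto

lemma AE_general_position: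
  assumes n: "n \<ge> N"
  shows "AE \<omega> in M n. (\<forall>i<n. X n i \<omega> \<in> unit_sphere (d n)) \<and> spread (d n) n (\<lambda>i. X n i \<omega>)"
  using sample_AE_unit_sphere[OF sample[OF n] d_bounds(3)[OF n]]
    sample_AE_spread[OF sample[OF n] d_bounds(1,2)[OF n]]
  by eventually_elim simp

lemma AE_dH_eq:
  assumes n: "n \<ge> N"
  shows "AE \<omega> in M n. 0 \<in> rand_polytope n (X n) \<omega> \<longrightarrow> dH n \<omega> = 1 - Hmin n \<omega>"
  using AE_general_position[OF n]
proof eventually_elim
  fix \<omega> assume g: "(\<forall>i<n. X n i \<omega> \<in> unit_sphere (d n)) \<and> spread (d n) n (\<lambda>i. X n i \<omega>)"
  show "0 \<in> rand_polytope n (X n) \<omega> \<longrightarrow> dH n \<omega> = 1 - Hmin n \<omega>"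
    unfolding rand_polytope_def
    using g hausdorff_dist_eq_min_facet_height[of n "\<lambda>i. X n i \<omega>" "d n"] d_bounds(3)[OF n]
      zero_in_convex_hull_support[of "\<lambda>i. X n i \<omega>" n] by blast
qed

lemma support_ge_consequences:
  assumes n: "n \<ge> N" and s: "support_ge_outside (M n) n (d n) (X n) L p"
  shows "\<exists>B\<in>sets (M n). measure (M n) B \<le> p \<and> (AE \<omega> in M n. \<omega> \<notin> B \<longrightarrow>
    dH n \<omega> \<le> 1 - L \<and> L \<le> Hmin n \<omega> \<and> (0 \<le> L \<longrightarrow> dH n \<omega> = 1 - Hmin n \<omega>))"
proof -
  obtain B where B: "B \<in> sets (M n)" "measure (M n) B \<le> p"
    "AE \<omega> in M n. \<omega> \<notin> B \<longrightarrow> (\<forall>u\<in>unit_sphere (d n). \<exists>i<n. L \<le> X n i \<omega> \<bullet> u)"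
    using s unfolding support_ge_outside_def by blast
  have "AE \<omega> in M n. \<omega> \<notin> B \<longrightarrow> dH n \<omega> \<le> 1 - L \<and> L \<le> Hmin n \<omega> \<and> (0 \<le> L \<longrightarrow> dH n \<omega> = 1 - Hmin n \<omega>)"
    using B(3) AE_general_position[OF n]
  proof eventually_elim
    fix \<omega> assume ge: "\<omega> \<notin> B \<longrightarrow> (\<forall>u\<in>unit_sphere (d n). \<exists>i<n. L \<le> X n i \<omega> \<bullet> u)"
      and g: "(\<forall>i<n. X n i \<omega> \<in> unit_sphere (d n)) \<and> spread (d n) n (\<lambda>i. X n i \<omega>)"
    let ?x = "\<lambda>i. X n i \<omega>"
    have xS: "\<And>i. i < n \<Longrightarrow> ?x i \<in> unit_sphere (d n)" and sp: "spread (d n) n ?x" using g by auto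
    show "\<omega> \<notin> B \<longrightarrow> dH n \<omega> \<le> 1 - L \<and> L \<le> Hmin n \<omega> \<and> (0 \<le> L \<longrightarrow> dH n \<omega> = 1 - Hmin n \<omega>)"
    proof (intro impI conjI)
      assume "\<omega> \<notin> B"
      then have L: "\<And>u. u \<in> unit_sphere (d n) \<Longrightarrow> \<exists>i<n. L \<le> ?x i \<bullet> u" using ge by blast
      show "dH n \<omega> \<le> 1 - L" unfolding rand_polytope_def
        by (rule hausdorff_dist_unit_ball_le[OF xS d_bounds(3,4)[OF n] L])
      show "L \<le> Hmin n \<omega>" unfolding rand_polytope_def
        by (rule min_facet_height_bounds(1)[OF xS sp d_bounds(3)[OF n] L])
      assume "0 \<le> L"
      then have L0: "\<And>u. u \<in> unit_sphere (d n) \<Longrightarrow> \<exists>i<n. 0 \<le> ?x i \<bullet> u" using L order_trans by blast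
      show "dH n \<omega> = 1 - Hmin n \<omega>" unfolding rand_polytope_def
        by (rule hausdorff_dist_eq_min_facet_height[OF xS sp d_bounds(3)[OF n] L0])
    qed
  qed
  then show ?thesis using B by blast
qed

lemma support_le_consequences:
  assumes n: "n \<ge> N" and s: "support_le_outside (M n) n (d n) (X n) U p"
  shows "\<exists>B\<in>sets (M n). measure (M n) B \<le> p \<and> (AE \<omega> in M n. \<omega> \<notin> B \<longrightarrow>
    1 - U \<le> dH n \<omega> \<and> (0 \<le> U \<longrightarrow> Hmin n \<omega> \<le> U))"
proof -
  obtain B where B: "B \<in> sets (M n)" "measure (M n) B \<le> p"
    "AE \<omega> in M n. \<omega> \<notin> B \<longrightarrow> (\<exists>u\<in>unit_sphere (d n). \<forall>i<n. X n i \<omega> \<bullet> u \<le> U)"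
    using s unfolding support_le_outside_def by blast
  have "AE \<omega> in M n. \<omega> \<notin> B \<longrightarrow> 1 - U \<le> dH n \<omega> \<and> (0 \<le> U \<longrightarrow> Hmin n \<omega> \<le> U)"
    using B(3) AE_general_position[OF n]
  proof eventually_elim
    fix \<omega> assume le: "\<omega> \<notin> B \<longrightarrow> (\<exists>u\<in>unit_sphere (d n). \<forall>i<n. X n i \<omega> \<bullet> u \<le> U)"
      and g: "(\<forall>i<n. X n i \<omega> \<in> unit_sphere (d n)) \<and> spread (d n) n (\<lambda>i. X n i \<omega>)"
    let ?x = "\<lambda>i. X n i \<omega>"
    have xS: "\<And>i. i < n \<Longrightarrow> ?x i \<in> unit_sphere (d n)" and sp: "spread (d n) n ?x" using g by auto
    show "\<omega> \<notin> B \<longrightarrow> 1 - U \<le> dH n \<omega> \<and> (0 \<le> U \<longrightarrow> Hmin n \<omega> \<le> U)"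
    proof (intro impI conjI)
      assume "\<omega> \<notin> B"
      then obtain u where u: "u \<in> unit_sphere (d n)" "\<And>i. i < n \<Longrightarrow> ?x i \<bullet> u \<le> U" using le by blast
      show "1 - U \<le> dH n \<omega>" unfolding rand_polytope_def
        by (rule hausdorff_dist_unit_ball_ge[OF xS d_bounds(4)[OF n] u])
      assume U: "0 \<le> U"
      show "Hmin n \<omega> \<le> U" unfolding rand_polytope_def
        by (rule min_facet_height_bounds(2)[OF xS sp d_bounds(3)[OF n] u U])
    qed
  qed
  then show ?thesis using B by blast
qed

lemma support_consequences:
  assumes n: "n \<ge> N" and ge: "support_ge_outside (M n) n (d n) (X n) L p"
    and le: "support_le_outside (M n) n (d n) (X n) U q" and U: "0 \<le> U"
  shows "\<exists>B\<in>sets (M n). measure (M n) B \<le> p + q \<and> (AE \<omega> in M n. \<omega> \<notin> B \<longrightarrow>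
    dH n \<omega> \<in> {1 - U..1 - L} \<and> Hmin n \<omega> \<in> {L..U})"
proof -
  obtain A where A: "A \<in> sets (M n)" "measure (M n) A \<le> p" "AE \<omega> in M n. \<omega> \<notin> A \<longrightarrow>
    dH n \<omega> \<le> 1 - L \<and> L \<le> Hmin n \<omega> \<and> (0 \<le> L \<longrightarrow> dH n \<omega> = 1 - Hmin n \<omega>)"
    using support_ge_consequences[OF n ge] by blast
  obtain B where B: "B \<in> sets (M n)" "measure (M n) B \<le> q" "AE \<omega> in M n. \<omega> \<notin> B \<longrightarrow>
    1 - U \<le> dH n \<omega> \<and> (0 \<le> U \<longrightarrow> Hmin n \<omega> \<le> U)"
    using support_le_consequences[OF n le] by blast
  have "measure (M n) (A \<union> B) \<le> p + q" using measure_Un_le[OF A(1) B(1)] A(2) B(2) by simp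
  moreover have "AE \<omega> in M n. \<omega> \<notin> A \<union> B \<longrightarrow> dH n \<omega> \<in> {1 - U..1 - L} \<and> Hmin n \<omega> \<in> {L..U}"
    using A(3) B(3) by eventually_elim (use U in auto)
  ultimately show ?thesis using A(1) B(1) by blast
qed

definition support_ge_whp :: "(nat \<Rightarrow> real) \<Rightarrow> bool"
  where "support_ge_whp L \<longleftrightarrow> (\<exists>b. b \<longlonglongrightarrow> 0 \<and> (\<forall>\<^sub>F n in sequentially. support_ge_outside (M n) n (d n) (X n) (L n) (b n)))"

definition support_le_whp :: "(nat \<Rightarrow> real) \<Rightarrow> bool"
  where "support_le_whp U \<longleftrightarrow> (\<exists>b. b \<longlonglongrightarrow> 0 \<and> (\<forall>\<^sub>F n in sequentially. support_le_outside (M n) n (d n) (X n) (U n) (b n)))"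

lemma whp_consequences:
  assumes ge: "support_ge_whp L" and le: "support_le_whp U" and U: "\<forall>\<^sub>F n in sequentially. 0 \<le> U n"
    and Y: "\<forall>\<^sub>F n in sequentially. \<forall>\<omega>. dH n \<omega> \<in> {1 - U n..1 - L n} \<longrightarrow> Hmin n \<omega> \<in> {L n..U n} \<longrightarrow> \<bar>Y n \<omega> - c\<bar> \<le> \<epsilon>"
  shows "\<exists>b. b \<longlonglongrightarrow> 0 \<and> (\<forall>\<^sub>F n in sequentially. \<exists>B\<in>sets (M n). measure (M n) B \<le> b n \<and>
      (AE \<omega> in M n. \<omega> \<notin> B \<longrightarrow> \<bar>Y n \<omega> - c\<bar> \<le> \<epsilon>))"
proof -
  obtain b where b: "b \<longlonglongrightarrow> 0" "\<forall>\<^sub>F n in sequentially. support_ge_outside (M n) n (d n) (X n) (L n) (b n)"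
    using ge by (auto simp: support_ge_whp_def)
  obtain b' where b': "b' \<longlonglongrightarrow> 0" "\<forall>\<^sub>F n in sequentially. support_le_outside (M n) n (d n) (X n) (U n) (b' n)"
    using le by (auto simp: support_le_whp_def)
  have "\<forall>\<^sub>F n in sequentially. \<exists>B\<in>sets (M n). measure (M n) B \<le> b n + b' n \<and>
      (AE \<omega> in M n. \<omega> \<notin> B \<longrightarrow> \<bar>Y n \<omega> - c\<bar> \<le> \<epsilon>)"
    using b(2) b'(2) U Y eventually_ge_at_top[of N]
  proof eventually_elim
    fix n assume s: "support_ge_outside (M n) n (d n) (X n) (L n) (b n)" "support_le_outside (M n) n (d n) (X n) (U n) (b' n)"
      "0 \<le> U n" and n: "N \<le> n"
      and Yn: "\<forall>\<omega>. dH n \<omega> \<in> {1 - U n..1 - L n} \<longrightarrow> Hmin n \<omega> \<in> {L n..U n} \<longrightarrow> \<bar>Y n \<omega> - c\<bar> \<le> \<epsilon>"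
    obtain B where B: "B \<in> sets (M n)" "measure (M n) B \<le> b n + b' n"
      "AE \<omega> in M n. \<omega> \<notin> B \<longrightarrow> dH n \<omega> \<in> {1 - U n..1 - L n} \<and> Hmin n \<omega> \<in> {L n..U n}"
      using support_consequences[OF n s] by blast
    have "AE \<omega> in M n. \<omega> \<notin> B \<longrightarrow> \<bar>Y n \<omega> - c\<bar> \<le> \<epsilon>"
      using B(3) by eventually_elim (use Yn in blast)
    then show "\<exists>B\<in>sets (M n). measure (M n) B \<le> b n + b' n \<and> (AE \<omega> in M n. \<omega> \<notin> B \<longrightarrow> \<bar>Y n \<omega> - c\<bar> \<le> \<epsilon>)"
      using B by blast
  qed
  moreover have "(\<lambda>n. b n + b' n) \<longlonglongrightarrow> 0" using tendsto_add[OF b(1) b'(1)] by simp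
  ultimately show ?thesis by blast
qed

lemma eventually_prob_space_M: "\<forall>\<^sub>F n in sequentially. prob_space (M n)"
  using eventually_ge_at_top[of N] by eventually_elim (rule prob_space_M)

text \<open>Facet heights are bounded above only by nonnegative values, hence
  \<open>0 \<le> c\<close>. The lower bound \<open>c - \<epsilon>\<close> may be negative, as
  happens in (iii).\<close>

lemma tendsto_in_prob_support:
  assumes c: "0 \<le> c" and ge: "\<And>\<epsilon>. 0 < \<epsilon> \<Longrightarrow> support_ge_whp (\<lambda>_. c - \<epsilon>)"
    and le: "\<And>\<epsilon>. 0 < \<epsilon> \<Longrightarrow> support_le_whp (\<lambda>_. c + \<epsilon>)"
  shows "tendsto_in_prob M dH (1 - c)" "tendsto_in_prob M (\<lambda>n \<omega>. 1 - Hmin n \<omega>) (1 - c)"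
proof -
  show "tendsto_in_prob M dH (1 - c)"
  proof (rule tendsto_in_probI[OF _ eventually_prob_space_M])
    show "\<forall>\<^sub>F n in sequentially. dH n \<in> borel_measurable (M n)"
      using eventually_ge_at_top[of N] by eventually_elim (rule measurable_dH)
    fix \<epsilon> :: real assume "0 < \<epsilon>"
    then show "\<exists>b. b \<longlonglongrightarrow> 0 \<and> (\<forall>\<^sub>F n in sequentially. \<exists>B\<in>sets (M n). measure (M n) B \<le> b n \<and>
      (AE \<omega> in M n. \<omega> \<notin> B \<longrightarrow> \<bar>dH n \<omega> - (1 - c)\<bar> \<le> \<epsilon>))"
      using c by (intro whp_consequences[OF ge le]) (auto simp: abs_le_iff)
  qed
  show "tendsto_in_prob M (\<lambda>n \<omega>. 1 - Hmin n \<omega>) (1 - c)"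
  proof (rule tendsto_in_probI[OF _ eventually_prob_space_M])
    show "\<forall>\<^sub>F n in sequentially. (\<lambda>\<omega>. 1 - Hmin n \<omega>) \<in> borel_measurable (M n)"
      using eventually_ge_at_top[of N] by eventually_elim (intro borel_measurable_diff borel_measurable_const measurable_Hmin)
    fix \<epsilon> :: real assume "0 < \<epsilon>"
    then show "\<exists>b. b \<longlonglongrightarrow> 0 \<and> (\<forall>\<^sub>F n in sequentially. \<exists>B\<in>sets (M n). measure (M n) B \<le> b n \<and>
      (AE \<omega> in M n. \<omega> \<notin> B \<longrightarrow> \<bar>(1 - Hmin n \<omega>) - (1 - c)\<bar> \<le> \<epsilon>))"
      using c by (intro whp_consequences[OF ge le]) (auto simp: abs_le_iff)
  qed
qed

lemma tendsto_in_prob_support_scaled: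
  assumes s: "\<forall>\<^sub>F n in sequentially. 1 \<le> s n"
    and ge: "\<And>\<epsilon>. 0 < \<epsilon> \<Longrightarrow> \<epsilon> < 1 \<Longrightarrow> support_ge_whp (\<lambda>n. 1 - (1 + \<epsilon>) / (2 * s n))"
    and le: "\<And>\<epsilon>. 0 < \<epsilon> \<Longrightarrow> \<epsilon> < 1 \<Longrightarrow> support_le_whp (\<lambda>n. 1 - (1 - \<epsilon>) / (2 * s n))"
  shows "tendsto_in_prob M (\<lambda>n \<omega>. 2 * s n * dH n \<omega>) 1"
proof (rule tendsto_in_probI[OF _ eventually_prob_space_M])
  show "\<forall>\<^sub>F n in sequentially. (\<lambda>\<omega>. 2 * s n * dH n \<omega>) \<in> borel_measurable (M n)"
    using eventually_ge_at_top[of N] by eventually_elim (intro borel_measurable_times borel_measurable_const measurable_dH)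
  fix \<epsilon> :: real assume e: "0 < \<epsilon>"
  \<comment> \<open>The hypotheses are available only for accuracies below \<open>1\<close>.\<close>
  define \<delta> where "\<delta> = min \<epsilon> (1 / 2)"
  have \<delta>: "0 < \<delta>" "\<delta> < 1" "\<delta> \<le> \<epsilon>" using e by (auto simp: \<delta>_def)
  show "\<exists>b. b \<longlonglongrightarrow> 0 \<and> (\<forall>\<^sub>F n in sequentially. \<exists>B\<in>sets (M n). measure (M n) B \<le> b n \<and>
    (AE \<omega> in M n. \<omega> \<notin> B \<longrightarrow> \<bar>2 * s n * dH n \<omega> - 1\<bar> \<le> \<epsilon>))"
  proof (rule whp_consequences[OF ge[OF \<delta>(1,2)] le[OF \<delta>(1,2)]])
    show "\<forall>\<^sub>F n in sequentially. 0 \<le> 1 - (1 - \<delta>) / (2 * s n)"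
      using s by eventually_elim (use \<delta> in \<open>auto simp: field_simps\<close>)
    show "\<forall>\<^sub>F n in sequentially. \<forall>\<omega>. dH n \<omega> \<in> {1 - (1 - (1 - \<delta>) / (2 * s n))..1 - (1 - (1 + \<delta>) / (2 * s n))} \<longrightarrow>
      Hmin n \<omega> \<in> {1 - (1 + \<delta>) / (2 * s n)..1 - (1 - \<delta>) / (2 * s n)} \<longrightarrow> \<bar>2 * s n * dH n \<omega> - 1\<bar> \<le> \<epsilon>"
      using s
    proof eventually_elim
      fix n assume s: "1 \<le> s n"
      have "\<bar>2 * s n * D - 1\<bar> \<le> \<epsilon>" if "(1 - \<delta>) / (2 * s n) \<le> D" "D \<le> (1 + \<delta>) / (2 * s n)" for D
        using that s \<delta>(3) by (auto simp: field_simps abs_le_iff)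
      then show "\<forall>\<omega>. dH n \<omega> \<in> {1 - (1 - (1 - \<delta>) / (2 * s n))..1 - (1 - (1 + \<delta>) / (2 * s n))} \<longrightarrow>
        Hmin n \<omega> \<in> {1 - (1 + \<delta>) / (2 * s n)..1 - (1 - \<delta>) / (2 * s n)} \<longrightarrow> \<bar>2 * s n * dH n \<omega> - 1\<bar> \<le> \<epsilon>"
        by auto
    qed
  qed
qed

text \<open>A nonnegative lower bound for the support function is exactly the case where
  \<open>hausdorff_dist_eq_min_facet_height\<close> applies.\<close>

lemma prob_dH_eq_tendsto_1:
  assumes c: "0 \<le> c" and ge: "support_ge_whp (\<lambda>_. c)"
  shows "(\<lambda>n. measure (M n) {\<omega> \<in> space (M n). dH n \<omega> = 1 - Hmin n \<omega>}) \<longlonglongrightarrow> 1"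
proof -
  obtain b where b: "b \<longlonglongrightarrow> 0" "\<forall>\<^sub>F n in sequentially. support_ge_outside (M n) n (d n) (X n) c (b n)"
    using ge by (auto simp: support_ge_whp_def)
  have ev: "\<forall>\<^sub>F n in sequentially. 1 - b n \<le> measure (M n) {\<omega> \<in> space (M n). dH n \<omega> = 1 - Hmin n \<omega>} \<and>
      measure (M n) {\<omega> \<in> space (M n). dH n \<omega> = 1 - Hmin n \<omega>} \<le> 1"
    using b(2) eventually_ge_at_top[of N]
  proof eventually_elim
    fix n assume s: "support_ge_outside (M n) n (d n) (X n) c (b n)" and n: "N \<le> n"
    interpret prob_space "M n" by (rule prob_space_M[OF n])
    obtain B where B: "B \<in> sets (M n)" "measure (M n) B \<le> b n"
      "AE \<omega> in M n. \<omega> \<notin> B \<longrightarrow> dH n \<omega> \<le> 1 - c \<and> c \<le> Hmin n \<omega> \<and> (0 \<le> c \<longrightarrow> dH n \<omega> = 1 - Hmin n \<omega>)"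
      using support_ge_consequences[OF n s] by blast
    note [measurable] = measurable_dH[OF n] measurable_Hmin[OF n]
    have m: "{\<omega> \<in> space (M n). dH n \<omega> = 1 - Hmin n \<omega>} \<in> sets (M n)" by measurable
    have "prob (space (M n) - B) \<le> prob {\<omega> \<in> space (M n). dH n \<omega> = 1 - Hmin n \<omega>}"
    proof (rule finite_measure_mono_AE[OF _ m])
      show "AE \<omega> in M n. \<omega> \<in> space (M n) - B \<longrightarrow> \<omega> \<in> {\<omega> \<in> space (M n). dH n \<omega> = 1 - Hmin n \<omega>}"
        using B(3) by eventually_elim (use c in auto)
    qed
    then show "1 - b n \<le> prob {\<omega> \<in> space (M n). dH n \<omega> = 1 - Hmin n \<omega>} \<and>
        prob {\<omega> \<in> space (M n). dH n \<omega> = 1 - Hmin n \<omega>} \<le> 1"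
      using B(1,2) by (simp add: prob_compl)
  qed
  have "(\<lambda>n. 1 - b n) \<longlonglongrightarrow> 1" using tendsto_diff[OF tendsto_const b(1), of 1] by simp
  then show ?thesis
    by (rule tendsto_sandwich[OF _ _ _ tendsto_const, rotated 2])
       (use ev in \<open>auto elim: eventually_mono\<close>)
qed

end

subsection \<open>Asymptotics\<close>

text \<open>In \<open>measure_cap_le\<close> a fixed \<open>\<eta>\<close> can be taken so small
  that \<open>s * sqrt (1 + \<eta>\<^sup>2) \<le> \<sigma>\<close>. The constant absorbs
  \<open>1 / \<eta>\<close> and the one missing factor \<open>s\<close>, and depends neither on
  \<open>d\<close> nor on \<open>u\<close>.\<close>

lemma measure_cap_exp_bound:
  assumes h: "0 \<le> h" "h < 1" and \<sigma>: "sqrt (1 - h\<^sup>2) < \<sigma>"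
  shows "\<exists>C>0. \<forall>d>0. \<forall>u\<in>unit_sphere d. measure (uniform_sphere d) (cap u h) \<le> C * \<sigma> ^ d"
proof -
  define s where "s = sqrt (1 - h\<^sup>2)"
  have "h\<^sup>2 < 1" using h by (simp add: abs_square_less_1)
  then have s: "0 < s" by (simp add: s_def)
  have s\<sigma>: "s < \<sigma>" using \<sigma> by (simp add: s_def)
  define \<eta> where "\<eta> = sqrt (min 1 ((\<sigma> / s)\<^sup>2 - 1))"
  have "1 < (\<sigma> / s)\<^sup>2" using s s\<sigma> by (intro one_less_power) (auto simp: field_simps)
  then have \<eta>: "0 < \<eta>" "\<eta> \<le> 1" "\<eta>\<^sup>2 \<le> (\<sigma> / s)\<^sup>2 - 1" by (auto simp: \<eta>_def min_def)
  have "sqrt (1 + \<eta>\<^sup>2) \<le> \<sigma> / s"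
    using \<eta>(3) s s\<sigma> by (intro real_le_lsqrt) auto
  then have le: "s * sqrt (1 + \<eta>\<^sup>2) \<le> \<sigma>" using s by (simp add: field_simps)
  have "measure (uniform_sphere d) (cap u h) \<le> 1 / (s * \<eta>) * \<sigma> ^ d" if d: "0 < d" "u \<in> unit_sphere d" for d u
  proof -
    have "measure (uniform_sphere d) (cap u h) \<le> s ^ (d - 1) * sqrt (1 + \<eta>\<^sup>2) ^ d / \<eta>"
      unfolding s_def by (rule measure_cap_le[OF d(2,1) h \<eta>(1,2)])
    also have "\<dots> = 1 / (s * \<eta>) * (s * s ^ (d - 1) * sqrt (1 + \<eta>\<^sup>2) ^ d)" using s by simp
    also have "s * s ^ (d - 1) = s ^ d" using d by (metis power_Suc Suc_diff_1)
    also have "s ^ d * sqrt (1 + \<eta>\<^sup>2) ^ d = (s * sqrt (1 + \<eta>\<^sup>2)) ^ d" by (simp add: power_mult_distrib)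
    also have "1 / (s * \<eta>) * \<dots> \<le> 1 / (s * \<eta>) * \<sigma> ^ d"
      using s \<eta> le by (intro mult_left_mono power_mono) auto
    finally show ?thesis .
  qed
  then show ?thesis using s \<eta> by (intro exI[of _ "1 / (s * \<eta>)"]) auto
qed

lemma measure_Compl_cap: "measure (uniform_sphere d) (- cap v h) = 1 - measure (uniform_sphere d) (cap v h)"
proof -
  interpret prob_space "uniform_sphere d" by (rule prob_space_uniform_sphere)
  show ?thesis using prob_compl[of "cap v h"] by (simp add: Compl_eq_Diff_UNIV)
qed

lemma uminus_unit_sphere: "u \<in> unit_sphere d \<Longrightarrow> - u \<in> unit_sphere d"
  by (auto simp: unit_sphere_def)

text \<open>Shows that \<open>d\<close> tends to infinity: with \<open>f\<close> equal to
  \<open>ln n\<close> in (ii) and (iii), and to \<open>ln (ln n)\<close> in the sharp part of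
  (i).\<close>

lemma filterlim_of_ratio_bounded:
  fixes f :: "nat \<Rightarrow> real" and d :: "nat \<Rightarrow> nat"
  assumes f: "filterlim f at_top sequentially" and r: "(\<lambda>n. f n / real (d n)) \<longlonglongrightarrow> \<rho>"
    and d: "\<forall>\<^sub>F n in sequentially. 0 < d n"
  shows "filterlim (\<lambda>n. real (d n)) at_top sequentially"
proof (rule filterlim_at_top_mono)
  define C where "C = \<bar>\<rho>\<bar> + 1"
  have C: "0 < C" "\<rho> < C" by (auto simp: C_def)
  show "filterlim (\<lambda>n. 1 / C * f n) at_top sequentially"
    using C by (intro filterlim_tendsto_pos_mult_at_top[OF tendsto_const _ f]) auto
  show "\<forall>\<^sub>F n in sequentially. 1 / C * f n \<le> real (d n)"
    using order_tendstoD(2)[OF r C(2)] d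
    by eventually_elim (use C in \<open>auto simp: field_simps\<close>)
qed

section \<open>Criteria for bounds with high probability, and the first part of (i)\<close>

context random_sphere_polytopes
begin

lemma eventually_d_bounds: "\<forall>\<^sub>F n in sequentially. n \<ge> N \<and> 2 \<le> d n \<and> d n < n"
  using eventually_ge_at_top[of N] by eventually_elim (simp add: d_bounds)

lemma support_ge_whpI:
  fixes h \<delta> q L :: "nat \<Rightarrow> real"
  assumes ev: "\<forall>\<^sub>F n in sequentially. 0 < \<delta> n \<and> \<delta> n \<le> 1 \<and> L n \<le> h n - \<delta> n \<and>
      (\<forall>v\<in>unit_sphere (d n). measure (uniform_sphere (d n)) (- cap v (h n)) \<le> q n)"
    and lim: "(\<lambda>n. (5 * real (d n) / \<delta> n) ^ d n * q n ^ n) \<longlonglongrightarrow> 0"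
  shows "support_ge_whp L"
  unfolding support_ge_whp_def
proof (intro exI[of _ "\<lambda>n. (5 * real (d n) / \<delta> n) ^ d n * q n ^ n"] conjI)
  show "(\<lambda>n. (5 * real (d n) / \<delta> n) ^ d n * q n ^ n) \<longlonglongrightarrow> 0" by (rule lim)
  show "\<forall>\<^sub>F n in sequentially. support_ge_outside (M n) n (d n) (X n) (L n) ((5 * real (d n) / \<delta> n) ^ d n * q n ^ n)"
    using ev eventually_d_bounds
  proof eventually_elim
    fix n assume a: "0 < \<delta> n \<and> \<delta> n \<le> 1 \<and> L n \<le> h n - \<delta> n \<and>
      (\<forall>v\<in>unit_sphere (d n). measure (uniform_sphere (d n)) (- cap v (h n)) \<le> q n)"
      and n: "n \<ge> N \<and> 2 \<le> d n \<and> d n < n"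
    have \<delta>: "0 < \<delta> n" "\<delta> n \<le> 1" using a by auto
    \<comment> \<open>The grid is just fine enough for mesh \<open>\<delta> n\<close>. Since
      \<open>2 * K + 1 \<le> 2 * d / \<delta> + 3\<close> and \<open>1 \<le> d / \<delta>\<close>,
      the factor \<open>5\<close> suffices.\<close>
    define K where "K = nat \<lceil>sqrt (real (d n)) / \<delta> n\<rceil>"
    have s0: "0 < sqrt (real (d n)) / \<delta> n" using \<delta> n by simp
    have K: "0 < K" "sqrt (real (d n)) / \<delta> n \<le> real K" "real K \<le> sqrt (real (d n)) / \<delta> n + 1"
      using s0 by (auto simp: K_def)
    have "sqrt (real (d n)) / real K \<le> \<delta> n" using K \<delta> by (simp add: field_simps)
    then have L: "L n \<le> h n - sqrt (real (d n)) / real K" using a by auto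
    have q0: "0 \<le> q n"
    proof -
      have "unit_vec 0 \<in> unit_sphere (d n)" using n by (intro unit_vec_in_unit_sphere) simp
      then show ?thesis using a measure_nonneg order_trans by blast
    qed
    have "sqrt (real (d n)) \<le> real (d n)" using n by (intro real_le_lsqrt) (auto simp: power2_eq_square)
    then have "sqrt (real (d n)) / \<delta> n \<le> real (d n) / \<delta> n" using \<delta> by (intro divide_right_mono) auto
    moreover have "1 \<le> real (d n) / \<delta> n" using n \<delta> by (simp add: field_simps)
    ultimately have "2 * real K + 1 \<le> 5 * real (d n) / \<delta> n" using K(3) by simp
    then have le: "(2 * real K + 1) ^ d n * q n ^ n \<le> (5 * real (d n) / \<delta> n) ^ d n * q n ^ n"
      using q0 by (intro mult_right_mono power_mono) auto
    have "support_ge_outside (M n) n (d n) (X n) (L n) ((2 * real K + 1) ^ d n * q n ^ n)"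
      by (rule support_ge_outside_net[OF sample]) (use n a L K in auto)
    then show "support_ge_outside (M n) n (d n) (X n) (L n) ((5 * real (d n) / \<delta> n) ^ d n * q n ^ n)"
      unfolding support_ge_outside_def using le order_trans by blast
  qed
qed

text \<open>By \<open>1 - p \<le> exp (- p)\<close> everything is in the exponent, where the
  logarithm of the net size competes with \<open>n * p\<close>. The majorant \<open>e\<close> is
  meant to be an explicit function of one growing quantity.\<close>

lemma support_ge_whp_exp:
  fixes h \<delta> p L e :: "nat \<Rightarrow> real"
  assumes ev: "\<forall>\<^sub>F n in sequentially. 0 < \<delta> n \<and> \<delta> n \<le> 1 \<and> L n \<le> h n - \<delta> n \<and>
      (\<forall>v\<in>unit_sphere (d n). p n \<le> measure (uniform_sphere (d n)) (cap v (h n)))"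
    and e: "\<forall>\<^sub>F n in sequentially. real (d n) * ln (5 * real (d n) / \<delta> n) - real n * p n \<le> e n"
    and lim: "(\<lambda>n. exp (e n)) \<longlonglongrightarrow> 0"
  shows "support_ge_whp L"
proof (rule support_ge_whpI)
  show "\<forall>\<^sub>F n in sequentially. 0 < \<delta> n \<and> \<delta> n \<le> 1 \<and> L n \<le> h n - \<delta> n \<and>
      (\<forall>v\<in>unit_sphere (d n). measure (uniform_sphere (d n)) (- cap v (h n)) \<le> 1 - p n)"
    using ev by eventually_elim (simp add: measure_Compl_cap)
  have "\<forall>\<^sub>F n in sequentially. 0 \<le> (5 * real (d n) / \<delta> n) ^ d n * (1 - p n) ^ n \<and>
     (5 * real (d n) / \<delta> n) ^ d n * (1 - p n) ^ n \<le> exp (e n)"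
    using ev e eventually_d_bounds
  proof eventually_elim
    fix n assume a: "0 < \<delta> n \<and> \<delta> n \<le> 1 \<and> L n \<le> h n - \<delta> n \<and>
      (\<forall>v\<in>unit_sphere (d n). p n \<le> measure (uniform_sphere (d n)) (cap v (h n)))"
      and e: "real (d n) * ln (5 * real (d n) / \<delta> n) - real n * p n \<le> e n"
      and n: "n \<ge> N \<and> 2 \<le> d n \<and> d n < n"
    interpret U: prob_space "uniform_sphere (d n)" by (rule prob_space_uniform_sphere)
    have "unit_vec 0 \<in> unit_sphere (d n)" using n by (intro unit_vec_in_unit_sphere) simp
    then have p1: "p n \<le> 1" using a U.prob_le_1 order_trans by blast
    have pos: "0 < 5 * real (d n) / \<delta> n" using a n by simp
    have "(1 - p n) ^ n \<le> exp (- p n) ^ n"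
      using p1 exp_ge_add_one_self[of "- p n"] by (intro power_mono) auto
    also have "\<dots> = exp (- (real n * p n))" by (simp flip: exp_of_nat_mult)
    finally have "(5 * real (d n) / \<delta> n) ^ d n * (1 - p n) ^ n
        \<le> (5 * real (d n) / \<delta> n) ^ d n * exp (- (real n * p n))"
      using pos by (intro mult_left_mono) auto
    also have "\<dots> = exp (real (d n) * ln (5 * real (d n) / \<delta> n)) * exp (- (real n * p n))"
      using pos by (simp add: exp_of_nat_mult)
    also have "\<dots> \<le> exp (e n)"
      using e by (simp flip: exp_add)
    finally show "0 \<le> (5 * real (d n) / \<delta> n) ^ d n * (1 - p n) ^ n \<and>
      (5 * real (d n) / \<delta> n) ^ d n * (1 - p n) ^ n \<le> exp (e n)"
      using pos p1 by simp
  qed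
  then show "(\<lambda>n. (5 * real (d n) / \<delta> n) ^ d n * (1 - p n) ^ n) \<longlonglongrightarrow> 0"
    by (intro tendsto_sandwich[OF _ _ tendsto_const lim]) (auto elim: eventually_mono)
qed

lemma support_le_whpI:
  fixes q :: "nat \<Rightarrow> real"
  assumes ev: "\<forall>\<^sub>F n in sequentially. \<forall>u\<in>unit_sphere (d n). real n * measure (uniform_sphere (d n)) (cap u (U n)) \<le> q n"
    and lim: "q \<longlonglongrightarrow> 0"
  shows "support_le_whp U"
  unfolding support_le_whp_def
proof (intro exI[of _ q] conjI)
  show "q \<longlonglongrightarrow> 0" by (rule lim)
  show "\<forall>\<^sub>F n in sequentially. support_le_outside (M n) n (d n) (X n) (U n) (q n)"
    using ev eventually_d_bounds
  proof eventually_elim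
    fix n assume a: "\<forall>u\<in>unit_sphere (d n). real n * measure (uniform_sphere (d n)) (cap u (U n)) \<le> q n"
      and n: "n \<ge> N \<and> 2 \<le> d n \<and> d n < n"
    have u: "unit_vec 0 \<in> unit_sphere (d n)" using n by (intro unit_vec_in_unit_sphere) simp
    then have "support_le_outside (M n) n (d n) (X n) (U n) (real n * measure (uniform_sphere (d n)) (cap (unit_vec 0) (U n)))"
      using n by (intro support_le_outside_direction sample) auto
    then show "support_le_outside (M n) n (d n) (X n) (U n) (q n)"
      unfolding support_le_outside_def using a u order_trans by blast
  qed
qed

text \<open>Supplies the upper bound where \<open>measure_cap_le\<close>, which needs a height below
  \<open>1\<close>, does not apply.\<close>

lemma support_le_whp_ge_1:
  assumes "1 \<le> U"
  shows "support_le_whp (\<lambda>_. U)"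
  unfolding support_le_whp_def
proof (intro exI conjI)
  show "(\<lambda>_. 0 :: real) \<longlonglongrightarrow> 0" by simp
  show "\<forall>\<^sub>F n in sequentially. support_le_outside (M n) n (d n) (X n) U 0"
    using eventually_d_bounds
  proof eventually_elim
    fix n assume n: "n \<ge> N \<and> 2 \<le> d n \<and> d n < n"
    then have u: "unit_vec 0 \<in> unit_sphere (d n)" by (intro unit_vec_in_unit_sphere) simp
    have "AE \<omega> in M n. \<omega> \<notin> {} \<longrightarrow> (\<exists>u\<in>unit_sphere (d n). \<forall>i<n. X n i \<omega> \<bullet> u \<le> U)"
      using AE_general_position[of n] n
    proof (elim conjE)
      assume "n \<ge> N" and g: "n \<ge> N \<Longrightarrow> AE \<omega> in M n. (\<forall>i<n. X n i \<omega> \<in> unit_sphere (d n)) \<and> spread (d n) n (\<lambda>i. X n i \<omega>)"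
      from g[OF this(1)] show ?thesis
      proof eventually_elim
        fix \<omega> assume x: "(\<forall>i<n. X n i \<omega> \<in> unit_sphere (d n)) \<and> spread (d n) n (\<lambda>i. X n i \<omega>)"
        have "X n i \<omega> \<bullet> unit_vec 0 \<le> U" if "i < n" for i
        proof -
          have "norm (X n i \<omega>) = 1" using x that by (intro unit_sphereD) blast
          then show ?thesis using norm_cauchy_schwarz[of "X n i \<omega>" "unit_vec 0"] assms by simp
        qed
        then show "\<omega> \<notin> {} \<longrightarrow> (\<exists>u\<in>unit_sphere (d n). \<forall>i<n. X n i \<omega> \<bullet> u \<le> U)" using u by blast
      qed
    qed
    then show "support_le_outside (M n) n (d n) (X n) U 0"
      unfolding support_le_outside_def by (intro bexI[of _ "{}"]) auto
  qed
qed

text \<open>Caps of fixed size are enough. Their measure is at least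
  \<open>\<kappa> ^ (d - 1) / (3 * d)\<close>, and as \<open>d\<close> is small against
  \<open>ln n\<close> this power exceeds \<open>exp (- ln n / 2)\<close>. So \<open>n * p\<close> is
  at least of order \<open>sqrt n / ln n\<close>, while the net costs at most about
  \<open>ln n * ln (ln n)\<close>.\<close>

lemma support_ge_whp_superexponential:
  assumes r: "(\<lambda>n. real (d n) / ln (real n)) \<longlonglongrightarrow> 0" and \<epsilon>: "0 < \<epsilon>"
  shows "support_ge_whp (\<lambda>_. 1 - \<epsilon>)"
proof -
  \<comment> \<open>One \<open>s\<close> pays for \<open>1 - s \<le> sqrt (1 - s\<^sup>2)\<close>,
    the other for the mesh.\<close>
  define s where "s = min (1 / 2) (\<epsilon> / 2)"
  have s: "0 < s" "s \<le> 1 / 2" "s \<le> \<epsilon> / 2" using \<epsilon> by (auto simp: s_def)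
  define \<delta> where "\<delta> = s"
  define \<kappa> where "\<kappa> = s / (1 + s)"
  have \<kappa>: "0 < \<kappa>" "\<kappa> < 1" using s by (auto simp: \<kappa>_def)
  \<comment> \<open>Chosen so that \<open>d \<le> \<theta> * ln n\<close> implies both
    \<open>d \<le> ln n\<close> and \<open>\<kappa> ^ d \<ge> exp (- ln n / 2)\<close>.\<close>
  define \<theta> where "\<theta> = min 1 (1 / (2 * ln (1 / \<kappa>)))"
  have l: "0 < ln (1 / \<kappa>)" using \<kappa> by simp
  have \<theta>: "0 < \<theta>" "\<theta> \<le> 1" "\<theta> * ln (1 / \<kappa>) \<le> 1 / 2"
    using l by (auto simp: \<theta>_def min_def field_simps)
  define p where "p n = s ^ (d n - 1) / (3 * real (d n) * (1 + s) ^ (d n - 1))" for n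
  define e where "e n = ln (real n) * ln (5 * ln (real n) / \<delta>) - exp (ln (real n) / 2) / (3 * ln (real n))" for n
  show ?thesis
  proof (rule support_ge_whp_exp)
    show "\<forall>\<^sub>F n in sequentially. 0 < \<delta> \<and> \<delta> \<le> 1 \<and> 1 - \<epsilon> \<le> sqrt (1 - s\<^sup>2) - \<delta> \<and>
      (\<forall>v\<in>unit_sphere (d n). p n \<le> measure (uniform_sphere (d n)) (cap v (sqrt (1 - s\<^sup>2))))"
      using eventually_d_bounds
    proof eventually_elim
      fix n assume n: "n \<ge> N \<and> 2 \<le> d n \<and> d n < n"
      have s2: "s\<^sup>2 \<le> s" using s by (simp add: power2_eq_square mult_left_le)
      have "(1 - s)\<^sup>2 \<le> 1 - s\<^sup>2" using s s2 by (simp add: power2_eq_square algebra_simps)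
      then have "1 - s \<le> sqrt (1 - s\<^sup>2)" using s by (intro real_le_rsqrt)
      then show "0 < \<delta> \<and> \<delta> \<le> 1 \<and> 1 - \<epsilon> \<le> sqrt (1 - s\<^sup>2) - \<delta> \<and>
        (\<forall>v\<in>unit_sphere (d n). p n \<le> measure (uniform_sphere (d n)) (cap v (sqrt (1 - s\<^sup>2))))"
      proof (intro conjI ballI)
        show "p n \<le> measure (uniform_sphere (d n)) (cap v (sqrt (1 - s\<^sup>2)))" if "v \<in> unit_sphere (d n)" for v
          unfolding p_def by (rule measure_cap_ge_small[OF that]) (use s n in auto)
      qed (use s in \<open>auto simp: \<delta>_def\<close>)
    qed
    have "filterlim (\<lambda>n. ln (real n)) at_top sequentially" by real_asymp
    then have ln1: "\<forall>\<^sub>F n in sequentially. 1 < ln (real n)" by (simp add: filterlim_at_top_dense)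
    show "\<forall>\<^sub>F n in sequentially. real (d n) * ln (5 * real (d n) / \<delta>) - real n * p n \<le> e n"
      using eventually_d_bounds ln1 order_tendstoD(2)[OF r \<theta>(1)]
    proof eventually_elim
      fix n assume n: "n \<ge> N \<and> 2 \<le> d n \<and> d n < n" and ln1: "1 < ln (real n)" and rn: "real (d n) / ln (real n) < \<theta>"
      define a where "a = ln (real n)"
      have a: "1 < a" using ln1 by (simp add: a_def)
      have da: "real (d n) \<le> \<theta> * a" using rn a by (simp add: a_def field_simps)
      also have "\<dots> \<le> 1 * a" using \<theta> a by (intro mult_right_mono) auto
      finally have da1: "real (d n) \<le> a" by simp
      have d2: "2 \<le> real (d n)" using n by simp
      have "5 * real (d n) / \<delta> \<le> 5 * a / \<delta>" using da1 s by (intro divide_right_mono) (auto simp: \<delta>_def)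
      moreover have "1 \<le> 5 * real (d n) / \<delta>" using d2 s by (simp add: \<delta>_def field_simps)
      ultimately have A: "real (d n) * ln (5 * real (d n) / \<delta>) \<le> a * ln (5 * a / \<delta>)"
        using da1 d2 a by (intro mult_mono) auto
      have "exp (- (a / 2)) \<le> exp (- (real (d n) * ln (1 / \<kappa>)))"
      proof -
        have "real (d n) * ln (1 / \<kappa>) \<le> (\<theta> * a) * ln (1 / \<kappa>)" using da l by (intro mult_right_mono) auto
        also have "\<dots> = (\<theta> * ln (1 / \<kappa>)) * a" by simp
        also have "\<dots> \<le> 1 / 2 * a" using \<theta> a by (intro mult_right_mono) auto
        finally show ?thesis by simp
      qed
      also have "\<dots> = \<kappa> ^ d n" using \<kappa> by (simp add: ln_div exp_of_nat_mult)
      also have "\<dots> \<le> \<kappa> ^ (d n - 1)" using \<kappa> by (intro power_decreasing) auto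
      finally have k: "exp (- (a / 2)) \<le> \<kappa> ^ (d n - 1)" .
      have "exp (a / 2) / (3 * a) \<le> exp (a / 2) / (3 * real (d n))"
        using da1 d2 by (intro divide_left_mono) auto
      also have "\<dots> = real n * exp (- (a / 2)) / (3 * real (d n))"
      proof -
        have "real n = exp a" using n by (simp add: a_def)
        then have E: "exp (a / 2) = real n * exp (- (a / 2))" by (simp flip: exp_add)
        show ?thesis by (simp only: E)
      qed
      also have "real n * exp (- (a / 2)) / (3 * real (d n)) \<le> real n * \<kappa> ^ (d n - 1) / (3 * real (d n))"
        using k by (intro divide_right_mono mult_left_mono) auto
      also have "\<dots> = real n * p n" by (simp add: p_def \<kappa>_def power_divide)
      finally have "exp (a / 2) / (3 * a) \<le> real n * p n" .
      then show "real (d n) * ln (5 * real (d n) / \<delta>) - real n * p n \<le> e n"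
        using A by (simp add: e_def a_def)
    qed
    have \<delta>0: "0 < \<delta>" using s by (simp add: \<delta>_def)
    have "((\<lambda>a::real. exp (a * ln (5 * a / \<delta>) - exp (a / 2) / (3 * a))) \<longlongrightarrow> 0) at_top"
      using \<delta>0 by real_asymp
    then show "(\<lambda>n. exp (e n)) \<longlonglongrightarrow> 0"
      unfolding e_def by (rule filterlim_compose) real_asymp
  qed
qed

end

text \<open>Taylor's coefficient \<open>1 / 8\<close> is enlarged to \<open>1 / 2\<close>, which
  makes the bound valid up to \<open>x = 1\<close>, with equality there.\<close>

lemma sqrt_one_minus_ge:
  fixes x :: real
  assumes "0 \<le> x" "x \<le> 1"
  shows "1 - x / 2 - x\<^sup>2 / 2 \<le> sqrt (1 - x)"
proof (cases "1 - x / 2 - x\<^sup>2 / 2 \<le> 0")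
  case True
  then show ?thesis using assms real_sqrt_ge_zero[of "1 - x"] by linarith
next
  case False
  have "(1 - x / 2 - x\<^sup>2 / 2)\<^sup>2 = 1 - x - x\<^sup>2 * (3 / 4 - x / 2 - x\<^sup>2 / 4)"
    by (simp add: power2_eq_square field_simps)
  moreover have "0 \<le> 3 / 4 - x / 2 - x\<^sup>2 / 4"
    using assms power_le_one[of x 2] by simp
  ultimately have "(1 - x / 2 - x\<^sup>2 / 2)\<^sup>2 \<le> 1 - x" by simp
  then show ?thesis by (intro real_le_rsqrt)
qed

section \<open>Number of points exponential or subexponential in the dimension\<close>

context random_sphere_polytopes
begin

lemma filterlim_ln_n: "filterlim (\<lambda>n. ln (real n)) at_top sequentially"
  by real_asymp

lemma eventually_d_pos: "\<forall>\<^sub>F n in sequentially. 0 < d n"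
  using eventually_d_bounds by eventually_elim simp

text \<open>A cap of height \<open>U\<close> has measure at most \<open>C * \<sigma> ^ d\<close>
  with \<open>\<sigma> < exp (- \<rho>)\<close>, while \<open>n\<close> grows like
  \<open>exp (\<rho> * d)\<close> up to a factor subexponential in \<open>d\<close>. The case
  \<open>\<rho> = 0\<close> serves (iii).\<close>

lemma support_le_whp_exponential:
  assumes r: "(\<lambda>n. ln (real n) / real (d n)) \<longlonglongrightarrow> \<rho>" and \<rho>: "0 \<le> \<rho>" and \<epsilon>: "0 < \<epsilon>"
  shows "support_le_whp (\<lambda>_. sqrt (1 - exp (- 2 * \<rho>)) + \<epsilon>)"
proof (cases "1 \<le> sqrt (1 - exp (- 2 * \<rho>)) + \<epsilon>")
  case True
  then show ?thesis by (rule support_le_whp_ge_1)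
next
  case False
  define U where "U = sqrt (1 - exp (- 2 * \<rho>)) + \<epsilon>"
  have h0: "0 \<le> sqrt (1 - exp (- 2 * \<rho>))" using \<rho> by simp
  have U: "0 < U" "U < 1" using False \<epsilon> h0 unfolding U_def by linarith+
  have "1 - exp (- 2 * \<rho>) = (sqrt (1 - exp (- 2 * \<rho>)))\<^sup>2" using \<rho> by simp
  also have "\<dots> < U\<^sup>2" using h0 \<epsilon> by (intro power_strict_mono) (auto simp: U_def)
  finally have "1 - U\<^sup>2 < (exp (- \<rho>))\<^sup>2" by (simp flip: exp_double)
  then have "sqrt (1 - U\<^sup>2) < exp (- \<rho>)" by (intro real_less_lsqrt) auto
  then obtain \<sigma> where \<sigma>: "sqrt (1 - U\<^sup>2) < \<sigma>" "\<sigma> < exp (- \<rho>)" using dense by blast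
  have "U\<^sup>2 < 1" using U by (simp add: abs_square_less_1)
  then have \<sigma>0: "0 < \<sigma>" using \<sigma>(1) real_sqrt_ge_zero[of "1 - U\<^sup>2"] by linarith
  obtain C where C: "0 < C" "\<And>d u. 0 < d \<Longrightarrow> u \<in> unit_sphere d \<Longrightarrow> measure (uniform_sphere d) (cap u U) \<le> C * \<sigma> ^ d"
    using measure_cap_exp_bound[OF less_imp_le[OF U(1)] U(2) \<sigma>(1)] by blast
  have "ln \<sigma> < - \<rho>" using \<sigma>(2) \<sigma>0 by (metis exp_gt_zero ln_exp ln_less_cancel_iff)
  \<comment> \<open>Half of the gap between \<open>ln \<sigma>\<close> and \<open>- \<rho>\<close>
    pays for the fluctuation of \<open>ln n / d\<close>; the other half remains as rate of
    decay.\<close>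
  define \<kappa> where "\<kappa> = - (ln \<sigma> + \<rho>) / 2"
  have \<kappa>: "0 < \<kappa>" using \<open>ln \<sigma> < - \<rho>\<close> by (simp add: \<kappa>_def)
  have dinf: "filterlim (\<lambda>n. real (d n)) at_top sequentially"
    by (rule filterlim_of_ratio_bounded[OF filterlim_ln_n r eventually_d_pos])
  have "support_le_whp (\<lambda>_. U)"
  proof (rule support_le_whpI)
    have "\<rho> < \<rho> + \<kappa>" using \<kappa> by simp
    from order_tendstoD(2)[OF r this]
    show "\<forall>\<^sub>F n in sequentially. \<forall>u\<in>unit_sphere (d n). real n * measure (uniform_sphere (d n)) (cap u U) \<le> C * exp (- \<kappa> * real (d n))"
      using eventually_d_bounds
    proof eventually_elim
      fix n assume rn: "ln (real n) / real (d n) < \<rho> + \<kappa>" and n: "n \<ge> N \<and> 2 \<le> d n \<and> d n < n"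
      have d0: "0 < real (d n)" using n by simp
      have ln: "ln (real n) \<le> (\<rho> + \<kappa>) * real (d n)" using rn d0 by (simp add: field_simps)
      show "\<forall>u\<in>unit_sphere (d n). real n * measure (uniform_sphere (d n)) (cap u U) \<le> C * exp (- \<kappa> * real (d n))"
      proof
        fix u assume u: "u \<in> unit_sphere (d n)"
        have "real n * measure (uniform_sphere (d n)) (cap u U) \<le> real n * (C * \<sigma> ^ d n)"
          using C(2)[OF _ u] d0 by (intro mult_left_mono) auto
        also have "\<dots> = C * (exp (ln (real n)) * exp (real (d n) * ln \<sigma>))"
          using n \<sigma>0 by (simp add: exp_of_nat_mult)
        also have "\<dots> = C * exp (ln (real n) + real (d n) * ln \<sigma>)" by (simp only: exp_add)
        also have "\<dots> \<le> C * exp (- \<kappa> * real (d n))"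
        proof -
          have "ln (real n) + real (d n) * ln \<sigma> \<le> (\<rho> + \<kappa>) * real (d n) + real (d n) * ln \<sigma>" using ln by simp
          also have "\<dots> = (\<rho> + \<kappa> + ln \<sigma>) * real (d n)" by (simp add: algebra_simps)
          also have "\<rho> + \<kappa> + ln \<sigma> = - \<kappa>" by (simp add: \<kappa>_def field_simps)
          finally show ?thesis using C(1) by simp
        qed
        finally show "real n * measure (uniform_sphere (d n)) (cap u U) \<le> C * exp (- \<kappa> * real (d n))" .
      qed
    qed
    have "((\<lambda>x::real. C * exp (- \<kappa> * x)) \<longlongrightarrow> 0) at_top" using \<kappa> C by real_asymp
    then show "(\<lambda>n. C * exp (- \<kappa> * real (d n))) \<longlonglongrightarrow> 0" by (rule filterlim_compose[OF _ dinf])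
  qed
  then show ?thesis by (simp add: U_def)
qed

text \<open>A height \<open>h\<close> slightly below the limit has
  \<open>s > exp (- \<rho>)\<close>, and a small \<open>\<eta>\<close> preserves this for the base
  \<open>\<theta>\<close> in \<open>measure_cap_ge_slab\<close>. The two caps of height
  \<open>\<eta>\<close> become negligible as \<open>d\<close> grows, so \<open>n * p\<close> is at
  least \<open>exp (\<kappa> * d) / 2\<close>, which beats the net cost of order
  \<open>d * ln d\<close>.\<close>

lemma support_ge_whp_exponential:
  assumes r: "(\<lambda>n. ln (real n) / real (d n)) \<longlonglongrightarrow> \<rho>" and \<rho>: "0 < \<rho>" and \<epsilon>: "0 < \<epsilon>"
  shows "support_ge_whp (\<lambda>_. sqrt (1 - exp (- 2 * \<rho>)) - \<epsilon>)"
proof -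
  define h0 where "h0 = sqrt (1 - exp (- 2 * \<rho>))"
  have h0: "0 < h0" "h0 < 1" using \<rho> by (auto simp: h0_def)
  define h where "h = h0 - min (\<epsilon> / 4) (h0 / 2)"
  have h: "0 < h" "h < h0" "h0 - \<epsilon> / 4 \<le> h" using h0 \<epsilon> by (auto simp: h_def min_def)
  have h1: "h < 1" using h h0 by simp
  define s where "s = sqrt (1 - h\<^sup>2)"
  have "h\<^sup>2 < h0\<^sup>2" using h by (intro power_strict_mono) auto
  also have "h0\<^sup>2 = 1 - (exp (- \<rho>))\<^sup>2" using \<rho> by (simp add: h0_def flip: exp_double)
  finally have "(exp (- \<rho>))\<^sup>2 < 1 - h\<^sup>2" by simp
  then have s: "exp (- \<rho>) < s" unfolding s_def by (rule real_less_rsqrt)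
  \<comment> \<open>As \<open>\<eta>\<close> decreases to \<open>0\<close> the height and the base
    in the slab bound tend to \<open>h\<close> and \<open>s\<close>, so some \<open>\<eta>\<close>
    loses little of either.\<close>
  have t1: "((\<lambda>\<eta>. (h - \<eta>) / sqrt (1 + 2 * h * \<eta>)) \<longlongrightarrow> (h - 0) / sqrt (1 + 2 * h * 0)) (at_right 0)"
    by (intro tendsto_intros) auto
  have t2: "((\<lambda>\<eta>. s / sqrt (1 + 2 * h * \<eta>)) \<longlongrightarrow> s / sqrt (1 + 2 * h * 0)) (at_right 0)"
    by (intro tendsto_intros) auto
  have "\<forall>\<^sub>F \<eta> in at_right 0. h - \<epsilon> / 4 < (h - \<eta>) / sqrt (1 + 2 * h * \<eta>)"
    by (rule order_tendstoD(1)[OF t1]) (use \<epsilon> in simp)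
  moreover have "\<forall>\<^sub>F \<eta> in at_right 0. exp (- \<rho>) < s / sqrt (1 + 2 * h * \<eta>)"
    by (rule order_tendstoD(1)[OF t2]) (use s in simp)
  moreover have "\<forall>\<^sub>F \<eta> in at_right 0. \<eta> \<in> {0<..<h}" by (rule eventually_at_right_real[OF h(1)])
  ultimately have "\<forall>\<^sub>F \<eta> in at_right 0. h - \<epsilon> / 4 < (h - \<eta>) / sqrt (1 + 2 * h * \<eta>) \<and>
    exp (- \<rho>) < s / sqrt (1 + 2 * h * \<eta>) \<and> \<eta> \<in> {0<..<h}"
    by eventually_elim simp
  then obtain \<eta> where \<eta>: "h - \<epsilon> / 4 < (h - \<eta>) / sqrt (1 + 2 * h * \<eta>)"
    "exp (- \<rho>) < s / sqrt (1 + 2 * h * \<eta>)" "0 < \<eta>" "\<eta> < h"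
    using eventually_happens[of _ "at_right (0::real)"] by (auto simp: trivial_limit_at_right_real)
  define \<theta> where "\<theta> = s / sqrt (1 + 2 * h * \<eta>)"
  have \<theta>: "exp (- \<rho>) < \<theta>" using \<eta> by (simp add: \<theta>_def)
  have \<theta>0: "0 < \<theta>" using \<theta> exp_gt_zero[of "- \<rho>"] by linarith
  have ln\<theta>: "- \<rho> < ln \<theta>" using \<theta> \<theta>0 by (metis exp_gt_zero ln_exp ln_less_cancel_iff)
  define \<kappa> where "\<kappa> = (\<rho> + ln \<theta>) / 2"
  have \<kappa>: "0 < \<kappa>" using ln\<theta> by (simp add: \<kappa>_def)
  have \<eta>1: "\<eta> < 1" using \<eta> h1 by simp
  have "0 < \<eta>\<^sup>2" "\<eta>\<^sup>2 < 1" using \<eta>(3) \<eta>1 by (auto simp: abs_square_less_1)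
  then have "sqrt (1 - \<eta>\<^sup>2) < 1" by simp
  then obtain \<sigma> where \<sigma>: "sqrt (1 - \<eta>\<^sup>2) < \<sigma>" "\<sigma> < 1" using dense by blast
  have \<sigma>0: "0 < \<sigma>" using \<sigma>(1) \<open>\<eta>\<^sup>2 < 1\<close> real_sqrt_ge_zero[of "1 - \<eta>\<^sup>2"] by linarith
  obtain C where C: "0 < C" "\<And>d u. 0 < d \<Longrightarrow> u \<in> unit_sphere d \<Longrightarrow> measure (uniform_sphere d) (cap u \<eta>) \<le> C * \<sigma> ^ d"
    using measure_cap_exp_bound[OF less_imp_le[OF \<eta>(3)] \<eta>1 \<sigma>(1)] by blast
  have dinf: "filterlim (\<lambda>n. real (d n)) at_top sequentially"
    by (rule filterlim_of_ratio_bounded[OF filterlim_ln_n r eventually_d_pos])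
  have dinf': "filterlim d at_top sequentially"
    using dinf by (simp add: filterlim_sequentially_iff_filterlim_real)
  have "(\<lambda>n. C * \<sigma> ^ d n) \<longlonglongrightarrow> C * 0"
    using \<sigma> \<sigma>0 by (intro tendsto_mult tendsto_const filterlim_compose[OF LIMSEQ_realpow_zero dinf']) auto
  then have small: "\<forall>\<^sub>F n in sequentially. C * \<sigma> ^ d n < 1 / 4" by (rule order_tendstoD(2)) simp
  \<comment> \<open>At most \<open>\<epsilon> / 4\<close> each is spent on lowering the height to
    \<open>h\<close>, on the slab and on the mesh.\<close>
  define \<delta> where "\<delta> = min 1 (\<epsilon> / 4)"
  have \<delta>: "0 < \<delta>" "\<delta> \<le> 1" "\<delta> \<le> \<epsilon> / 4" using \<epsilon> by (auto simp: \<delta>_def)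
  have "support_ge_whp (\<lambda>_. h0 - \<epsilon>)"
  proof (rule support_ge_whp_exp)
    show "\<forall>\<^sub>F n in sequentially. 0 < \<delta> \<and> \<delta> \<le> 1 \<and> h0 - \<epsilon> \<le> (h - \<eta>) / sqrt (1 + 2 * h * \<eta>) - \<delta> \<and>
      (\<forall>v\<in>unit_sphere (d n). \<theta> ^ d n / 2 \<le> measure (uniform_sphere (d n)) (cap v ((h - \<eta>) / sqrt (1 + 2 * h * \<eta>))))"
      using small eventually_d_bounds
    proof eventually_elim
      fix n assume sm: "C * \<sigma> ^ d n < 1 / 4" and n: "n \<ge> N \<and> 2 \<le> d n \<and> d n < n"
      have d0: "0 < d n" using n by simp
      have "\<theta> ^ d n / 2 \<le> measure (uniform_sphere (d n)) (cap v ((h - \<eta>) / sqrt (1 + 2 * h * \<eta>)))"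
        if v: "v \<in> unit_sphere (d n)" for v
      proof -
        have "\<theta> ^ d n / 2 = \<theta> ^ d n * (1 / 2)" by simp
        also have "\<dots> \<le> \<theta> ^ d n * (1 - measure (uniform_sphere (d n)) (cap v \<eta>) - measure (uniform_sphere (d n)) (cap (- v) \<eta>))"
        proof (rule mult_left_mono)
          show "1 / 2 \<le> 1 - measure (uniform_sphere (d n)) (cap v \<eta>) - measure (uniform_sphere (d n)) (cap (- v) \<eta>)"
            using C(2)[OF d0 v] C(2)[OF d0 uminus_unit_sphere[OF v]] sm by linarith
        qed (use \<theta>0 in simp)
        also have "\<dots> \<le> measure (uniform_sphere (d n)) (cap v ((h - \<eta>) / sqrt (1 + 2 * h * \<eta>)))"
          unfolding \<theta>_def s_def by (rule measure_cap_ge_slab[OF v d0 h(1) h1 \<eta>(3,4)])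
        finally show ?thesis .
      qed
      moreover have "h0 - \<epsilon> \<le> (h - \<eta>) / sqrt (1 + 2 * h * \<eta>) - \<delta>" using \<eta>(1) h(3) \<delta> by linarith
      ultimately show "0 < \<delta> \<and> \<delta> \<le> 1 \<and> h0 - \<epsilon> \<le> (h - \<eta>) / sqrt (1 + 2 * h * \<eta>) - \<delta> \<and>
        (\<forall>v\<in>unit_sphere (d n). \<theta> ^ d n / 2 \<le> measure (uniform_sphere (d n)) (cap v ((h - \<eta>) / sqrt (1 + 2 * h * \<eta>))))"
        using \<delta> by blast
    qed
    have "\<rho> - \<kappa> < \<rho>" using \<kappa> by simp
    from order_tendstoD(1)[OF r this]
    show "\<forall>\<^sub>F n in sequentially. real (d n) * ln (5 * real (d n) / \<delta>) - real n * (\<theta> ^ d n / 2)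
      \<le> real (d n) * ln (5 * real (d n) / \<delta>) - exp (\<kappa> * real (d n)) / 2"
      using eventually_d_bounds
    proof eventually_elim
      fix n assume rn: "\<rho> - \<kappa> < ln (real n) / real (d n)" and n: "n \<ge> N \<and> 2 \<le> d n \<and> d n < n"
      have d0: "0 < real (d n)" using n by simp
      have "\<kappa> * real (d n) = (\<rho> - \<kappa>) * real (d n) + real (d n) * ln \<theta>" by (simp add: \<kappa>_def field_simps)
      also have "\<dots> \<le> ln (real n) + real (d n) * ln \<theta>" using rn d0 by (simp add: field_simps)
      finally have "exp (\<kappa> * real (d n)) \<le> exp (ln (real n) + real (d n) * ln \<theta>)" by simp
      also have "\<dots> = real n * \<theta> ^ d n" using n \<theta>0 by (simp add: exp_add exp_of_nat_mult)
      finally show "real (d n) * ln (5 * real (d n) / \<delta>) - real n * (\<theta> ^ d n / 2)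
        \<le> real (d n) * ln (5 * real (d n) / \<delta>) - exp (\<kappa> * real (d n)) / 2" by simp
    qed
    have "((\<lambda>x::real. exp (x * ln (5 * x / \<delta>) - exp (\<kappa> * x) / 2)) \<longlongrightarrow> 0) at_top"
      using \<delta>(1) \<kappa> by real_asymp
    then show "(\<lambda>n. exp (real (d n) * ln (5 * real (d n) / \<delta>) - exp (\<kappa> * real (d n)) / 2)) \<longlonglongrightarrow> 0"
      by (rule filterlim_compose[OF _ dinf])
  qed
  then show ?thesis by (simp add: h0_def)
qed

text \<open>Missing a cap of height \<open>- \<delta>\<close> means lying in the opposite cap of
  height \<open>\<delta>\<close>, with probability \<open>q \<le> C * \<sigma> ^ d\<close>. Since
  \<open>n > d\<close>, the union bound is at most
  \<open>(5 * d / \<delta> * C * \<sigma> ^ d) ^ d\<close>, and its base tends to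
  \<open>0\<close>.\<close>

lemma support_ge_whp_subexponential:
  assumes r: "(\<lambda>n. ln (real n) / real (d n)) \<longlonglongrightarrow> 0" and \<epsilon>: "0 < \<epsilon>"
  shows "support_ge_whp (\<lambda>_. - \<epsilon>)"
proof -
  define \<delta> where "\<delta> = min \<epsilon> 1 / 2"
  have \<delta>: "0 < \<delta>" "\<delta> < 1" "2 * \<delta> \<le> \<epsilon>" using \<epsilon> by (auto simp: \<delta>_def)
  have "0 < \<delta>\<^sup>2" "\<delta>\<^sup>2 < 1" using \<delta> by (auto simp: abs_square_less_1)
  then have "sqrt (1 - \<delta>\<^sup>2) < 1" by simp
  then obtain \<sigma> where \<sigma>: "sqrt (1 - \<delta>\<^sup>2) < \<sigma>" "\<sigma> < 1" using dense by blast
  have \<sigma>0: "0 < \<sigma>" using \<sigma>(1) \<open>\<delta>\<^sup>2 < 1\<close> real_sqrt_ge_zero[of "1 - \<delta>\<^sup>2"] by linarith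
  obtain C where C: "0 < C" "\<And>d u. 0 < d \<Longrightarrow> u \<in> unit_sphere d \<Longrightarrow> measure (uniform_sphere d) (cap u \<delta>) \<le> C * \<sigma> ^ d"
    using measure_cap_exp_bound[OF less_imp_le[OF \<delta>(1)] \<delta>(2) \<sigma>(1)] by blast
  have dinf: "filterlim (\<lambda>n. real (d n)) at_top sequentially"
    by (rule filterlim_of_ratio_bounded[OF filterlim_ln_n r eventually_d_pos])
  have pw: "\<sigma> ^ k = exp (- (- ln \<sigma>) * real k)" for k using \<sigma>0 by (simp add: exp_of_nat2_mult)
  have l: "0 < - ln \<sigma>" using \<sigma> \<sigma>0 by simp
  define g where "g x = 5 * x / \<delta> * (C * exp (- (- ln \<sigma>) * x))" for x
  have "(g \<longlongrightarrow> 0) at_top" unfolding g_def using l C(1) \<delta>(1) by real_asymp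
  then have g0: "(\<lambda>n. g (real (d n))) \<longlonglongrightarrow> 0" by (rule filterlim_compose[OF _ dinf])
  have "((\<lambda>x. C * exp (- (- ln \<sigma>) * x)) \<longlongrightarrow> 0) at_top" using l C(1) by real_asymp
  then have "(\<lambda>n. C * exp (- (- ln \<sigma>) * real (d n))) \<longlonglongrightarrow> 0" by (rule filterlim_compose[OF _ dinf])
  then have q1: "\<forall>\<^sub>F n in sequentially. C * \<sigma> ^ d n < 1" unfolding pw by (rule order_tendstoD(2)) simp
  show ?thesis
  proof (rule support_ge_whpI)
    show "\<forall>\<^sub>F n in sequentially. 0 < \<delta> \<and> \<delta> \<le> 1 \<and> - \<epsilon> \<le> - \<delta> - \<delta> \<and>
      (\<forall>v\<in>unit_sphere (d n). measure (uniform_sphere (d n)) (- cap v (- \<delta>)) \<le> C * \<sigma> ^ d n)"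
      using eventually_d_bounds
    proof eventually_elim
      fix n assume n: "n \<ge> N \<and> 2 \<le> d n \<and> d n < n"
      interpret U: prob_space "uniform_sphere (d n)" by (rule prob_space_uniform_sphere)
      have "measure (uniform_sphere (d n)) (- cap v (- \<delta>)) \<le> C * \<sigma> ^ d n" if v: "v \<in> unit_sphere (d n)" for v
      proof -
        have "measure (uniform_sphere (d n)) (- cap v (- \<delta>)) \<le> measure (uniform_sphere (d n)) (cap (- v) \<delta>)"
          by (rule U.finite_measure_mono) (auto simp: cap_def)
        also have "\<dots> \<le> C * \<sigma> ^ d n" using n by (intro C(2) uminus_unit_sphere v) auto
        finally show ?thesis .
      qed
      then show "0 < \<delta> \<and> \<delta> \<le> 1 \<and> - \<epsilon> \<le> - \<delta> - \<delta> \<and>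
        (\<forall>v\<in>unit_sphere (d n). measure (uniform_sphere (d n)) (- cap v (- \<delta>)) \<le> C * \<sigma> ^ d n)"
        using \<delta> by auto
    qed
    have "\<forall>\<^sub>F n in sequentially. 0 \<le> (5 * real (d n) / \<delta>) ^ d n * (C * \<sigma> ^ d n) ^ n \<and>
      (5 * real (d n) / \<delta>) ^ d n * (C * \<sigma> ^ d n) ^ n \<le> g (real (d n))"
      using eventually_d_bounds q1 order_tendstoD(2)[OF g0 zero_less_one]
    proof eventually_elim
      fix n assume n: "n \<ge> N \<and> 2 \<le> d n \<and> d n < n" and q1: "C * \<sigma> ^ d n < 1" and g1: "g (real (d n)) < 1"
      have q0: "0 \<le> C * \<sigma> ^ d n" using C(1) \<sigma>0 by simp
      have b0: "0 \<le> 5 * real (d n) / \<delta>" using \<delta> by simp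
      have geq: "g (real (d n)) = 5 * real (d n) / \<delta> * (C * \<sigma> ^ d n)" by (simp only: g_def pw)
      have g0: "0 \<le> g (real (d n))" unfolding geq by (rule mult_nonneg_nonneg[OF b0 q0])
      have "(C * \<sigma> ^ d n) ^ n \<le> (C * \<sigma> ^ d n) ^ d n"
        using q0 q1 n by (intro power_decreasing) auto
      then have "(5 * real (d n) / \<delta>) ^ d n * (C * \<sigma> ^ d n) ^ n \<le> (5 * real (d n) / \<delta>) ^ d n * (C * \<sigma> ^ d n) ^ d n"
        using b0 by (intro mult_left_mono) auto
      also have "\<dots> = g (real (d n)) ^ d n" unfolding geq by (rule power_mult_distrib[symmetric])
      also have "\<dots> \<le> g (real (d n)) ^ 1" using g0 g1 n by (intro power_decreasing) auto
      finally show "0 \<le> (5 * real (d n) / \<delta>) ^ d n * (C * \<sigma> ^ d n) ^ n \<and>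
        (5 * real (d n) / \<delta>) ^ d n * (C * \<sigma> ^ d n) ^ n \<le> g (real (d n))"
        using b0 q0 by simp
    qed
    then show "(\<lambda>n. (5 * real (d n) / \<delta>) ^ d n * (C * \<sigma> ^ d n) ^ n) \<longlonglongrightarrow> 0"
      by (intro tendsto_sandwich[OF _ _ tendsto_const g0]) (auto elim: eventually_mono)
  qed
qed

end

section \<open>The sharp rate in (i)\<close>

context random_sphere_polytopes
begin

text \<open>A cap of radius \<open>s\<close> has measure roughly \<open>s ^ (d - 1)\<close>, so the
  critical radius, where this is \<open>1 / n\<close>, is \<open>1 / sqrt (scale n)\<close>. The
  corresponding height falls short of \<open>1\<close> by about \<open>s\<^sup>2 / 2\<close>, which
  is \<open>1 / (2 * scale n)\<close>.\<close>

definition scale :: "nat \<Rightarrow> real"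
  where "scale n = real n powr (2 / (real (d n) - 1))"

lemma sqrt_scale_power:
  assumes "n \<ge> N"
  shows "sqrt (scale n) ^ (d n - 1) = real n"
proof -
  have n: "0 < real n" "2 \<le> d n" using d_bounds[OF assms] by auto
  have "sqrt (scale n) = scale n powr (1 / 2)" by (rule powr_half_sqrt[symmetric]) (simp add: scale_def)
  also have "\<dots> = real n powr (2 / (real (d n) - 1) * (1 / 2))" unfolding scale_def by (rule powr_powr)
  also have "2 / (real (d n) - 1) * (1 / 2) = 1 / (real (d n) - 1)"
  proof -
    have "2 / x * (1 / 2) = 1 / x" for x :: real by simp
    then show ?thesis .
  qed
  finally have "sqrt (scale n) ^ (d n - 1) = (real n powr (1 / (real (d n) - 1))) ^ (d n - 1)" by simp
  also have "\<dots> = real n powr (1 / (real (d n) - 1) * real (d n - 1))" using n by (simp add: powr_power)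
  also have "1 / (real (d n) - 1) * real (d n - 1) = 1" using n by (simp add: of_nat_diff)
  finally show ?thesis using n by simp
qed

lemma filterlim_scale:
  assumes r: "(\<lambda>n. real (d n) / ln (real n)) \<longlonglongrightarrow> 0"
  shows "filterlim scale at_top sequentially"
  unfolding filterlim_at_top_gt[where c = 0]
proof (intro allI impI)
  fix Z :: real assume Z: "0 < Z"
  then have "0 < 2 / Z" by simp
  from order_tendstoD(2)[OF r this]
  show "\<forall>\<^sub>F n in sequentially. Z \<le> scale n"
    using eventually_d_bounds eventually_gt_at_top[of 1]
  proof eventually_elim
    fix n assume rn: "real (d n) / ln (real n) < 2 / Z" and n: "n \<ge> N \<and> 2 \<le> d n \<and> d n < n" and n1: "1 < n"
    have l: "0 < ln (real n)" using n1 by simp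
    have "Z * real (d n) \<le> 2 * ln (real n)" using rn l Z by (simp add: field_simps)
    then have "Z * (real (d n) - 1) \<le> 2 * ln (real n)" using Z by (simp add: right_diff_distrib)
    then have "Z \<le> 2 * ln (real n) / (real (d n) - 1)" using n by (simp add: pos_le_divide_eq)
    also have "\<dots> \<le> exp (2 * ln (real n) / (real (d n) - 1))" using exp_ge_add_one_self[of "2 * ln (real n) / (real (d n) - 1)"] by linarith
    also have "\<dots> = scale n" using n1 by (simp add: scale_def powr_def)
    finally show "Z \<le> scale n" .
  qed
qed

lemma filterlim_d_sharp:
  assumes "(\<lambda>n. ln (ln (real n)) / real (d n)) \<longlonglongrightarrow> 0"
  shows "filterlim (\<lambda>n. real (d n)) at_top sequentially"
  by (rule filterlim_of_ratio_bounded[OF _ assms eventually_d_pos]) real_asymp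

text \<open>The radius exceeds the critical one by the factor \<open>\<beta>\<close>, which gains
  \<open>\<beta> ^ (d - 1)\<close>. The loss from \<open>(1 + \<sigma>) ^ (d - 1)\<close> is at most
  the square root of this gain, so \<open>n * p \<ge> \<gamma> ^ (d - 1) / (3 * d)\<close>. Taking
  \<open>\<kappa>\<close> as half of \<open>ln \<gamma>\<close> makes this outgrow
  \<open>ln n \<le> exp (\<kappa> * d)\<close>.\<close>

lemma support_ge_whp_sharp:
  assumes r: "(\<lambda>n. real (d n) / ln (real n)) \<longlonglongrightarrow> 0" and l: "(\<lambda>n. ln (ln (real n)) / real (d n)) \<longlonglongrightarrow> 0"
    and \<epsilon>: "0 < \<epsilon>" "\<epsilon> < 1"
  shows "support_ge_whp (\<lambda>n. 1 - (1 + \<epsilon>) / (2 * scale n))"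
proof -
  \<comment> \<open>The deficit \<open>\<sigma>\<^sup>2 / 2\<close> uses only
    \<open>1 + \<epsilon> / 2\<close> of the allowed \<open>1 + \<epsilon>\<close>. The rest,
    \<open>\<epsilon> / (4 * scale n)\<close>, is shared equally by the second-order term of the
    square root and the mesh \<open>\<delta> n\<close>.\<close>
  define \<beta> where "\<beta> = sqrt (1 + \<epsilon> / 2)"
  have \<beta>: "1 < \<beta>" "\<beta>\<^sup>2 = 1 + \<epsilon> / 2" using \<epsilon> by (auto simp: \<beta>_def)
  define \<gamma> where "\<gamma> = sqrt \<beta>"
  have \<gamma>: "1 < \<gamma>" "\<gamma> * \<gamma> = \<beta>" using \<beta> by (auto simp: \<gamma>_def)
  define \<kappa> where "\<kappa> = ln \<gamma> / 2"
  have \<kappa>: "0 < \<kappa>" using \<gamma> by (simp add: \<kappa>_def)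
  define \<sigma> where "\<sigma> n = \<beta> / sqrt (scale n)" for n
  define \<delta> where "\<delta> n = \<epsilon> / (8 * scale n)" for n
  define p where "p n = \<sigma> n ^ (d n - 1) / (3 * real (d n) * (1 + \<sigma> n) ^ (d n - 1))" for n
  have dinf: "filterlim (\<lambda>n. real (d n)) at_top sequentially" by (rule filterlim_d_sharp[OF l])
  have ev_scale: "\<forall>\<^sub>F n in sequentially. Z \<le> scale n" for Z
    using filterlim_scale[OF r] by (simp add: filterlim_at_top)
  have big: "\<forall>\<^sub>F n in sequentially. 1 \<le> scale n \<and> 9 / \<epsilon> \<le> scale n \<and> 0 < \<sigma> n \<and> \<sigma> n \<le> 1 / 2 \<and> 1 + \<sigma> n \<le> \<gamma>"
    using ev_scale[of 1] ev_scale[of "9 / \<epsilon>"] ev_scale[of "(2 * \<beta>)\<^sup>2"] ev_scale[of "(\<beta> / (\<gamma> - 1))\<^sup>2"]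
  proof eventually_elim
    fix n assume s: "1 \<le> scale n" "9 / \<epsilon> \<le> scale n" "(2 * \<beta>)\<^sup>2 \<le> scale n" "(\<beta> / (\<gamma> - 1))\<^sup>2 \<le> scale n"
    have s1: "2 * \<beta> \<le> sqrt (scale n)" using s(3) by (rule real_le_rsqrt)
    have s2: "\<beta> / (\<gamma> - 1) \<le> sqrt (scale n)" using s(4) by (rule real_le_rsqrt)
    have s0: "0 < sqrt (scale n)" using s(1) by simp
    have "\<sigma> n \<le> 1 / 2" using s1 s0 by (simp add: \<sigma>_def field_simps)
    moreover have "\<sigma> n \<le> \<gamma> - 1" using s2 s0 \<gamma>(1) by (simp add: \<sigma>_def field_simps)
    moreover have "0 < \<sigma> n" using \<beta> s0 by (simp add: \<sigma>_def)
    ultimately show "1 \<le> scale n \<and> 9 / \<epsilon> \<le> scale n \<and> 0 < \<sigma> n \<and> \<sigma> n \<le> 1 / 2 \<and> 1 + \<sigma> n \<le> \<gamma>"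
      using s by auto
  qed
  define e where "e x = x * ln (40 * x / \<epsilon>) + 4 * exp (\<kappa> * x) - exp ((x - 1) * (2 * \<kappa>)) / (3 * x)" for x
  show ?thesis
  proof (rule support_ge_whp_exp)
    show "\<forall>\<^sub>F n in sequentially. 0 < \<delta> n \<and> \<delta> n \<le> 1 \<and> 1 - (1 + \<epsilon>) / (2 * scale n) \<le> sqrt (1 - (\<sigma> n)\<^sup>2) - \<delta> n \<and>
      (\<forall>v\<in>unit_sphere (d n). p n \<le> measure (uniform_sphere (d n)) (cap v (sqrt (1 - (\<sigma> n)\<^sup>2))))"
      using big eventually_d_bounds
    proof eventually_elim
      fix n assume b: "1 \<le> scale n \<and> 9 / \<epsilon> \<le> scale n \<and> 0 < \<sigma> n \<and> \<sigma> n \<le> 1 / 2 \<and> 1 + \<sigma> n \<le> \<gamma>"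
        and n: "n \<ge> N \<and> 2 \<le> d n \<and> d n < n"
      define t where "t = 1 / scale n"
      have t: "0 < t" "t \<le> 1" "t \<le> \<epsilon> / 9" using b \<epsilon> by (auto simp: t_def field_simps)
      have \<delta>t: "\<delta> n = \<epsilon> / 8 * t" by (simp add: \<delta>_def t_def)
      have \<sigma>t: "(\<sigma> n)\<^sup>2 = (1 + \<epsilon> / 2) * t" using b \<beta>(2) by (simp add: \<sigma>_def t_def power_divide)
      have "(\<sigma> n)\<^sup>2 \<le> 1" using b by (intro power_le_one) auto
      then have h: "1 - (\<sigma> n)\<^sup>2 / 2 - ((\<sigma> n)\<^sup>2)\<^sup>2 / 2 \<le> sqrt (1 - (\<sigma> n)\<^sup>2)"
        by (intro sqrt_one_minus_ge) auto
      \<comment> \<open>Here \<open>9 / \<epsilon> \<le> scale n\<close> is used: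
        \<open>9 / 4 * (\<epsilon> / 9)\<close> is the \<open>\<epsilon> / 4\<close> allotted to the
        squared term before halving.\<close>
      have "(1 + \<epsilon> / 2)\<^sup>2 \<le> (3 / 2)\<^sup>2" using \<epsilon> by (intro power_mono) auto
      then have "(1 + \<epsilon> / 2)\<^sup>2 * t \<le> (3 / 2)\<^sup>2 * (\<epsilon> / 9)" using t by (intro mult_mono) auto
      then have "(1 + \<epsilon> / 2)\<^sup>2 * t * t \<le> \<epsilon> / 4 * t" using t by (intro mult_right_mono) (auto simp: power2_eq_square)
      then have "((\<sigma> n)\<^sup>2)\<^sup>2 \<le> \<epsilon> / 4 * t" unfolding \<sigma>t by (simp add: power2_eq_square algebra_simps)
      moreover have "(\<sigma> n)\<^sup>2 = t + \<epsilon> * t / 2" "(1 + \<epsilon>) / 2 * t = t / 2 + \<epsilon> * t / 2" "\<epsilon> / 4 * t = \<epsilon> * t / 4" "\<delta> n = \<epsilon> * t / 8"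
        unfolding \<sigma>t \<delta>t by (simp_all add: field_simps)
      ultimately have "1 - (1 + \<epsilon>) / 2 * t \<le> sqrt (1 - (\<sigma> n)\<^sup>2) - \<delta> n"
        using h by linarith
      then have "1 - (1 + \<epsilon>) / (2 * scale n) \<le> sqrt (1 - (\<sigma> n)\<^sup>2) - \<delta> n" by (simp add: t_def)
      moreover have "0 < \<delta> n" "\<delta> n \<le> 1" unfolding \<delta>t using t \<epsilon> mult_le_one[of "\<epsilon> / 8" t] by auto
      moreover have "p n \<le> measure (uniform_sphere (d n)) (cap v (sqrt (1 - (\<sigma> n)\<^sup>2)))" if "v \<in> unit_sphere (d n)" for v
        unfolding p_def by (rule measure_cap_ge_small[OF that]) (use b n in auto)
      ultimately show "0 < \<delta> n \<and> \<delta> n \<le> 1 \<and> 1 - (1 + \<epsilon>) / (2 * scale n) \<le> sqrt (1 - (\<sigma> n)\<^sup>2) - \<delta> n \<and>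
        (\<forall>v\<in>unit_sphere (d n). p n \<le> measure (uniform_sphere (d n)) (cap v (sqrt (1 - (\<sigma> n)\<^sup>2))))" by blast
    qed
    show "\<forall>\<^sub>F n in sequentially. real (d n) * ln (5 * real (d n) / \<delta> n) - real n * p n \<le> e (real (d n))"
      using big eventually_d_bounds order_tendstoD(2)[OF l \<kappa>] eventually_gt_at_top[of 2]
    proof eventually_elim
      fix n assume b: "1 \<le> scale n \<and> 9 / \<epsilon> \<le> scale n \<and> 0 < \<sigma> n \<and> \<sigma> n \<le> 1 / 2 \<and> 1 + \<sigma> n \<le> \<gamma>"
        and n: "n \<ge> N \<and> 2 \<le> d n \<and> d n < n" and ln: "ln (ln (real n)) / real (d n) < \<kappa>" and n2: "2 < n"
      have d2: "2 \<le> real (d n)" using n by simp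
      have ln0: "0 < ln (real n)" using n2 by simp
      have "ln (ln (real n)) \<le> \<kappa> * real (d n)" using ln d2 by (simp add: field_simps)
      then have lnn: "ln (real n) \<le> exp (\<kappa> * real (d n))" using ln0 by (metis exp_le_cancel_iff exp_ln)
      have "real (d n) * ln (5 * real (d n) / \<delta> n) = real (d n) * ln (40 * real (d n) / \<epsilon>) + real (d n) * ln (scale n)"
      proof -
        have "5 * real (d n) / \<delta> n = (40 * real (d n) / \<epsilon>) * scale n" by (simp add: \<delta>_def)
        moreover have "ln ((40 * real (d n) / \<epsilon>) * scale n) = ln (40 * real (d n) / \<epsilon>) + ln (scale n)"
          using d2 \<epsilon> b by (intro ln_mult_pos) auto
        ultimately show ?thesis by (simp only: distrib_left)
      qed
      \<comment> \<open>The logarithm of the scale is \<open>2 * ln n / (d - 1)\<close>, and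
        \<open>2 * d / (d - 1) \<le> 4\<close> for \<open>d \<ge> 2\<close>.\<close>
      also have "real (d n) * ln (scale n) = (2 * real (d n) / (real (d n) - 1)) * ln (real n)"
        using n2 by (simp add: scale_def ln_powr)
      also have "\<dots> \<le> 4 * ln (real n)"
        using d2 ln0 by (intro mult_right_mono) (auto simp: divide_le_eq)
      also have "\<dots> \<le> 4 * exp (\<kappa> * real (d n))" using lnn by simp
      finally have A: "real (d n) * ln (5 * real (d n) / \<delta> n) \<le> real (d n) * ln (40 * real (d n) / \<epsilon>) + 4 * exp (\<kappa> * real (d n))"
        by simp
      have "exp ((real (d n) - 1) * (2 * \<kappa>)) = \<gamma> ^ (d n - 1)"
      proof -
        have d1: "real (d n) - 1 = real (d n - 1)" using n by (simp add: of_nat_diff)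
        have k2: "2 * \<kappa> = ln \<gamma>" by (simp add: \<kappa>_def)
        have "exp (real (d n - 1) * ln \<gamma>) = \<gamma> ^ (d n - 1)"
          using \<gamma> by (subst exp_of_nat_mult) simp
        then show ?thesis unfolding d1 k2 .
      qed
      also have "\<dots> \<le> (\<beta> / (1 + \<sigma> n)) ^ (d n - 1)"
      proof (rule power_mono)
        have "\<gamma> * (1 + \<sigma> n) \<le> \<beta>" unfolding \<gamma>(2)[symmetric] using b \<gamma> by (intro mult_left_mono) auto
        then show "\<gamma> \<le> \<beta> / (1 + \<sigma> n)" using b by (simp add: pos_le_divide_eq)
      qed (use \<gamma> in simp)
      also have "\<dots> = sqrt (scale n) ^ (d n - 1) * \<sigma> n ^ (d n - 1) / (1 + \<sigma> n) ^ (d n - 1)"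
        using b by (simp add: \<sigma>_def power_divide)
      finally have "exp ((real (d n) - 1) * (2 * \<kappa>)) \<le> real n * \<sigma> n ^ (d n - 1) / (1 + \<sigma> n) ^ (d n - 1)"
        using sqrt_scale_power[of n] n by simp
      then have "exp ((real (d n) - 1) * (2 * \<kappa>)) / (3 * real (d n)) \<le> real n * \<sigma> n ^ (d n - 1) / (1 + \<sigma> n) ^ (d n - 1) / (3 * real (d n))"
        by (rule divide_right_mono) simp
      also have "\<dots> = real n * p n" by (simp add: p_def)
      finally show "real (d n) * ln (5 * real (d n) / \<delta> n) - real n * p n \<le> e (real (d n))"
        using A by (simp add: e_def)
    qed
    have "((\<lambda>x. exp (e x)) \<longlongrightarrow> 0) at_top"
      unfolding e_def using \<kappa> \<epsilon> by real_asymp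
    then show "(\<lambda>n. exp (e (real (d n)))) \<longlonglongrightarrow> 0" by (rule filterlim_compose[OF _ dinf])
  qed
qed

text \<open>In \<open>measure_cap_le\<close> with \<open>\<eta> = sqrt \<epsilon>\<close> the factor
  \<open>n\<close> cancels against the power of the scale. What remains is a constant times
  \<open>sqrt (1 - \<epsilon>\<^sup>2) ^ (d - 1)\<close>, which vanishes as \<open>d\<close> tends
  to infinity.\<close>

lemma support_le_whp_sharp:
  assumes r: "(\<lambda>n. real (d n) / ln (real n)) \<longlonglongrightarrow> 0" and l: "(\<lambda>n. ln (ln (real n)) / real (d n)) \<longlonglongrightarrow> 0"
    and \<epsilon>: "0 < \<epsilon>" "\<epsilon> < 1"
  shows "support_le_whp (\<lambda>n. 1 - (1 - \<epsilon>) / (2 * scale n))"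
proof (rule support_le_whpI)
  define \<nu> where "\<nu> = sqrt (1 - \<epsilon>) * sqrt (1 + \<epsilon>)"
  define c where "c = sqrt (1 + \<epsilon>) / sqrt \<epsilon>"
  have "\<epsilon>\<^sup>2 < 1" using \<epsilon> by (simp add: abs_square_less_1)
  moreover have "\<nu> = sqrt (1 - \<epsilon>\<^sup>2)"
    by (simp add: \<nu>_def real_sqrt_mult[symmetric] power2_eq_square algebra_simps)
  ultimately have \<nu>: "0 \<le> \<nu>" "\<nu> < 1" using \<epsilon> by auto
  have ev: "\<forall>\<^sub>F n in sequentially. 1 \<le> scale n"
    using filterlim_scale[OF r] by (simp add: filterlim_at_top)
  show "\<forall>\<^sub>F n in sequentially. \<forall>u\<in>unit_sphere (d n).
      real n * measure (uniform_sphere (d n)) (cap u (1 - (1 - \<epsilon>) / (2 * scale n))) \<le> \<nu> ^ (d n - 1) * c"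
    using ev eventually_d_bounds
  proof eventually_elim
    fix n assume s: "1 \<le> scale n" and n: "n \<ge> N \<and> 2 \<le> d n \<and> d n < n"
    define U where "U = 1 - (1 - \<epsilon>) / (2 * scale n)"
    have U: "0 \<le> U" "U < 1" using s \<epsilon> by (auto simp: U_def field_simps)
    have "1 - U\<^sup>2 \<le> 2 * (1 - U)" using zero_le_power2[of "1 - U"] by (simp add: power2_eq_square algebra_simps)
    also have "\<dots> = (1 - \<epsilon>) / scale n"
    proof -
      have "scale n \<noteq> 0" using s by simp
      then show ?thesis by (simp add: U_def field_simps)
    qed
    finally have "sqrt (1 - U\<^sup>2) \<le> sqrt ((1 - \<epsilon>) / scale n)" by (rule real_sqrt_le_mono)
    then have sU: "sqrt (1 - U\<^sup>2) \<le> sqrt (1 - \<epsilon>) / sqrt (scale n)" by (simp add: real_sqrt_divide)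
    have U1: "0 \<le> 1 - U\<^sup>2" using U by (simp add: power_le_one)
    show "\<forall>u\<in>unit_sphere (d n). real n * measure (uniform_sphere (d n)) (cap u (1 - (1 - \<epsilon>) / (2 * scale n))) \<le> \<nu> ^ (d n - 1) * c"
      unfolding U_def[symmetric]
    proof
      fix u assume u: "u \<in> unit_sphere (d n)"
      have "measure (uniform_sphere (d n)) (cap u U) \<le> sqrt (1 - U\<^sup>2) ^ (d n - 1) * sqrt (1 + (sqrt \<epsilon>)\<^sup>2) ^ d n / sqrt \<epsilon>"
        using n \<epsilon> by (intro measure_cap_le u U) auto
      also have "\<dots> \<le> (sqrt (1 - \<epsilon>) / sqrt (scale n)) ^ (d n - 1) * sqrt (1 + (sqrt \<epsilon>)\<^sup>2) ^ d n / sqrt \<epsilon>"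
        using sU U1 \<epsilon> by (intro divide_right_mono mult_right_mono power_mono) auto
      finally have "real n * measure (uniform_sphere (d n)) (cap u U)
          \<le> real n * ((sqrt (1 - \<epsilon>) / sqrt (scale n)) ^ (d n - 1) * sqrt (1 + (sqrt \<epsilon>)\<^sup>2) ^ d n / sqrt \<epsilon>)"
        by (rule mult_left_mono) simp
      also have "\<dots> = (real n / sqrt (scale n) ^ (d n - 1)) * (sqrt (1 - \<epsilon>) ^ (d n - 1) * sqrt (1 + \<epsilon>) ^ d n / sqrt \<epsilon>)"
        using \<epsilon> by (simp add: power_divide)
      also have "real n / sqrt (scale n) ^ (d n - 1) = 1"
        using sqrt_scale_power[of n] n by simp
      also have "sqrt (1 + \<epsilon>) ^ d n = sqrt (1 + \<epsilon>) * sqrt (1 + \<epsilon>) ^ (d n - 1)"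
        using n by (metis One_nat_def Suc_1 Suc_diff_1 Suc_le_lessD less_trans power_Suc zero_less_Suc)
      finally show "real n * measure (uniform_sphere (d n)) (cap u U) \<le> \<nu> ^ (d n - 1) * c"
        by (simp add: \<nu>_def c_def power_mult_distrib mult_ac)
    qed
  qed
  have "filterlim d at_top sequentially"
    using filterlim_d_sharp[OF l] by (simp add: filterlim_sequentially_iff_filterlim_real)
  then have dinf: "filterlim (\<lambda>n. d n - 1) at_top sequentially"
    by (rule filterlim_compose[OF filterlim_minus_const_nat_at_top])
  have "(\<lambda>n. \<nu> ^ (d n - 1) * c) \<longlonglongrightarrow> 0 * c"
    by (intro tendsto_mult tendsto_const filterlim_compose[OF LIMSEQ_realpow_zero dinf] \<nu>)
  then show "(\<lambda>n. \<nu> ^ (d n - 1) * c) \<longlonglongrightarrow> 0" by simp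
qed

end

text \<open>If the polytope misses the origin, its nearest point to the origin may lie on a face of
  lower dimension, and then \<open>dH = 1 - Hmin\<close> fails. The equality is therefore asserted
  almost surely on \<open>0 \<in> P n \<omega>\<close> and with probability tending to
  \<open>1\<close> in (i) and (ii), while the limits are stated for both quantities
  throughout.\<close>

theorem corollary14:
  fixes d :: "nat \<Rightarrow> nat" and N :: nat
    and M :: "nat \<Rightarrow> 'w measure" and X :: "nat \<Rightarrow> nat \<Rightarrow> 'w \<Rightarrow> fseq"
    and P :: "nat \<Rightarrow> 'w \<Rightarrow> fseq set" and dH Hmin :: "nat \<Rightarrow> 'w \<Rightarrow> real"
  defines "P \<equiv> \<lambda>n. rand_polytope n (X n)"
  defines "dH \<equiv> \<lambda>n \<omega>. hausdorff_dist (P n \<omega>) (unit_ball (d n))"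
    and "Hmin \<equiv> \<lambda>n \<omega>. min_facet_height (d n) (P n \<omega>)"
  assumes d_range: "\<And>n. n \<ge> N \<Longrightarrow> d n \<in> {2..n - 1}"
    and d_const_or_infty: "(\<exists>c. \<forall>n\<ge>N. d n = c) \<or> filterlim d at_top sequentially"
    and sample: "\<And>n. n \<ge> N \<Longrightarrow> uniform_sphere_sample (M n) n (d n) (X n)"
  shows
    "(\<forall>n\<ge>N. AE \<omega> in M n. 0 \<in> P n \<omega> \<longrightarrow> dH n \<omega> = 1 - Hmin n \<omega>)
     \<and> \<comment> \<open>(i)\<close>
     ((\<lambda>n. real (d n) / ln (real n)) \<longlonglongrightarrow> 0 \<longrightarrow>
        (\<lambda>n. measure (M n) {\<omega> \<in> space (M n). dH n \<omega> = 1 - Hmin n \<omega>}) \<longlonglongrightarrow> 1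
        \<and> tendsto_in_prob M dH 0
        \<and> tendsto_in_prob M (\<lambda>n \<omega>. 1 - Hmin n \<omega>) 0
        \<and> ((\<lambda>n. ln (ln (real n)) / real (d n)) \<longlonglongrightarrow> 0 \<longrightarrow>
             tendsto_in_prob M (\<lambda>n \<omega>. 2 * real n powr (2 / (real (d n) - 1)) * dH n \<omega>) 1))
     \<and> \<comment> \<open>(ii)\<close>
     (\<forall>\<rho>>0. (\<lambda>n. ln (real n) / real (d n)) \<longlonglongrightarrow> \<rho> \<longrightarrow>
        (\<lambda>n. measure (M n) {\<omega> \<in> space (M n). dH n \<omega> = 1 - Hmin n \<omega>}) \<longlonglongrightarrow> 1
        \<and> tendsto_in_prob M dH (1 - sqrt (1 - exp (- 2 * \<rho>)))
        \<and> tendsto_in_prob M (\<lambda>n \<omega>. 1 - Hmin n \<omega>) (1 - sqrt (1 - exp (- 2 * \<rho>))))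
     \<and> \<comment> \<open>(iii)\<close>
     ((\<lambda>n. ln (real n) / real (d n)) \<longlonglongrightarrow> 0 \<longrightarrow>
        tendsto_in_prob M dH 1
        \<and> tendsto_in_prob M (\<lambda>n \<omega>. 1 - Hmin n \<omega>) 1)"
proof -
  interpret R: random_sphere_polytopes d N M X
    by unfold_locales (fact d_range, fact sample)
  have dH: "dH = R.dH" and Hmin: "Hmin = R.Hmin"
    by (simp_all add: dH_def Hmin_def P_def fun_eq_iff)
  have 0: "\<forall>n\<ge>N. AE \<omega> in M n. 0 \<in> P n \<omega> \<longrightarrow> dH n \<omega> = 1 - Hmin n \<omega>"
    unfolding dH Hmin unfolding P_def using R.AE_dH_eq by blast
  have le1: "R.support_le_whp (\<lambda>_. 1 + \<epsilon>)" if "0 < \<epsilon>" for \<epsilon>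
    using that by (intro R.support_le_whp_ge_1) simp
  have 1: "(\<lambda>n. measure (M n) {\<omega> \<in> space (M n). dH n \<omega> = 1 - Hmin n \<omega>}) \<longlonglongrightarrow> 1"
    "tendsto_in_prob M dH 0" "tendsto_in_prob M (\<lambda>n \<omega>. 1 - Hmin n \<omega>) 0"
    if r: "(\<lambda>n. real (d n) / ln (real n)) \<longlonglongrightarrow> 0"
    unfolding dH Hmin
    using R.prob_dH_eq_tendsto_1[of 0] R.support_ge_whp_superexponential[OF r, of 1]
      R.tendsto_in_prob_support[OF zero_le_one R.support_ge_whp_superexponential[OF r] le1]
    by simp_all
  have 2: "tendsto_in_prob M (\<lambda>n \<omega>. 2 * real n powr (2 / (real (d n) - 1)) * dH n \<omega>) 1"
    if r: "(\<lambda>n. real (d n) / ln (real n)) \<longlonglongrightarrow> 0" and l: "(\<lambda>n. ln (ln (real n)) / real (d n)) \<longlonglongrightarrow> 0"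
    unfolding dH R.scale_def[symmetric]
  proof (rule R.tendsto_in_prob_support_scaled)
    show "\<forall>\<^sub>F n in sequentially. 1 \<le> R.scale n"
      using R.filterlim_scale[OF r] by (simp add: filterlim_at_top)
  qed (rule R.support_ge_whp_sharp[OF r l] R.support_le_whp_sharp[OF r l]; assumption)+
  have 3: "(\<lambda>n. measure (M n) {\<omega> \<in> space (M n). dH n \<omega> = 1 - Hmin n \<omega>}) \<longlonglongrightarrow> 1"
    "tendsto_in_prob M dH (1 - sqrt (1 - exp (- 2 * \<rho>)))"
    "tendsto_in_prob M (\<lambda>n \<omega>. 1 - Hmin n \<omega>) (1 - sqrt (1 - exp (- 2 * \<rho>)))"
    if \<rho>: "0 < \<rho>" and r: "(\<lambda>n. ln (real n) / real (d n)) \<longlonglongrightarrow> \<rho>" for \<rho>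
  proof -
    define h where "h = sqrt (1 - exp (- 2 * \<rho>))"
    have h: "0 < h" using \<rho> by (simp add: h_def)
    have ge: "R.support_ge_whp (\<lambda>_. h - \<epsilon>)" if "0 < \<epsilon>" for \<epsilon>
      unfolding h_def by (rule R.support_ge_whp_exponential[OF r \<rho> that])
    have le: "R.support_le_whp (\<lambda>_. h + \<epsilon>)" if "0 < \<epsilon>" for \<epsilon>
      unfolding h_def by (rule R.support_le_whp_exponential[OF r less_imp_le[OF \<rho>] that])
    show "(\<lambda>n. measure (M n) {\<omega> \<in> space (M n). dH n \<omega> = 1 - Hmin n \<omega>}) \<longlonglongrightarrow> 1"
      unfolding dH Hmin using R.prob_dH_eq_tendsto_1[of 0] ge[OF h] by simp
    show "tendsto_in_prob M dH (1 - sqrt (1 - exp (- 2 * \<rho>)))"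
      "tendsto_in_prob M (\<lambda>n \<omega>. 1 - Hmin n \<omega>) (1 - sqrt (1 - exp (- 2 * \<rho>)))"
      unfolding dH Hmin h_def[symmetric]
      by (rule R.tendsto_in_prob_support[OF less_imp_le[OF h] ge le]; assumption)+
  qed
  have 4: "tendsto_in_prob M dH 1" "tendsto_in_prob M (\<lambda>n \<omega>. 1 - Hmin n \<omega>) 1"
    if r: "(\<lambda>n. ln (real n) / real (d n)) \<longlonglongrightarrow> 0"
  proof -
    have ge: "R.support_ge_whp (\<lambda>_. 0 - \<epsilon>)" if "0 < \<epsilon>" for \<epsilon>
      using R.support_ge_whp_subexponential[OF r that] by simp
    \<comment> \<open>The exponential bound at \<open>\<rho> = 0\<close>, where
      \<open>sqrt (1 - exp 0)\<close> is \<open>0\<close>.\<close>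
    have le: "R.support_le_whp (\<lambda>_. 0 + \<epsilon>)" if "0 < \<epsilon>" for \<epsilon>
      using R.support_le_whp_exponential[OF r order_refl that] by simp
    show "tendsto_in_prob M dH 1" "tendsto_in_prob M (\<lambda>n \<omega>. 1 - Hmin n \<omega>) 1"
      unfolding dH Hmin using R.tendsto_in_prob_support[OF order_refl ge le] by simp_all
  qed
  show ?thesis using 0 1 2 3 4 by blast
qed

end
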